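(* Let $\alpha,\alpha',\beta,\beta',\gamma,\rho,a\in\mathbb{C}$ with $a\neq 0$, and let $\mu$ be a real number, such that $\operatorname{Re}(\gamma)>0$, $\mu>0$ and $\operatorname{Re}(\rho)>\max\{0,\operatorname{Re}(\alpha'-\beta'),\operatorname{Re}(\alpha+\alpha'+\beta-\gamma)\}$. Then for every $x>0$, $$\left(\mathcal{I}_{0+}^{\alpha,\alpha',\beta,\beta',\gamma}\left(t^{\rho-1}I^{m,n}_{p,q}\left[at^{\mu}\,\middle|\begin{matrix}(a_i,A_i,\alpha_i)_{1,p}\\(b_j,B_j,\beta_j)_{1,q}\end{matrix}\right]\right)\right)(x)=x^{-\alpha-\alpha'+\gamma+\rho-1}\,I^{m,n+3}_{p+3,q+3}\left[ax^{\mu}\,\middle|\begin{matrix}U\\L\end{matrix}\right],$$ where the list of upper triples is $$U=(1-\rho,\mu,1),\ (1+\alpha'-\beta'-\rho,\mu,1),\ (1+\alpha+\alpha'+\beta-\gamma-\rho,\mu,1),\ (a_i,A_i,\alpha_i)_{1,p}$$ and the list of lower triples is $$L=(b_j,B_j,\beta_j)_{1,q},\ (1-\beta'-\rho,\mu,1),\ (1+\alpha+\alpha'-\gamma-\rho,\mu,1),\ (1+\alpha'+\beta-\gamma-\rho,\mu,1).$$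
   Context: **$I$-function.** Let $m,n,p,q$ be integers with $0\le m\le q$, $0\le n\le p$; let $a_i\in\mathbb{C}$, $A_i,\alpha_i>0$ $(1\le i\le p)$ and $b_j\in\mathbb{C}$, $B_j,\beta_j>0$ $(1\le j\le q)$. For $z\neq0$ (with a chosen value of $\arg z$; $z^{-s}=e^{-s(\log|z|+i\arg z)}$), $$I^{m,n}_{p,q}\left[z\,\middle|\begin{matrix}(a_i,A_i,\alpha_i)_{1,p}\\(b_j,B_j,\beta_j)_{1,q}\end{matrix}\right]=\frac{1}{2\pi i}\int_{C}\chi(s)z^{-s}\,ds,\qquad \chi(s)=\frac{\prod_{j=1}^{m}\Gamma^{\beta_j}(b_j+B_js)\prod_{i=1}^{n}\Gamma^{\alpha_i}(1-a_i-A_is)}{\prod_{j=m+1}^{q}\Gamma^{\beta_j}(1-b_j-B_js)\prod_{i=n+1}^{p}\Gamma^{\alpha_i}(a_i+A_is)}.$$ Here $(a_i,A_i,\alpha_i)_{1,p}$ is the ordered list of triples for $i=1,\dots,p$ (the first $n$ upper triples and the first $m$ lower triples enter the numerator), $\Gamma^{\kappa}(w)=(\Gamma(w))^{\kappa}$, with the branch of non-integer powers fixed along $C$ and the same for the same triple in all $I$-functions considered; empty products equal $1$. The singularities of $\Gamma^{\beta_j}(b_j+B_js)$, $j\le m$, lie to the left of $C$ and those of $\Gamma^{\alpha_i}(1-a_i-A_is)$, $i\le n$, to the right. **Standing assumptions.** The contour $C$ is the imaginary axis $\operatorname{Re}(s)=0$, traversed upwards, and for each $I$-function occurring the following conditions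 for absolute convergence hold: with (computed from the parameters of that $I$-function) $\mu^*=\sum_{j=1}^q\beta_jB_j-\sum_{i=1}^p\alpha_iA_i$, $\Omega=\sum_{i=1}^p(\frac12-\operatorname{Re}(a_i))\alpha_i-\sum_{j=1}^q(\frac12-\operatorname{Re}(b_j))\beta_j$, $\Delta=\sum_{j=1}^m\beta_jB_j-\sum_{j=m+1}^q\beta_jB_j+\sum_{i=1}^n\alpha_iA_i-\sum_{i=n+1}^p\alpha_iA_i$, either $\Delta>0$ and $|\arg z|<\frac{\pi}{2}\Delta$, or $\Delta\ge0$, $|\arg z|=\frac{\pi}{2}\Delta$ and one of: $\mu^*=0$ and $\Omega<-1$; or $\mu^*\ne0$ and $\Omega+\sigma\mu^*<-1$ where $\sigma=\operatorname{Re}(s)$ on $C$ (so $\sigma=0$). For $t>0$, $\arg(at^{\pm\mu})=\arg a$. **Operator.** For $\operatorname{Re}(\gamma)>0$, $x>0$, the left-sided Marichev–Saigo–Maeda (MSM) fractional integral is $$\left(\mathcal{I}_{0+}^{\alpha,\alpha',\beta,\beta',\gamma}f\right)(x)=\frac{x^{-\alpha}}{\Gamma(\gamma)}\int_0^x(x-t)^{\gamma-1}t^{-\alpha'}F_3\left(\alpha,\alpha',\beta,\beta';\gamma;1-\tfrac{t}{x},1-\tfrac{x}{t}\right)f(t)\,dt .$$ $F_3(\alpha,\alpha',\beta,\beta';\gamma;u,v)=\sum_{k,l\ge0}\frac{(\alpha)_k(\alpha')_l(\beta)_k(\beta')_l}{(\gamma)_{k+l}}\frac{u^kv^l}{k!\,l!}$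 for $\max\{|u|,|v|\}<1$ (third Appell function, $(\cdot)_k$ the Pochhammer symbol), and for $u\in[0,1)$, $v\le0$ it denotes the analytic continuation $\sum_{k\ge0}\frac{(\alpha)_k(\beta)_k}{(\gamma)_k}\frac{u^k}{k!}\,{}_2F_1(\alpha',\beta';\gamma+k;v)$. *)

theory Defs
  imports "HOL-Complex_Analysis.Complex_Analysis"
begin

unbundle no vec_syntax

section \<open>The I-function\<close>

text \<open>A parameter triple \<open>(a, A, \<alpha>)\<close>: shift, slope and exponent of a Gamma factor.\<close>

type_synonym triple = "complex \<times> real \<times> real"

text \<open>
  A branch assignment \<open>\<Lambda>\<close> provides, for the Gamma factor \<open>\<Gamma>(c + C s)\<close> raised to the power \<open>\<kappa>\<close>,
  a logarithm \<open>\<Lambda> c C \<kappa> s\<close> of \<open>\<Gamma>(c + C s)\<close> at the points \<open>s\<close> of the contour \<open>Re s = 0\<close>.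
  A triple \<open>(a, A, \<alpha>)\<close> occurs through \<open>\<Gamma>\<^sup>\<alpha>(a + A s)\<close> or through \<open>\<Gamma>\<^sup>\<alpha>(1 - a - A s)\<close>, that is with
  \<open>(c, C, \<kappa>) = (a, A, \<alpha>)\<close> or \<open>(1 - a, -A, \<alpha>)\<close>; so the branch depends on the triple only, and
  I-functions formed with the same \<open>\<Lambda>\<close> use the same branch for the same triple.
  A pole of the Gamma factor on the contour (possible in the denominator only) cuts the contour
  in two, and the branch is then fixed on either side of it.
\<close>

type_synonym branch = "complex \<Rightarrow> real \<Rightarrow> real \<Rightarrow> complex \<Rightarrow> complex"

definition log_Gamma_branch :: "branch \<Rightarrow> bool" where
  "log_Gamma_branch \<Lambda> \<longleftrightarrow>
     (\<forall>c C \<kappa>. let S = {s. Re s = 0 \<and> c + of_real C * s \<notin> \<int>\<^sub>\<le>\<^sub>0} in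
        continuous_on S (\<Lambda> c C \<kappa>) \<and>
        (\<forall>s\<in>S. exp (\<Lambda> c C \<kappa> s) = Gamma (c + of_real C * s)))"

text \<open>
  \<open>\<Gamma>\<^sup>\<kappa>(c + C s)\<close>. The value \<open>0\<close> at a pole is the library's convention for \<open>Gamma\<close>; it matters for
  denominators only, where by \<open>1 / 0 = 0\<close> it yields the correct value of \<open>1 / \<Gamma>\<^sup>\<kappa>\<close> for \<open>\<kappa> > 0\<close>.
\<close>

definition Gamma_pow :: "branch \<Rightarrow> complex \<Rightarrow> real \<Rightarrow> real \<Rightarrow> complex \<Rightarrow> complex" where
  "Gamma_pow \<Lambda> c C \<kappa> s =
     (if c + of_real C * s \<in> \<int>\<^sub>\<le>\<^sub>0 then 0 else exp (of_real \<kappa> * \<Lambda> c C \<kappa> s))"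

text \<open>
  In the following, \<open>us\<close> and \<open>ls\<close> are the lists of upper and lower triples, so that
  \<open>p = length us\<close> and \<open>q = length ls\<close>.
\<close>

definition I_kernel ::
  "branch \<Rightarrow> nat \<Rightarrow> nat \<Rightarrow> triple list \<Rightarrow> triple list \<Rightarrow> complex \<Rightarrow> complex" where
  "I_kernel \<Lambda> m n us ls s =
     ((\<Prod>(b, B, \<beta>)\<leftarrow>take m ls. Gamma_pow \<Lambda> b B \<beta> s) *
      (\<Prod>(a, A, \<alpha>)\<leftarrow>take n us. Gamma_pow \<Lambda> (1 - a) (- A) \<alpha> s)) /
     ((\<Prod>(b, B, \<beta>)\<leftarrow>drop m ls. Gamma_pow \<Lambda> (1 - b) (- B) \<beta> s) *
      (\<Prod>(a, A, \<alpha>)\<leftarrow>drop n us. Gamma_pow \<Lambda> a A \<alpha> s))"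

text \<open>
  \<open>\<theta>\<close> is the chosen value of \<open>arg z\<close>. The contour is parametrised by \<open>s = \<i> \<tau>\<close>, \<open>ds = \<i> d\<tau>\<close>.
\<close>

definition I_fun ::
  "branch \<Rightarrow> nat \<Rightarrow> nat \<Rightarrow> triple list \<Rightarrow> triple list \<Rightarrow> real \<Rightarrow> complex \<Rightarrow> complex" where
  "I_fun \<Lambda> m n us ls \<theta> z =
     1 / (2 * of_real pi * \<i>) *
     (\<integral>\<tau>. I_kernel \<Lambda> m n us ls (\<i> * of_real \<tau>) *
          exp (- (\<i> * of_real \<tau>) * (of_real (ln (cmod z)) + \<i> * of_real \<theta>)) * \<i> \<partial>lborel)"

definition I_mu :: "triple list \<Rightarrow> triple list \<Rightarrow> real" where
  "I_mu us ls = (\<Sum>(b, B, \<beta>)\<leftarrow>ls. \<beta> * B) - (\<Sum>(a, A, \<alpha>)\<leftarrow>us. \<alpha> * A)"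

definition I_Omega :: "triple list \<Rightarrow> triple list \<Rightarrow> real" where
  "I_Omega us ls =
     (\<Sum>(a, A, \<alpha>)\<leftarrow>us. (1/2 - Re a) * \<alpha>) - (\<Sum>(b, B, \<beta>)\<leftarrow>ls. (1/2 - Re b) * \<beta>)"

definition I_Delta :: "nat \<Rightarrow> nat \<Rightarrow> triple list \<Rightarrow> triple list \<Rightarrow> real" where
  "I_Delta m n us ls =
     (\<Sum>(b, B, \<beta>)\<leftarrow>take m ls. \<beta> * B) - (\<Sum>(b, B, \<beta>)\<leftarrow>drop m ls. \<beta> * B) +
     (\<Sum>(a, A, \<alpha>)\<leftarrow>take n us. \<alpha> * A) - (\<Sum>(a, A, \<alpha>)\<leftarrow>drop n us. \<alpha> * A)"

text \<open>Absolute convergence of the integral along \<open>Re s = \<sigma>\<close> for \<open>arg z = \<theta>\<close>.\<close>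

definition I_convergence ::
  "real \<Rightarrow> nat \<Rightarrow> nat \<Rightarrow> triple list \<Rightarrow> triple list \<Rightarrow> real \<Rightarrow> bool" where
  "I_convergence \<sigma> m n us ls \<theta> \<longleftrightarrow>
     (let \<mu> = I_mu us ls; \<Omega> = I_Omega us ls; \<Delta> = I_Delta m n us ls in
        (\<Delta> > 0 \<and> \<bar>\<theta>\<bar> < pi / 2 * \<Delta>) \<or>
        (\<Delta> \<ge> 0 \<and> \<bar>\<theta>\<bar> = pi / 2 * \<Delta> \<and>
          ((\<mu> = 0 \<and> \<Omega> < - 1) \<or> (\<mu> \<noteq> 0 \<and> \<Omega> + \<sigma> * \<mu> < - 1))))"

text \<open>
  The contour \<open>Re s = 0\<close> separates the singularities of the numerator factors. The singularities
  of \<open>\<Gamma>\<^sup>\<kappa>(w)\<close> are the poles \<open>w \<in> \<int>\<^sub>\<le>\<^sub>0\<close> of \<open>\<Gamma>\<close>, as \<open>\<Gamma>\<close> has no zeros.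
\<close>

definition I_separation :: "nat \<Rightarrow> nat \<Rightarrow> triple list \<Rightarrow> triple list \<Rightarrow> bool" where
  "I_separation m n us ls \<longleftrightarrow>
     (\<forall>(b, B, \<beta>)\<in>set (take m ls). \<forall>s. b + of_real B * s \<in> \<int>\<^sub>\<le>\<^sub>0 \<longrightarrow> Re s < 0) \<and>
     (\<forall>(a, A, \<alpha>)\<in>set (take n us). \<forall>s. 1 - a - of_real A * s \<in> \<int>\<^sub>\<le>\<^sub>0 \<longrightarrow> Re s > 0)"

definition I_admissible ::
  "nat \<Rightarrow> nat \<Rightarrow> triple list \<Rightarrow> triple list \<Rightarrow> real \<Rightarrow> bool" where
  "I_admissible m n us ls \<theta> \<longleftrightarrow>
     m \<le> length ls \<and> n \<le> length us \<and>
     (\<forall>(a, A, \<alpha>)\<in>set us. A > 0 \<and> \<alpha> > 0) \<and> (\<forall>(b, B, \<beta>)\<in>set ls. B > 0 \<and> \<beta> > 0) \<and>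
     I_separation m n us ls \<and> I_convergence 0 m n us ls \<theta>"


section \<open>Hypergeometric functions\<close>

text \<open>
  Gauss's function: the value at \<open>z\<close> of the analytic continuation of the power series along the
  segment from \<open>0\<close> to \<open>z\<close>. On the complex plane slit along \<open>[1, \<infinity>)\<close> this is the principal branch.
  By the identity theorem the value does not depend on the choice of the convex set \<open>S\<close>.
\<close>

definition hyp2F1 :: "complex \<Rightarrow> complex \<Rightarrow> complex \<Rightarrow> complex \<Rightarrow> complex" where
  "hyp2F1 a b c z =
     (THE w. \<exists>S f. open S \<and> convex S \<and> 0 \<in> S \<and> z \<in> S \<and> f holomorphic_on S \<and>
        (\<forall>y\<in>S. cmod y < 1 \<longrightarrow>
           (\<lambda>k. pochhammer a k * pochhammer b k / pochhammer c k * y ^ k / fact k) sums f y) \<and>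
        w = f z)"

text \<open>
  Appell's third function: the double series for \<open>max {|u|, |v|} < 1\<close>, and its analytic
  continuation for \<open>u \<in> [0, 1)\<close>, \<open>v \<le> 0\<close>. Where both apply, they agree, since
  \<open>(\<gamma>)\<^bsub>k+l\<^esub> = (\<gamma>)\<^bsub>k\<^esub> (\<gamma> + k)\<^bsub>l\<^esub>\<close>.
\<close>

definition appell_F3 ::
  "complex \<Rightarrow> complex \<Rightarrow> complex \<Rightarrow> complex \<Rightarrow> complex \<Rightarrow> complex \<Rightarrow> complex \<Rightarrow> complex" where
  "appell_F3 \<alpha> \<alpha>' \<beta> \<beta>' \<gamma> u v =
     (if u \<in> of_real ` {0..<1} \<and> v \<in> of_real ` {..0}
      then \<Sum>k. pochhammer \<alpha> k * pochhammer \<beta> k / pochhammer \<gamma> k * u ^ k / fact k *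
                 hyp2F1 \<alpha>' \<beta>' (\<gamma> + of_nat k) v
      else \<Sum>\<^sub>\<infinity>(k, l)\<in>UNIV.
             pochhammer \<alpha> k * pochhammer \<alpha>' l * pochhammer \<beta> k * pochhammer \<beta>' l /
             pochhammer \<gamma> (k + l) * (u ^ k * v ^ l / (fact k * fact l)))"


section \<open>The left-sided Marichev--Saigo--Maeda fractional integral\<close>

definition msm_integrand ::
  "complex \<Rightarrow> complex \<Rightarrow> complex \<Rightarrow> complex \<Rightarrow> complex \<Rightarrow> (real \<Rightarrow> complex) \<Rightarrow> real \<Rightarrow> real \<Rightarrow> complex"
  where
  "msm_integrand \<alpha> \<alpha>' \<beta> \<beta>' \<gamma> f x t =
     of_real (x - t) powr (\<gamma> - 1) * of_real t powr (- \<alpha>') *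
     appell_F3 \<alpha> \<alpha>' \<beta> \<beta>' \<gamma> (of_real (1 - t / x)) (of_real (1 - x / t)) * f t"

definition msm_integral ::
  "complex \<Rightarrow> complex \<Rightarrow> complex \<Rightarrow> complex \<Rightarrow> complex \<Rightarrow> (real \<Rightarrow> complex) \<Rightarrow> real \<Rightarrow> complex"
  where
  "msm_integral \<alpha> \<alpha>' \<beta> \<beta>' \<gamma> f x =
     of_real x powr (- \<alpha>) / Gamma \<gamma> * (LBINT t:{0<..<x}. msm_integrand \<alpha> \<alpha>' \<beta> \<beta>' \<gamma> f x t)"

text \<open>The integral exists as a Lebesgue integral (otherwise \<open>msm_integral\<close> is \<open>0\<close> by convention).\<close>

definition msm_exists ::
  "complex \<Rightarrow> complex \<Rightarrow> complex \<Rightarrow> complex \<Rightarrow> complex \<Rightarrow> (real \<Rightarrow> complex) \<Rightarrow> real \<Rightarrow> bool"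
  where
  "msm_exists \<alpha> \<alpha>' \<beta> \<beta>' \<gamma> f x \<longleftrightarrow>
     set_integrable lborel {0<..<x} (msm_integrand \<alpha> \<alpha>' \<beta> \<beta>' \<gamma> f x)"

end

theory Submission
  imports Defs "HOL-Real_Asymp.Real_Asymp"
begin

text \<open>
  On a power \<open>t\<^bsup>\<rho>-1\<^esup>\<close> the fractional integral acts as multiplication by \<open>x\<^bsup>-\<alpha>-\<alpha>'+\<gamma>\<^esup>\<close> and a quotient of six
  Gamma values depending on \<open>\<rho>\<close>. The I-function of \<open>a t\<^bsup>\<mu>\<^esup>\<close> is a superposition of the powers \<open>t\<^bsup>-\<mu>s\<^esup>\<close>
  with \<open>s\<close> on the imaginary axis. Interchanging the two integrations replaces \<open>\<rho>\<close> by \<open>\<rho> - \<mu>s\<close> in the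
  six Gamma values, and these are exactly the factors that the six new triples add to the kernel.
  On the contour \<open>Re (\<rho> - \<mu>s) = Re \<rho>\<close>, so that one hypothesis on \<open>\<rho>\<close> covers all powers that occur.

  The interchange is Fubini's theorem for the product of two absolutely integrable functions.

  Integrability along the contour (\<open>I_fun_integrable\<close>) needs the order of \<open>\<bar>\<Gamma>(x + iy)\<bar>\<close> on vertical lines
  (\<open>Gamma_vertical_bigtheta\<close>). Here \<open>log \<bar>\<Gamma>(x + iy)\<bar>\<close> is, for \<open>0 \<le> x \<le> 1\<close>, an almost linear
  function of \<open>x\<close>, because its second derivative is bounded uniformly in \<open>\<bar>y\<bar> \<ge> 1\<close>; its end
  point values are known from the reflection formula and the functional equation.

  Integrability in \<open>t\<close> and the value of the integral of a power (\<open>msm_power\<close>) come from expanding \<open>F\<^sub>3\<close>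
  into Gauss functions of \<open>1 - x/t\<close>, bringing these into Pfaff's form and integrating both series
  termwise against Beta kernels. Each of the two sums that result is a Gauss series at argument \<open>1\<close>
  (\<open>gauss_sums\<close>). The double series does not converge absolutely for all admissible parameters, as
  Pfaff's series may involve cancellation. The inner series is therefore summed first and estimated
  as a whole (\<open>pfaff_bound\<close>), uniformly in the outer index, by means of a contiguous relation that
  raises both upper parameters until all terms can be estimated separately.
\<close>


section \<open>Growth of Pochhammer symbols\<close>

lemma norm_one_minus_le_exp:
  fixes w :: complex
  shows "norm (1 - w) \<le> exp (- Re w + (norm w)\<^sup>2 / 2)"
proof -
  have "(norm (1 - w))\<^sup>2 = 1 + (- 2 * Re w + (norm w)\<^sup>2)"
    unfolding cmod_power2 by (simp add: power2_eq_square algebra_simps)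
  also have "\<dots> \<le> exp (- 2 * Re w + (norm w)\<^sup>2)"
    by (rule exp_ge_add_one_self)
  also have "\<dots> = (exp (- Re w + (norm w)\<^sup>2 / 2))\<^sup>2"
    by (simp add: power2_eq_square exp_add [symmetric])
  finally show ?thesis
    by (rule power2_le_imp_le) simp
qed

lemma norm_add_of_nat_ge:
  fixes c :: complex
  assumes "Re c > 0"
  shows "norm (c + of_nat j) \<ge> min 1 (Re c) * (real j + 1)"
proof -
  have "min 1 (Re c) * (real j + 1) \<le> 1 * real j + Re c * 1"
    by (simp add: algebra_simps min_def mult_left_le_one_le)
       (smt (verit) assms mult_left_le_one_le mult_right_mono of_nat_0_le_iff)
  also have "\<dots> = Re (c + of_nat j)" by simp
  also have "\<dots> \<le> norm (c + of_nat j)" by (rule complex_Re_le_cmod)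
  finally show ?thesis .
qed

lemma powr_minus_one: "(real n + 1) powr (e - 1) = (real n + 1) powr e / (real n + 1)"
  by (simp add: powr_diff)

lemma powr_Suc_mult: "e + e' = d \<Longrightarrow> (real n + 1) powr e * (real n + 1) powr e' = (real n + 1) powr d"
  by (simp add: powr_add [symmetric])

lemma add_of_nat_nonzero:
  fixes c :: complex
  assumes "Re c > 0"
  shows "c + of_nat j \<noteq> 0"
  using assms by (metis Re_complex_of_real add_pos_nonneg less_irrefl of_nat_0_le_iff
      plus_complex.simps(1) of_real_of_nat_eq zero_complex.simps(1))

lemma Re_pos_not_nonpos_Ints: "Re z > 0 \<Longrightarrow> z \<notin> \<int>\<^sub>\<le>\<^sub>0" for z :: complex
  by (auto elim!: nonpos_Ints_cases)

lemma pochhammer_nonzero_Re_pos: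
  fixes c :: complex
  assumes "Re c > 0"
  shows "pochhammer c n \<noteq> 0"
  using add_of_nat_nonzero[OF assms] by (auto simp: pochhammer_eq_0_iff eq_neg_iff_add_eq_0)

text \<open>
  One factor \<open>1 - b / (c + j)\<close> of a quotient of Pochhammer symbols behaves like
  \<open>((j + 1) / (j + 2))\<^bsup>Re b\<^esup>\<close> up to a factor whose infinite product converges. Being
  one-sided, the estimate includes the case in which a factor vanishes.
\<close>

lemma one_step_quotient_bound:
  fixes b c :: complex
  assumes "Re c > 0"
  obtains D where "D \<ge> 0"
    "\<And>j. norm (1 - b / (c + of_nat j)) \<le>
       ((real j + 1) / (real j + 2)) powr Re b * exp (D / (real j + 1)\<^sup>2)"
proof -
  define d where "d = min 1 (Re c)"
  have d: "d > 0" using assms by (simp add: d_def)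
  define D where "D = norm b * norm (1 - c) / d + (norm b / d)\<^sup>2 / 2 + \<bar>Re b\<bar>"
  have "D \<ge> 0" using d by (simp add: D_def)
  moreover have "norm (1 - b / (c + of_nat j)) \<le>
       ((real j + 1) / (real j + 2)) powr Re b * exp (D / (real j + 1)\<^sup>2)" for j
  proof -
    define J where "J = real j + 1"
    have J: "J \<ge> 1" by (simp add: J_def)
    define w where "w = b / (c + of_nat j)"
    have nz: "c + of_nat j \<noteq> 0" by (rule add_of_nat_nonzero[OF assms])
    have ge: "norm (c + of_nat j) \<ge> d * J"
      using norm_add_of_nat_ge[OF assms, of j] by (simp add: d_def J_def)
    have dJ: "d * J > 0" using d J by simp
    have Jc: "complex_of_real J = of_nat j + 1" "of_nat j + 1 \<noteq> (0 :: complex)"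
      using J by (simp add: J_def, metis of_nat_Suc of_nat_neq_0 add.commute)
    have "w - b / of_real J = b * (1 - c) / ((c + of_nat j) * of_real J)"
      using nz Jc(2) unfolding w_def Jc(1) by (simp add: field_simps)
    hence "norm (w - b / of_real J) = norm b * norm (1 - c) / (norm (c + of_nat j) * J)"
      using J by (simp add: norm_mult norm_divide)
    also have "\<dots> \<le> norm b * norm (1 - c) / (d * J * J)"
      using ge d dJ J nz by (intro divide_left_mono mult_right_mono mult_nonneg_nonneg mult_pos_pos) auto
    finally have 1: "norm (w - b / of_real J) \<le> norm b * norm (1 - c) / d / J\<^sup>2"
      by (simp add: power2_eq_square divide_divide_eq_left mult.assoc)
    have "norm w \<le> norm b / (d * J)"
      using ge dJ unfolding w_def norm_divide
      by (intro divide_left_mono mult_pos_pos) (use d J nz in auto)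
    hence "(norm w)\<^sup>2 \<le> (norm b / (d * J))\<^sup>2" by (intro power_mono) auto
    hence 2: "(norm w)\<^sup>2 / 2 \<le> (norm b / d)\<^sup>2 / 2 / J\<^sup>2"
      by (simp add: power_divide power_mult_distrib)
    have "\<bar>ln (1 + 1 / J) - 1 / J\<bar> \<le> (1 / J)\<^sup>2"
      using J by (intro abs_ln_one_plus_x_minus_x_bound_nonneg) auto
    hence "\<bar>Re b * (ln (1 + 1 / J) - 1 / J)\<bar> \<le> \<bar>Re b\<bar> * (1 / J)\<^sup>2"
      unfolding abs_mult by (intro mult_left_mono) auto
    hence 3: "- Re b / J \<le> - Re b * ln (1 + 1 / J) + \<bar>Re b\<bar> / J\<^sup>2"
      by (simp add: algebra_simps power_divide)
    have "Re (b / of_real J) - Re w \<le> norm (b / of_real J - w)"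
      by (metis complex_Re_le_cmod minus_complex.simps(1))
    hence 4: "- Re w \<le> - Re b / J + norm b * norm (1 - c) / d / J\<^sup>2"
      using 1 by (simp add: norm_minus_commute)
    have "norm (1 - w) \<le> exp (- Re w + (norm w)\<^sup>2 / 2)" by (rule norm_one_minus_le_exp)
    also have "\<dots> \<le> exp (- Re b * ln (1 + 1 / J) + D / J\<^sup>2)"
      using 2 3 4 by (simp add: D_def add_divide_distrib)
    also have "- Re b * ln (1 + 1 / J) = Re b * ln (J / (J + 1))"
      using J by (simp add: ln_div divide_simps) (simp add: algebra_simps)
    also have "exp (Re b * ln (J / (J + 1)) + D / J\<^sup>2) = (J / (J + 1)) powr Re b * exp (D / J\<^sup>2)"
      using J by (simp add: powr_def exp_add)
    finally show ?thesis by (simp add: w_def J_def add_ac)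
  qed
  ultimately show ?thesis using that by blast
qed

text \<open>
  The estimate behind every absolute convergence statement on hypergeometric series below. It is
  uniform in the starting index \<open>k\<close>, which will be the index of the outer sum of \<open>F\<^sub>3\<close>.
\<close>

lemma pochhammer_quotient_bound:
  fixes b c :: complex
  assumes "Re c > 0"
  obtains K where "K > 0"
    "\<And>k l. norm (pochhammer (c - b + of_nat k) l / pochhammer (c + of_nat k) l) \<le>
       K * ((real k + 1) / (real k + real l + 1)) powr Re b"
proof -
  obtain D where D: "D \<ge> 0" and step: "\<And>j. norm (1 - b / (c + of_nat j)) \<le>
       ((real j + 1) / (real j + 2)) powr Re b * exp (D / (real j + 1)\<^sup>2)"
    using one_step_quotient_bound[OF assms] by metis
  define Z where "Z = (pi\<^sup>2 / 6 :: real)"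
  have bound: "norm (pochhammer (c - b + of_nat k) l / pochhammer (c + of_nat k) l) \<le>
      ((real k + 1) / (real k + real l + 1)) powr Re b * exp (D * (\<Sum>i<l. 1 / (real i + 1)\<^sup>2))" for k l
  proof (induction l)
    case (Suc l)
    have nz: "c + of_nat (k + l) \<noteq> 0" by (rule add_of_nat_nonzero[OF assms])
    have "pochhammer (c - b + of_nat k) (Suc l) / pochhammer (c + of_nat k) (Suc l) =
        pochhammer (c - b + of_nat k) l / pochhammer (c + of_nat k) l * (1 - b / (c + of_nat (k + l)))"
    proof -
      have "1 - b / (c + of_nat (k + l)) = (c - b + of_nat k + of_nat l) / (c + of_nat k + of_nat l)"
        using nz by (simp add: field_simps)
      thus ?thesis by (simp add: pochhammer_Suc)
    qed
    hence "norm (pochhammer (c - b + of_nat k) (Suc l) / pochhammer (c + of_nat k) (Suc l)) =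
        norm (pochhammer (c - b + of_nat k) l / pochhammer (c + of_nat k) l) *
        norm (1 - b / (c + of_nat (k + l)))"
      by (simp only: norm_mult)
    also have "\<dots> \<le> (((real k + 1) / (real k + real l + 1)) powr Re b *
          exp (D * (\<Sum>i<l. 1 / (real i + 1)\<^sup>2))) *
        (((real (k + l) + 1) / (real (k + l) + 2)) powr Re b * exp (D * (1 / (real l + 1)\<^sup>2)))"
    proof (intro mult_mono Suc.IH order_trans[OF step] mult_left_mono)
      have "D / (real (k + l) + 1)\<^sup>2 \<le> D / (real l + 1)\<^sup>2"
        using D by (intro divide_left_mono power_mono) auto
      thus "exp (D / (real (k + l) + 1)\<^sup>2) \<le> exp (D * (1 / (real l + 1)\<^sup>2))"
        by simp
    qed auto
    also have "\<dots> = (((real k + 1) / (real k + real l + 1)) powr Re b *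
          ((real (k + l) + 1) / (real (k + l) + 2)) powr Re b) *
          exp (D * (\<Sum>i<Suc l. 1 / (real i + 1)\<^sup>2))"
      by (simp add: exp_add distrib_left)
    also have "((real k + 1) / (real k + real l + 1)) powr Re b *
          ((real (k + l) + 1) / (real (k + l) + 2)) powr Re b =
        ((real k + 1) / (real k + real (Suc l) + 1)) powr Re b"
    proof -
      have "(real k + 1) / (real k + real l + 1) * ((real (k + l) + 1) / (real (k + l) + 2)) =
          (real k + 1) / (real k + real (Suc l) + 1)"
        by (simp add: divide_simps)
      thus ?thesis by (subst powr_mult [symmetric]) (simp_all only: divide_nonneg_nonneg of_nat_0_le_iff add_nonneg_nonneg zero_le_one zero_le_numeral)
    qed
    finally show ?case .
  qed auto
  have "(\<Sum>i<l. 1 / (real i + 1)\<^sup>2) \<le> Z" for l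
    using inverse_squares_sums by (intro sum_le_suminf[THEN order_trans] sums_summable)
      (auto simp: Z_def sums_iff add_ac)
  hence "((real k + 1) / (real k + real l + 1)) powr Re b * exp (D * (\<Sum>i<l. 1 / (real i + 1)\<^sup>2)) \<le>
      ((real k + 1) / (real k + real l + 1)) powr Re b * exp (D * Z)" for k l
    using D by (intro mult_left_mono) (auto intro: mult_left_mono)
  from order_trans[OF bound this] show ?thesis
    by (intro that[of "exp (D * Z)"]) (simp_all add: mult.commute)
qed

lemma pochhammer_quotient_bound_0:
  fixes b c :: complex
  assumes "Re c > 0"
  obtains K where "K > 0"
    "\<And>l. norm (pochhammer b l / pochhammer c l) \<le> K * (real l + 1) powr (Re b - Re c)"
proof -
  obtain K where "K > 0" and K: "\<And>k l. norm (pochhammer (c - (c - b) + of_nat k) l / pochhammer (c + of_nat k) l) \<le>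
       K * ((real k + 1) / (real k + real l + 1)) powr Re (c - b)"
    using pochhammer_quotient_bound[OF assms, of "c - b"] by metis
  have "norm (pochhammer b l / pochhammer c l) \<le> K * (real l + 1) powr (Re b - Re c)" for l
    using K[of 0 l] by (simp add: powr_divide powr_diff divide_simps add_ac)
  with \<open>K > 0\<close> show ?thesis using that by blast
qed

lemma pochhammer_fact_bound:
  fixes a :: complex
  obtains K where "K > 0"
    "\<And>l. norm (pochhammer a l / fact l) \<le> K * (real l + 1) powr (Re a - 1)"
  using pochhammer_quotient_bound_0[of 1 a] by (auto simp: pochhammer_fact [symmetric])

lemma summable_Suc_powr:
  assumes "p < -1"
  shows "summable (\<lambda>n. (real n + 1) powr p)"
proof -
  have "summable (\<lambda>n. real (n + 1) powr p)"
    using assms by (subst summable_iff_shift) (simp add: summable_real_powr_iff)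
  thus ?thesis by (simp add: add_ac)
qed

lemma summable_powr_times_power:
  fixes x :: real
  assumes "0 < x" "x < 1"
  shows "summable (\<lambda>n. (real n + 1) powr p * x ^ n)"
proof (rule summable_comparison_test_bigo)
  define y where "y = (1 + x) / 2"
  have y: "x < y" "y < 1" "0 < y" using assms by (auto simp: y_def)
  thus "summable (\<lambda>n. norm (y ^ n))" by (simp add: norm_power)
  define r where "r = x / y"
  have "0 < r" "r < 1" using y assms by (auto simp: r_def)
  hence "(\<lambda>n. (real n + 1) powr p * r ^ n) \<in> O(\<lambda>_. 1)" by real_asymp
  hence "(\<lambda>n. ((real n + 1) powr p * r ^ n) * y ^ n) \<in> O(\<lambda>n. 1 * y ^ n)"
    by (intro landau_o.big.mult) auto
  also have "(\<lambda>n. ((real n + 1) powr p * r ^ n) * y ^ n) = (\<lambda>n. (real n + 1) powr p * x ^ n)"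
    using y by (auto simp: r_def power_divide)
  finally show "(\<lambda>n. (real n + 1) powr p * x ^ n) \<in> O(\<lambda>n. y ^ n)" by simp
qed


section \<open>Gauss's summation theorem\<close>

text \<open>
  Dividing by \<open>\<Gamma>(c)\<close> turns Gauss's series into one that is entire in \<open>c\<close>; the summation theorem
  then needs no exception for the poles \<open>c = 0, -1, \<dots>\<close>.
\<close>

definition gauss_term :: "complex \<Rightarrow> complex \<Rightarrow> complex \<Rightarrow> nat \<Rightarrow> complex" where
  "gauss_term a b c n = pochhammer a n * pochhammer b n / fact n * rGamma (c + of_nat n)"

lemma gauss_term_shift: "gauss_term a b c n = (c + of_nat n) * gauss_term a b (c + 1) n"
  using rGamma_plus1[of "c + of_nat n"] by (simp add: gauss_term_def add_ac)

lemma gauss_term_Re_pos: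
  assumes "Re c > 0"
  shows "gauss_term a b c n = rGamma c * (pochhammer a n / fact n) * (pochhammer b n / pochhammer c n)"
  using pochhammer_rGamma[of c n] pochhammer_nonzero_Re_pos[OF assms, of n]
  by (simp add: gauss_term_def)

text \<open>
  For \<open>Re c > 0\<close> the term is a product of two quotients of Pochhammer symbols. Lowering \<open>c\<close> by \<open>1\<close>
  multiplies it by a factor of order \<open>n\<close>, in accordance with the bound, and this reaches all \<open>c\<close>.
\<close>

lemma gauss_term_bound:
  obtains K where "K > 0" "\<And>n. norm (gauss_term a b c n) \<le> K * (real n + 1) powr (Re a + Re b - Re c - 1)"
proof -
  define bounded where "bounded c \<longleftrightarrow> (\<exists>K>0. \<forall>n. norm (gauss_term a b c n) \<le> K * (real n + 1) powr (Re a + Re b - Re c - 1))" for c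
  have "\<forall>c. Re c > - real N \<longrightarrow> bounded c" for N
  proof (induction N)
    case 0
    show ?case
    proof (intro allI impI)
      fix c :: complex assume "Re c > - real 0"
      hence c: "Re c > 0" by simp
      obtain K where K: "K > 0" "\<And>n. norm (pochhammer b n / pochhammer c n) \<le> K * (real n + 1) powr (Re b - Re c)"
        using pochhammer_quotient_bound_0[OF c] by metis
      obtain L where L: "L > 0" "\<And>n. norm (pochhammer a n / fact n) \<le> L * (real n + 1) powr (Re a - 1)"
        using pochhammer_fact_bound by metis
      have "norm (gauss_term a b c n) \<le> ((norm (rGamma c) + 1) * L * K) * (real n + 1) powr (Re a + Re b - Re c - 1)" for n
      proof -
        have "norm (gauss_term a b c n) = norm (rGamma c) * norm (pochhammer a n / fact n) * norm (pochhammer b n / pochhammer c n)"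
          by (simp only: gauss_term_Re_pos[OF c] norm_mult)
        also have "\<dots> \<le> (norm (rGamma c) + 1) * (L * (real n + 1) powr (Re a - 1)) * (K * (real n + 1) powr (Re b - Re c))"
          using K L by (intro mult_mono) auto
        also have "\<dots> = ((norm (rGamma c) + 1) * L * K) *
            ((real n + 1) powr (Re a - 1) * (real n + 1) powr (Re b - Re c))"
          by (simp only: mult_ac)
        also have "(real n + 1) powr (Re a - 1) * (real n + 1) powr (Re b - Re c) =
            (real n + 1) powr (Re a + Re b - Re c - 1)"
          by (rule powr_Suc_mult) simp
        finally show ?thesis .
      qed
      thus "bounded c"
        using K(1) L(1) unfolding bounded_def by (intro exI[of _ "(norm (rGamma c) + 1) * L * K"]) (auto intro!: mult_pos_pos add_nonneg_pos)
    qed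
  next
    case (Suc N)
    show ?case
    proof (intro allI impI)
      fix c :: complex assume "Re c > - real (Suc N)"
      hence "Re (c + 1) > - real N" by simp
      with Suc obtain K where K: "K > 0"
        "\<And>n. norm (gauss_term a b (c + 1) n) \<le> K * (real n + 1) powr (Re a + Re b - Re (c + 1) - 1)"
        unfolding bounded_def by blast
      have "norm (gauss_term a b c n) \<le> ((norm c + 1) * K) * (real n + 1) powr (Re a + Re b - Re c - 1)" for n
      proof -
        have "norm (c + of_nat n) \<le> norm c + real n"
          by (metis norm_of_nat norm_triangle_ineq)
        also have "\<dots> \<le> (norm c + 1) * (real n + 1)" by (simp add: algebra_simps)
        finally have "norm (gauss_term a b c n) \<le>
            ((norm c + 1) * (real n + 1)) * (K * (real n + 1) powr (Re a + Re b - Re (c + 1) - 1))"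
          unfolding gauss_term_shift[of a b c] norm_mult
          by (intro mult_mono K mult_nonneg_nonneg add_nonneg_nonneg) auto
        also have "(real n + 1) powr (Re a + Re b - Re (c + 1) - 1) = (real n + 1) powr (Re a + Re b - Re c - 1) / (real n + 1)"
        proof -
          have "Re a + Re b - Re (c + 1) - 1 = (Re a + Re b - Re c - 1) - 1" by simp
          thus ?thesis by (simp only: powr_minus_one)
        qed
        finally show ?thesis by simp
      qed
      thus "bounded c"
        using K(1) unfolding bounded_def by (intro exI[of _ "(norm c + 1) * K"]) (auto intro!: mult_pos_pos add_nonneg_pos)
    qed
  qed
  moreover obtain N :: nat where "Re c > - real N"
  proof -
    obtain N :: nat where "- Re c < real N" using reals_Archimedean2 by blast
    thus ?thesis by (intro that[of N]) linarith
  qed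
  ultimately have "bounded c" by blast
  thus ?thesis using that unfolding bounded_def by blast
qed

lemma summable_norm_gauss_term:
  assumes "Re (c - a - b) > 0"
  shows "summable (\<lambda>n. norm (gauss_term a b c n))"
proof -
  obtain K where "K > 0" "\<And>n. norm (gauss_term a b c n) \<le> K * (real n + 1) powr (Re a + Re b - Re c - 1)"
    using gauss_term_bound by metis
  thus ?thesis
    using assms by (intro summable_comparison_test'[OF summable_mult[OF summable_Suc_powr]]) auto
qed

text \<open>
  The difference of the two sides telescopes: termwise it is \<open>v\<^sub>n - v\<^bsub>n+1\<^esub>\<close> with \<open>v\<^sub>n\<close> equal to \<open>n\<close> times the
  \<open>n\<close>-th term of the series on the left.
\<close>

lemma gauss_sum_recurrence:
  assumes "Re (c - a - b) > 0"
  shows "(c - a - b) * (\<Sum>n. gauss_term a b c n) = (c - a) * (c - b) * (\<Sum>n. gauss_term a b (c + 1) n)"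
proof -
  define v where "v n = of_nat n * gauss_term a b c n" for n
  define D where "D n = (c - a - b) * gauss_term a b c n - (c - a) * (c - b) * gauss_term a b (c + 1) n" for n
  have s: "summable (gauss_term a b c)" "summable (gauss_term a b (c + 1))"
    using assms by (auto intro!: summable_norm_cancel[OF summable_norm_gauss_term])
  obtain K where K: "K > 0" "\<And>n. norm (gauss_term a b c n) \<le> K * (real n + 1) powr (Re a + Re b - Re c - 1)"
    using gauss_term_bound by metis
  have "v \<longlonglongrightarrow> 0"
  proof (rule Lim_null_comparison)
    have "norm (v n) \<le> K * (real n + 1) powr (Re a + Re b - Re c)" for n
    proof -
      have "norm (v n) \<le> (real n + 1) * (K * (real n + 1) powr (Re a + Re b - Re c - 1))"
        unfolding v_def norm_mult by (intro mult_mono K) auto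
      also have "\<dots> = K * (real n + 1) powr (Re a + Re b - Re c)" by (simp add: powr_diff)
      finally show ?thesis .
    qed
    thus "eventually (\<lambda>n. norm (v n) \<le> K * (real n + 1) powr (Re a + Re b - Re c)) sequentially" by simp
    have "Re a + Re b - Re c < 0" using assms by simp
    thus "(\<lambda>n. K * (real n + 1) powr (Re a + Re b - Re c)) \<longlonglongrightarrow> 0" by real_asymp
  qed
  hence "(\<lambda>n. v n - v (Suc n)) sums v 0"
    using telescope_sums'[of v 0] by simp
  hence "(\<lambda>n. v n - v (Suc n)) sums 0" by (simp add: v_def)
  also have "(\<lambda>n. v n - v (Suc n)) = D"
  proof
    fix n
    define X where "X = gauss_term a b (c + 1) n"
    have 1: "gauss_term a b c n = (c + of_nat n) * X" unfolding X_def by (rule gauss_term_shift)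
    have "v (Suc n) = of_nat (Suc n) * (pochhammer a (Suc n) * pochhammer b (Suc n) / fact (Suc n) * rGamma (c + 1 + of_nat n))"
      by (simp add: v_def gauss_term_def add_ac)
    also have "\<dots> = (a + of_nat n) * (b + of_nat n) * X"
      by (simp add: X_def gauss_term_def pochhammer_Suc field_simps del: of_nat_Suc)
    finally have 2: "v (Suc n) = (a + of_nat n) * (b + of_nat n) * X" .
    show "v n - v (Suc n) = D n"
      unfolding 2 D_def unfolding v_def 1 X_def [symmetric] by (simp add: algebra_simps)
  qed
  finally have "D sums 0" .
  moreover have "D sums
      ((c - a - b) * (\<Sum>n. gauss_term a b c n) - (c - a) * (c - b) * (\<Sum>n. gauss_term a b (c + 1) n))"
    unfolding D_def [abs_def] using s by (intro sums_diff sums_mult summable_sums)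
  ultimately show ?thesis using sums_unique2 by fastforce
qed

lemma gauss_sum_recurrence_iterated:
  assumes "Re (c - a - b) > 0"
  shows "pochhammer (c - a - b) N * (\<Sum>n. gauss_term a b c n) =
     pochhammer (c - a) N * pochhammer (c - b) N * (\<Sum>n. gauss_term a b (c + of_nat N) n)"
proof (induction N)
  case (Suc N)
  have r: "(c + of_nat N - a - b) * (\<Sum>n. gauss_term a b (c + of_nat N) n) =
      (c + of_nat N - a) * (c + of_nat N - b) * (\<Sum>n. gauss_term a b (c + of_nat N + 1) n)"
    using assms by (intro gauss_sum_recurrence) (simp add: add_nonneg_pos)
  have "pochhammer (c - a - b) (Suc N) * (\<Sum>n. gauss_term a b c n) =
     (c + of_nat N - a - b) * (pochhammer (c - a - b) N * (\<Sum>n. gauss_term a b c n))"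
    by (simp add: pochhammer_Suc algebra_simps)
  also have "\<dots> = pochhammer (c - a) N * pochhammer (c - b) N *
      ((c + of_nat N - a - b) * (\<Sum>n. gauss_term a b (c + of_nat N) n))"
    unfolding Suc by (simp add: mult_ac)
  also have "\<dots> = pochhammer (c - a) (Suc N) * pochhammer (c - b) (Suc N) *
      (\<Sum>n. gauss_term a b (c + of_nat (Suc N)) n)"
    unfolding r by (simp add: pochhammer_Suc algebra_simps)
  finally show ?case .
qed simp

text \<open>As \<open>c\<close> moves off to the right, all terms of Gauss's series but the first disappear.\<close>

lemma gauss_sum_limit:
  assumes "Re c > 0" "Re (c - a - b) > 0"
  shows "(\<lambda>N. Gamma (c + of_nat N) * (\<Sum>n. gauss_term a b (c + of_nat N) n)) \<longlonglongrightarrow> 1"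
proof -
  define A where "A n = pochhammer a n * pochhammer b n / fact n" for n
  define r where "r = complex_of_real (Re c)"
  have r: "Re r > 0" using assms by (simp add: r_def)
  have lower: "norm (pochhammer r n) \<le> norm (pochhammer (c + of_nat N) n)" for N n
    unfolding pochhammer_prod prod_norm [symmetric]
  proof (intro prod_mono conjI)
    fix i
    have "r + of_nat i = complex_of_real (Re c + real i)" by (simp add: r_def)
    hence "norm (r + of_nat i) = Re c + real i"
      using assms by (simp only: norm_of_real)
    also have "\<dots> \<le> Re (c + of_nat N + of_nat i)" by simp
    also have "\<dots> \<le> norm (c + of_nat N + of_nat i)" by (rule complex_Re_le_cmod)
    finally show "norm (r + of_nat i) \<le> norm (c + of_nat N + of_nat i)" .
  qed auto
  have pos: "norm (pochhammer r n) > 0" for n using pochhammer_nonzero_Re_pos[OF r] by simp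
  have *: "eventually (\<lambda>N. summable (\<lambda>n. norm (A n / pochhammer (c + of_nat N) n))) sequentially \<and>
      summable (\<lambda>n. norm (if n = 0 then 1 else 0 :: complex)) \<and>
      (\<lambda>N. \<Sum>n. A n / pochhammer (c + of_nat N) n) \<longlonglongrightarrow> (\<Sum>n. if n = 0 then 1 else 0)"
  proof (rule tannerys_theorem)
    fix n
    show "(\<lambda>N. A n / pochhammer (c + of_nat N) n) \<longlonglongrightarrow> (if n = 0 then 1 else 0)"
    proof (cases n)
      case 0 thus ?thesis by (simp add: A_def)
    next
      case (Suc m)
      have "(\<lambda>N. A n / pochhammer (c + of_nat N) n) \<longlonglongrightarrow> 0"
      proof (rule Lim_null_comparison)
        have "norm (A n / pochhammer (c + of_nat N) n) \<le> norm (A n) / norm (pochhammer r m) / real N"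
          if "N > 0" for N
        proof -
          have "real N \<le> Re (c + of_nat N + of_nat m)" using assms by simp
          also have "\<dots> \<le> norm (c + of_nat N + of_nat m)" by (rule complex_Re_le_cmod)
          finally have "norm (pochhammer r m) * real N \<le> norm (pochhammer (c + of_nat N) n)"
            unfolding Suc pochhammer_Suc norm_mult using lower by (intro mult_mono) auto
          moreover have P: "norm (pochhammer r m) * real N > 0" using pos[of m] that by simp
          ultimately show ?thesis
            unfolding norm_divide divide_divide_eq_left
            by (intro divide_left_mono mult_pos_pos[OF less_le_trans[OF P] P]) auto
        qed
        thus "eventually (\<lambda>N. norm (A n / pochhammer (c + of_nat N) n) \<le>
            norm (A n) / norm (pochhammer r m) / real N) sequentially"
          by (intro eventually_mono[OF eventually_gt_at_top[of 0]]) auto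
        show "(\<lambda>N. norm (A n) / norm (pochhammer r m) / real N) \<longlonglongrightarrow> 0" by real_asymp
      qed
      thus ?thesis by (simp add: Suc)
    qed
  next
    have "norm (A n / pochhammer (c + of_nat N) n) \<le> norm (A n / pochhammer r n)" for n N
      using lower[of n N] pos[of n] by (auto simp: norm_divide intro!: divide_left_mono mult_pos_pos)
    thus "eventually (\<lambda>(n, N). norm (A n / pochhammer (c + of_nat N) n) \<le> norm (A n / pochhammer r n))
        (at_top \<times>\<^sub>F sequentially)" by (intro always_eventually) auto
    have "summable (\<lambda>n. norm (inverse (rGamma r)) * norm (gauss_term a b r n))"
      using assms by (intro summable_mult summable_norm_gauss_term) (simp add: r_def)
    also have "(\<lambda>n. norm (inverse (rGamma r)) * norm (gauss_term a b r n)) = (\<lambda>n. norm (A n / pochhammer r n))"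
      using Re_pos_not_nonpos_Ints[OF r]
      by (auto simp: gauss_term_Re_pos[OF r] norm_mult [symmetric] A_def rGamma_eq_zero_iff field_simps)
    finally show "summable (\<lambda>n. norm (A n / pochhammer r n))" .
  qed auto
  have "(\<Sum>n. A n / pochhammer (c + of_nat N) n) = Gamma (c + of_nat N) * (\<Sum>n. gauss_term a b (c + of_nat N) n)" for N
  proof -
    have c: "Re (c + of_nat N) > 0" using assms by (simp add: add_pos_nonneg)
    have nz: "rGamma (c + of_nat N) \<noteq> 0" using Re_pos_not_nonpos_Ints[OF c] by (simp add: rGamma_eq_zero_iff)
    have "summable (gauss_term a b (c + of_nat N))"
      using assms by (intro summable_norm_cancel[OF summable_norm_gauss_term]) (simp add: add_pos_nonneg)
    hence "Gamma (c + of_nat N) * (\<Sum>n. gauss_term a b (c + of_nat N) n) = (\<Sum>n. Gamma (c + of_nat N) * gauss_term a b (c + of_nat N) n)"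
      by (rule suminf_mult [symmetric])
    thus ?thesis using nz
      by (simp add: gauss_term_Re_pos[OF c] A_def Gamma_def field_simps)
  qed
  moreover have "(\<Sum>n. if n = 0 then 1 else 0 :: complex) = 1"
    using suminf_finite[of "{0}" "\<lambda>n. if n = 0 then 1 else 0 :: complex"] by simp
  ultimately show ?thesis using * by simp
qed

text \<open>
  Iterating the recurrence \<open>N\<close> times leaves quotients of Pochhammer symbols of length \<open>N\<close>, which
  tend to Gamma values by the product formula for \<open>1 / \<Gamma>\<close>. The limit is taken for \<open>Re c > 0\<close>; finitely
  many further steps of the recurrence carry the result to the remaining \<open>c\<close>.
\<close>

theorem gauss_sums:
  assumes "Re (c - a - b) > 0"
  shows "gauss_term a b c sums (Gamma (c - a - b) * rGamma (c - a) * rGamma (c - b))"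
proof -
  have main: "(\<Sum>n. gauss_term a b c n) = Gamma (c - a - b) * rGamma (c - a) * rGamma (c - b)"
    if c: "Re c > 0" and "Re (c - a - b) > 0" for c
  proof -
    define S where "S = (\<Sum>n. gauss_term a b c n)"
    define q where "q N = rGamma_series (c - a) N * rGamma_series (c - b) N / (rGamma_series (c - a - b) N * rGamma_series c N)" for N
    have nz: "rGamma c \<noteq> 0" "rGamma (c - a - b) \<noteq> 0"
      using that Re_pos_not_nonpos_Ints[of c] Re_pos_not_nonpos_Ints[of "c - a - b"]
      by (auto simp: rGamma_eq_zero_iff)
    \<comment> \<open>Below, \<open>rGamma_series z N\<close> contains the Pochhammer symbol of length \<open>N + 1\<close>, hence \<open>Suc N\<close> steps.\<close>
    have "(\<lambda>N. q N *
        (rGamma c * (Gamma (c + of_nat (Suc N)) * (\<Sum>n. gauss_term a b (c + of_nat (Suc N)) n)))) \<longlonglongrightarrow>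
        rGamma (c - a) * rGamma (c - b) / (rGamma (c - a - b) * rGamma c) * (rGamma c * 1)"
      using nz LIMSEQ_Suc[OF gauss_sum_limit[OF that]]
      unfolding q_def by (intro tendsto_intros) auto
    also have "(\<lambda>N. q N *
        (rGamma c * (Gamma (c + of_nat (Suc N)) * (\<Sum>n. gauss_term a b (c + of_nat (Suc N)) n)))) = (\<lambda>_. S)"
    proof
      fix N
      define E where "E z = fact N * exp (z * complex_of_real (ln (real N)))" for z
      have E: "E z \<noteq> 0" for z by (simp add: E_def)
      have EE: "E (c - a) * E (c - b) = E (c - a - b) * E c"
        by (simp add: E_def exp_add [symmetric] algebra_simps)
      have rs: "rGamma_series z N = pochhammer z (Suc N) / E z" for z
        by (simp add: rGamma_series_def E_def)
      have cN: "Re (c + of_nat (Suc N)) > 0" using c by simp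
      have nz': "pochhammer (c - a - b) (Suc N) \<noteq> 0" "pochhammer c (Suc N) \<noteq> 0" "rGamma (c + of_nat (Suc N)) \<noteq> 0"
        using that pochhammer_nonzero_Re_pos Re_pos_not_nonpos_Ints[OF cN] by (auto simp: rGamma_eq_zero_iff simp del: of_nat_Suc)
      have "rGamma c * Gamma (c + of_nat (Suc N)) = pochhammer c (Suc N)"
        using nz'(3) pochhammer_rGamma[of c "Suc N"] by (simp add: Gamma_def del: of_nat_Suc)
      moreover have "S = pochhammer (c - a) (Suc N) * pochhammer (c - b) (Suc N) *
          (\<Sum>n. gauss_term a b (c + of_nat (Suc N)) n) / pochhammer (c - a - b) (Suc N)"
        using gauss_sum_recurrence_iterated[OF that(2), of "Suc N"] nz'(1)
        by (simp add: S_def field_simps del: of_nat_Suc)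
      moreover have "q N =
          pochhammer (c - a) (Suc N) * pochhammer (c - b) (Suc N) / (pochhammer (c - a - b) (Suc N) * pochhammer c (Suc N))"
      proof -
        have "q N =
          (pochhammer (c - a) (Suc N) * pochhammer (c - b) (Suc N) / (E (c - a) * E (c - b))) /
          (pochhammer (c - a - b) (Suc N) * pochhammer c (Suc N) / (E (c - a - b) * E c))"
          by (simp add: q_def rs)
        thus ?thesis using E by (simp add: EE)
      qed
      ultimately show "q N *
          (rGamma c * (Gamma (c + of_nat (Suc N)) * (\<Sum>n. gauss_term a b (c + of_nat (Suc N)) n))) = S"
        using nz' by (simp add: mult.assoc [symmetric] del: of_nat_Suc)
    qed
    finally have "S = rGamma (c - a) * rGamma (c - b) / (rGamma (c - a - b) * rGamma c) * (rGamma c * 1)"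
      by (simp only: tendsto_const_iff[OF sequentially_bot] LIMSEQ_const_iff)
    thus ?thesis using nz by (simp add: S_def Gamma_def field_simps)
  qed
  obtain N :: nat where N: "Re c + real N > 0"
  proof -
    obtain N :: nat where "- Re c < real N" using reals_Archimedean2 by blast
    thus ?thesis by (intro that[of N]) linarith
  qed
  have nz: "pochhammer (c - a - b) N \<noteq> 0" using assms by (rule pochhammer_nonzero_Re_pos)
  have nz': "rGamma (c - a - b + of_nat N) \<noteq> 0" "rGamma (c - a - b) \<noteq> 0"
    using assms Re_pos_not_nonpos_Ints[of "c - a - b + of_nat N"] Re_pos_not_nonpos_Ints[of "c - a - b"]
    by (auto simp: rGamma_eq_zero_iff add_pos_nonneg)
  have "pochhammer (c - a - b) N * (\<Sum>n. gauss_term a b c n) =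
      pochhammer (c - a) N * pochhammer (c - b) N *
      (Gamma (c + of_nat N - a - b) * rGamma (c + of_nat N - a) * rGamma (c + of_nat N - b))"
    using N assms by (subst gauss_sum_recurrence_iterated[OF assms], subst main) (simp_all add: add_pos_nonneg)
  also have "\<dots> = pochhammer (c - a - b) N * (Gamma (c - a - b) * rGamma (c - a) * rGamma (c - b))"
    using pochhammer_rGamma[of "c - a" N] pochhammer_rGamma[of "c - b" N] pochhammer_rGamma[of "c - a - b" N] nz nz'
    by (simp add: Gamma_def algebra_simps)
  finally have "(\<Sum>n. gauss_term a b c n) = Gamma (c - a - b) * rGamma (c - a) * rGamma (c - b)"
    using nz by simp
  thus ?thesis
    using summable_sums[OF summable_norm_cancel[OF summable_norm_gauss_term[OF assms]]] by simp
qed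


section \<open>The complex Beta integral\<close>

text \<open>\<open>Beta (p + k) r\<close> is \<open>Beta p r\<close> times a quotient of Pochhammer symbols of length \<open>k\<close>.\<close>

lemma Beta_growth:
  fixes p r :: real
  assumes "p > 0" "r > 0"
  obtains K where "K > 0" "\<And>k. Beta (p + real k) r \<le> K * (real k + 1) powr (- r)"
proof -
  have "Re (complex_of_real (p + r)) > 0" using assms by simp
  then obtain K where K: "K > 0" "\<And>k. norm (pochhammer (complex_of_real p) k / pochhammer (complex_of_real (p + r)) k) \<le>
       K * (real k + 1) powr (Re (of_real p) - Re (of_real (p + r)))"
    using pochhammer_quotient_bound_0[of "of_real (p + r)" "of_real p"] by metis
  have "Beta (p + real k) r \<le> (Beta p r * K) * (real k + 1) powr (- r)" for k
  proof -
    have nonneg: "pochhammer p k \<ge> 0" "pochhammer (p + r) k > 0"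
      using assms by (auto intro: pochhammer_pos pochhammer_nonneg)
    have "p \<notin> \<int>\<^sub>\<le>\<^sub>0" "p + r \<notin> \<int>\<^sub>\<le>\<^sub>0" using assms by (auto elim!: nonpos_Ints_cases)
    moreover have "p + r + real k > 0" "p + real k > 0" using assms by auto
    ultimately have "Beta (p + real k) r = Beta p r * (pochhammer p k / pochhammer (p + r) k)"
      using assms Gamma_real_pos[of p] Gamma_real_pos[of "p + r"] Gamma_real_pos[of "p + r + real k"]
      by (simp add: Beta_def pochhammer_Gamma add_ac less_imp_neq[symmetric])
    also have "pochhammer p k / pochhammer (p + r) k =
        norm (pochhammer (complex_of_real p) k / pochhammer (complex_of_real (p + r)) k)"
      using nonneg by (simp only: pochhammer_of_real norm_divide norm_of_real abs_of_pos abs_of_nonneg)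
    also have "Beta p r * \<dots> \<le> Beta p r * (K * (real k + 1) powr (- r))"
      using K(2)[of k] assms by (intro mult_left_mono) (auto simp: Beta_def)
    finally show ?thesis by (simp add: mult.assoc)
  qed
  thus ?thesis using that[of "Beta p r * K"] K(1) assms by (simp add: Beta_def)
qed

lemma norm_of_real_powr:
  assumes "t > 0"
  shows "norm (of_real t powr z :: complex) = t powr Re z"
  using assms by (simp add: norm_powr_real_powr)

lemma set_lborel_integral_eq:
  fixes f :: "real \<Rightarrow> complex"
  assumes "set_integrable lborel S f" "(f has_integral I) S"
  shows "(LINT t:S|lborel. f t) = I"
  using set_borel_integral_eq_integral(2)[OF assms(1)] assms(2) by (simp add: integral_unique)

lemma set_integrable_beta_real:
  assumes "p > 0" "q > (0 :: real)"
  shows "set_integrable lborel {0<..<1} (\<lambda>t. t powr (p - 1) * (1 - t) powr (q - 1))"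
    and "(LINT t:{0<..<1}|lborel. t powr (p - 1) * (1 - t) powr (q - 1)) = Beta p q"
proof -
  show *: "set_integrable lborel {0<..<1} (\<lambda>t. t powr (p - 1) * (1 - t) powr (q - 1))"
    using integrable_Beta[OF assms] by (rule set_integrable_subset) auto
  have "((\<lambda>t. t powr (p - 1) * (1 - t) powr (q - 1)) has_integral Beta p q) {0<..<1}"
    using has_integral_Beta_real[OF assms] by (simp add: has_integral_Icc_iff_Ioo)
  thus "(LINT t:{0<..<1}|lborel. t powr (p - 1) * (1 - t) powr (q - 1)) = Beta p q"
    using set_borel_integral_eq_integral(2)[OF *] by (simp add: integral_unique)
qed

lemma set_integrable_bound_measurable:
  fixes f :: "'a \<Rightarrow> complex" and g :: "'a \<Rightarrow> real"
  assumes "set_integrable M S g" "set_borel_measurable M S f" "\<And>t. t \<in> S \<Longrightarrow> norm (f t) \<le> g t"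
  shows "set_integrable M S f"
  using assms(1,2) unfolding set_integrable_def set_borel_measurable_def
proof (rule Bochner_Integration.integrable_bound)
  show "AE t in M. norm (indicator S t *\<^sub>R f t) \<le> norm (indicator S t *\<^sub>R g t)"
    using assms(3) by (intro AE_I2) (force simp: indicator_def)
qed

lemma set_borel_measurable_continuous_lborel:
  fixes f :: "real \<Rightarrow> complex"
  assumes "continuous_on S f" "S \<in> sets borel"
  shows "set_borel_measurable lborel S f"
  using assms borel_measurable_continuous_on_indicator[of S f]
  by (simp add: set_borel_measurable_def)

lemma set_integrable_beta_complex:
  fixes p q :: complex
  assumes "Re p > 0" "Re q > 0"
  shows "set_integrable lborel {0<..<1} (\<lambda>t. of_real t powr (p - 1) * of_real (1 - t) powr (q - 1))"
proof (rule set_integrable_bound_measurable)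
  show "set_integrable lborel {0<..<1} (\<lambda>t. t powr (Re p - 1) * (1 - t) powr (Re q - 1))"
    using assms by (rule set_integrable_beta_real)
  show "set_borel_measurable lborel {0<..<1} (\<lambda>t. complex_of_real t powr (p - 1) * of_real (1 - t) powr (q - 1))"
    by (intro set_borel_measurable_continuous_lborel continuous_intros) (auto simp: complex_nonpos_Reals_iff)
  fix t :: real assume "t \<in> {0<..<1}"
  thus "norm (of_real t powr (p - 1) * complex_of_real (1 - t) powr (q - 1)) \<le> t powr (Re p - 1) * (1 - t) powr (Re q - 1)"
    unfolding norm_mult by (subst (1 2) norm_of_real_powr) auto
qed

lemma power_integral_complex:
  fixes p :: complex
  assumes "Re p > 0"
  shows "(LINT t:{0<..<1}|lborel. of_real t powr (p - 1)) = 1 / p"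
proof (rule set_lborel_integral_eq)
  show "set_integrable lborel {0<..<1} (\<lambda>t. complex_of_real t powr (p - 1))"
  proof -
    have "set_integrable lborel {0<..<1} (\<lambda>t. complex_of_real t powr (p - 1)) \<longleftrightarrow>
        set_integrable lborel {0<..<1} (\<lambda>t. complex_of_real t powr (p - 1) * of_real (1 - t) powr (1 - 1))"
      by (intro set_integrable_cong) auto
    thus ?thesis using set_integrable_beta_complex[of p 1] assms by simp
  qed
  have "p \<noteq> 0" using assms by auto
  have "((\<lambda>t. complex_of_real t powr (p - 1)) has_integral (of_real 1 powr p / p - of_real 0 powr p / p)) {0..1}"
  proof (rule fundamental_theorem_of_calculus_interior)
    show "continuous_on {0..1} (\<lambda>t. complex_of_real t powr p / p)"
      using assms \<open>p \<noteq> 0\<close> by (intro continuous_intros continuous_on_powr_complex) auto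
    fix t :: real assume t: "t \<in> {0<..<1}"
    have "((\<lambda>z. z powr p / p) has_field_derivative of_real t powr (p - 1)) (at (of_real t))"
      using t \<open>p \<noteq> 0\<close> by (auto intro!: derivative_eq_intros simp: complex_nonpos_Reals_iff)
    thus "((\<lambda>t. complex_of_real t powr p / p) has_vector_derivative of_real t powr (p - 1)) (at t)"
      by (rule has_vector_derivative_real_field)
  qed auto
  thus "((\<lambda>t. complex_of_real t powr (p - 1)) has_integral (1 / p)) {0<..<1}"
    by (simp add: has_integral_Icc_iff_Ioo)
qed

lemma integrate_series_termwise:
  fixes f :: "nat \<Rightarrow> real \<Rightarrow> complex"
  assumes int: "\<And>k. set_integrable lborel S (f k)"
    and norm: "\<And>t. t \<in> S \<Longrightarrow> summable (\<lambda>k. norm (f k t))"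
    and norms: "summable (\<lambda>k. LINT t:S|lborel. norm (f k t))"
    and F: "\<And>t. t \<in> S \<Longrightarrow> F t = (\<Sum>k. f k t)"
    and I: "(\<lambda>k. LINT t:S|lborel. f k t) sums I"
  shows "set_integrable lborel S F" "(LINT t:S|lborel. F t) = I"
proof -
  have eq: "(\<lambda>t. indicator S t *\<^sub>R F t) = (\<lambda>t. \<Sum>k. indicator S t *\<^sub>R f k t)"
  proof
    show "indicator S t *\<^sub>R F t = (\<Sum>k. indicator S t *\<^sub>R f k t)" for t
      using F[of t] by (cases "t \<in> S") auto
  qed
  have norm_eq: "norm (indicator S t *\<^sub>R f k t) = indicator S t *\<^sub>R norm (f k t)" for k t
    by (cases "t \<in> S") auto
  have 1: "integrable lborel (\<lambda>t. indicator S t *\<^sub>R f k t)" for k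
    using int by (simp add: set_integrable_def)
  have 2: "AE t in lborel. summable (\<lambda>k. norm (indicator S t *\<^sub>R f k t))"
  proof (intro AE_I2)
    fix t show "summable (\<lambda>k. norm (indicator S t *\<^sub>R f k t))"
      using norm[of t] by (cases "t \<in> S") auto
  qed
  have 3: "summable (\<lambda>k. \<integral>t. norm (indicator S t *\<^sub>R f k t) \<partial>lborel)"
    using norms unfolding norm_eq by (simp add: set_lebesgue_integral_def)
  show "set_integrable lborel S F"
    unfolding set_integrable_def eq by (rule integrable_suminf[OF 1 2 3])
  show "(LINT t:S|lborel. F t) = I"
    using sums_integral[OF 1 2 3] I unfolding set_lebesgue_integral_def eq by (rule sums_unique2)
qed

lemma Gamma_nonzero_Re_pos: "Re z > 0 \<Longrightarrow> Gamma z \<noteq> 0" for z :: complex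
  using Re_pos_not_nonpos_Ints[of z] by (simp add: Gamma_eq_zero_iff)

lemma Gamma_plus_of_nat:
  fixes c :: complex
  assumes "Re c > 0"
  shows "Gamma (c + of_nat n) = pochhammer c n * Gamma c"
  using pochhammer_Gamma[of c n] Re_pos_not_nonpos_Ints[OF assms] Gamma_nonzero_Re_pos[OF assms] by simp

lemma of_real_powr_plus_nat:
  assumes "t > 0"
  shows "complex_of_real t powr (z + of_nat n - 1) = of_real t powr (z - 1) * of_real t ^ n"
proof -
  have "complex_of_real t powr (z + of_nat n - 1) = of_real t powr ((z - 1) + of_nat n)"
    by (simp add: algebra_simps)
  also have "\<dots> = of_real t powr (z - 1) * of_real t ^ n"
    using assms by (subst powr_add) (simp add: powr_nat')
  finally show ?thesis .
qed

lemma binomial_series_pochhammer: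
  fixes z a :: complex
  assumes "norm z < 1"
  shows "(\<lambda>n. pochhammer a n / fact n * z ^ n) sums (1 - z) powr (- a)"
proof -
  have "(- a gchoose n) * (- z) ^ n = pochhammer a n / fact n * z ^ n" for n
  proof -
    have "(- a gchoose n) * (- z) ^ n = ((- 1) ^ n * (- 1) ^ n) * (pochhammer a n / fact n * z ^ n)"
      by (simp add: gbinomial_pochhammer power_minus[of z])
    also have "(- 1) ^ n * (- 1) ^ n = (1 :: complex)"
      by (simp add: power_mult_distrib [symmetric])
    finally show ?thesis by simp
  qed
  moreover have "norm (- z) < 1" using assms by simp
  from gen_binomial_complex[OF this, of "- a"]
    have "(\<lambda>n. (- a gchoose n) * (- z) ^ n) sums (1 - z) powr (- a)" by simp
  ultimately show ?thesis by simp
qed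

text \<open>
  Expanding \<open>(1 - t)\<^bsup>q-1\<^esup>\<close> by the binomial theorem and integrating termwise turns the Beta integral
  into a Gauss series at argument \<open>1\<close>, with parameters \<open>1 - q\<close>, \<open>p\<close> and \<open>p + 1\<close>.
\<close>

lemma beta_integral_complex:
  fixes p q :: complex
  assumes p: "Re p > 0" and q: "Re q > 0"
  shows "(LINT t:{0<..<1}|lborel. of_real t powr (p - 1) * of_real (1 - t) powr (q - 1)) =
    Gamma p * Gamma q * rGamma (p + q)" (is "_ = ?V")
proof -
  define c where "c n = pochhammer (1 - q) n / fact n" for n
  define f where "f n t = c n * of_real t powr (p + of_nat n - 1)" for n and t :: real
  have pn: "Re (p + of_nat n) > 0" for n using p by simp
  have norm_f: "norm (f n t) = norm (c n) * (t powr (Re p + real n - 1) * (1 - t) powr (1 - 1))"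
    if "t \<in> {0<..<1}" for n t
    using that unfolding f_def norm_mult by (subst norm_of_real_powr) auto
  have int: "set_integrable lborel {0<..<1} (\<lambda>t. norm (c n) * (t powr (Re p + real n - 1) * (1 - t) powr (1 - 1)))" for n
    using p by (intro set_integrable_mult_right set_integrable_beta_real) auto
  have 1: "set_integrable lborel {0<..<1} (f n)" for n
  proof (rule set_integrable_bound_measurable[OF int])
    show "set_borel_measurable lborel {0<..<1} (f n)" unfolding f_def
      by (intro set_borel_measurable_continuous_lborel continuous_intros) (auto simp: complex_nonpos_Reals_iff)
  qed (use norm_f in auto)
  obtain K1 where K1: "K1 > 0" "\<And>n. norm (c n) \<le> K1 * (real n + 1) powr (Re (1 - q) - 1)"
    using pochhammer_fact_bound unfolding c_def by metis
  have F_eq: "of_real t powr (p - 1) * of_real (1 - t) powr (q - 1) = (\<Sum>n. f n t)"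
    and sumn: "summable (\<lambda>n. norm (f n t))" if t: "t \<in> {0<..<1}" for t
  proof -
    have t': "0 < t" "norm (complex_of_real t) < 1" using t by auto
    have f_eq: "f n t = of_real t powr (p - 1) * (c n * of_real t ^ n)" for n
      unfolding f_def of_real_powr_plus_nat[OF t'(1)] by (simp only: mult_ac)
    have "(\<lambda>n. c n * of_real t ^ n) sums (of_real (1 - t) powr (q - 1))"
      using binomial_series_pochhammer[OF t'(2), of "1 - q"] by (simp add: c_def)
    hence "(\<lambda>n. f n t) sums (of_real t powr (p - 1) * of_real (1 - t) powr (q - 1))"
      unfolding f_eq by (rule sums_mult)
    thus "of_real t powr (p - 1) * of_real (1 - t) powr (q - 1) = (\<Sum>n. f n t)" by (rule sums_unique)
    have "summable (\<lambda>n. norm (c n * of_real t ^ n))"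
    proof (rule summable_comparison_test')
      show "summable (\<lambda>n. K1 * ((real n + 1) powr (Re (1 - q) - 1) * t ^ n))"
        using t by (intro summable_mult summable_powr_times_power) auto
      show "norm (norm (c n * of_real t ^ n)) \<le> K1 * ((real n + 1) powr (Re (1 - q) - 1) * t ^ n)" for n
        using mult_right_mono[OF K1(2)[of n], of "t ^ n"] t by (simp add: norm_mult norm_power mult.assoc)
    qed
    thus "summable (\<lambda>n. norm (f n t))" unfolding f_eq norm_mult[of "_ powr _"] by (rule summable_mult)
  qed
  have 3: "summable (\<lambda>n. LINT t:{0<..<1}|lborel. norm (f n t))"
  proof -
    obtain K2 where K2: "K2 > 0" "\<And>n. Beta (Re p + real n) 1 \<le> K2 * (real n + 1) powr (- 1)"
      using Beta_growth[OF p zero_less_one] by metis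
    have eq: "(LINT t:{0<..<1}|lborel. norm (f n t)) = norm (c n) * Beta (Re p + real n) 1" for n
    proof -
      have "(LINT t:{0<..<1}|lborel. norm (f n t)) =
          (LINT t:{0<..<1}|lborel. norm (c n) * (t powr (Re p + real n - 1) * (1 - t) powr (1 - 1)))"
        by (intro set_lebesgue_integral_cong) (use norm_f in auto)
      also have "\<dots> = norm (c n) * Beta (Re p + real n) 1"
        using set_integrable_beta_real(2)[of "Re p + real n" 1] p by (simp only: set_integral_mult_right)
      finally show ?thesis .
    qed
    show ?thesis unfolding eq
    proof (rule summable_comparison_test'[OF summable_mult[OF summable_Suc_powr]])
      show "- Re q - 1 < -1" using q by simp
      fix n
      have nonneg: "Beta (Re p + real n) 1 \<ge> 0" using p by (simp add: Beta_def Gamma_real_pos less_imp_le)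
      have "norm (c n) * Beta (Re p + real n) 1 \<le>
          (K1 * (real n + 1) powr (Re (1 - q) - 1)) * (K2 * (real n + 1) powr (- 1))"
        by (intro mult_mono K1 K2 nonneg mult_nonneg_nonneg) (use K1 in auto)
      also have "\<dots> = K1 * K2 * ((real n + 1) powr (Re (1 - q) - 1) * (real n + 1) powr (- 1))"
        by (simp only: mult_ac)
      also have "(real n + 1) powr (Re (1 - q) - 1) * (real n + 1) powr (- 1) = (real n + 1) powr (- Re q - 1)"
        by (rule powr_Suc_mult) simp
      finally show "norm (norm (c n) * Beta (Re p + real n) 1) \<le> K1 * K2 * (real n + 1) powr (- Re q - 1)"
        using nonneg by simp
    qed
  qed
  have "(\<lambda>n. LINT t:{0<..<1}|lborel. f n t) sums ?V"
  proof -
    have "Re (p + 1 - (1 - q) - p) > 0" using q by simp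
    from sums_mult[OF gauss_sums[OF this], of "Gamma p"]
    have "(\<lambda>n. Gamma p * gauss_term (1 - q) p (p + 1) n) sums ?V"
      by (simp add: mult_ac add_ac)
    moreover have "Gamma p * gauss_term (1 - q) p (p + 1) n = (LINT t:{0<..<1}|lborel. f n t)" for n
    proof -
      define w where "w = p + of_nat n"
      have "rGamma w \<noteq> 0" using Re_pos_not_nonpos_Ints[OF pn[of n]] by (simp add: rGamma_eq_zero_iff w_def)
      moreover have h: "rGamma w = w * rGamma (w + 1)" by (rule rGamma_plus1 [symmetric])
      ultimately have "w \<noteq> 0" "rGamma (w + 1) \<noteq> 0" by auto
      hence "Gamma w * rGamma (w + 1) = 1 / w" unfolding Gamma_def h by (simp add: divide_simps)
      moreover have "p + 1 + of_nat n = w + 1" by (simp add: w_def)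
      ultimately have *: "Gamma (p + of_nat n) * rGamma (p + 1 + of_nat n) = 1 / (p + of_nat n)"
        by (simp only: w_def)
      have "Gamma p * gauss_term (1 - q) p (p + 1) n = c n * (Gamma (p + of_nat n) * rGamma (p + 1 + of_nat n))"
        by (simp add: gauss_term_def c_def Gamma_plus_of_nat[OF p])
      thus ?thesis unfolding * f_def using power_integral_complex[OF pn[of n]] by simp
    qed
    ultimately show ?thesis by simp
  qed
  from integrate_series_termwise(2)[where f = f, OF 1 sumn 3 F_eq this] show ?thesis by simp
qed


section \<open>The continuation of Gauss's function to a half-plane\<close>

definition hyp_coeff :: "complex \<Rightarrow> complex \<Rightarrow> complex \<Rightarrow> nat \<Rightarrow> complex" where
  "hyp_coeff a b c n = pochhammer a n * pochhammer b n / (pochhammer c n * fact n)"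

definition hyp_fps :: "complex \<Rightarrow> complex \<Rightarrow> complex \<Rightarrow> complex fps" where
  "hyp_fps a b c = Abs_fps (hyp_coeff a b c)"

lemma hyp_fps_nth [simp]: "fps_nth (hyp_fps a b c) n = hyp_coeff a b c n"
  by (simp add: hyp_fps_def)

lemma hyp_coeff_bound:
  assumes "Re c > 0"
  obtains K where "K > 0" "\<And>n. norm (hyp_coeff a b c n) \<le> K * (real n + 1) powr (Re a + Re b - Re c - 1)"
proof -
  obtain K where K: "K > 0" "\<And>n. norm (gauss_term a b c n) \<le> K * (real n + 1) powr (Re a + Re b - Re c - 1)"
    using gauss_term_bound by metis
  have nz: "rGamma c \<noteq> 0" using Re_pos_not_nonpos_Ints[OF assms] by (simp add: rGamma_eq_zero_iff)
  have "norm (hyp_coeff a b c n) \<le> (K / norm (rGamma c)) * (real n + 1) powr (Re a + Re b - Re c - 1)" for n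
  proof -
    have "gauss_term a b c n = rGamma c * hyp_coeff a b c n"
      by (simp add: gauss_term_Re_pos[OF assms] hyp_coeff_def mult_ac)
    hence "norm (hyp_coeff a b c n) = norm (gauss_term a b c n) / norm (rGamma c)"
      using nz by (simp add: norm_mult)
    also have "\<dots> \<le> K * (real n + 1) powr (Re a + Re b - Re c - 1) / norm (rGamma c)"
      by (intro divide_right_mono K) auto
    finally show ?thesis by simp
  qed
  thus ?thesis using that[of "K / norm (rGamma c)"] K(1) nz by simp
qed

lemma summable_hyp:
  assumes "Re c > 0" "norm z < 1"
  shows "summable (\<lambda>n. norm (hyp_coeff a b c n * z ^ n))"
proof (cases "z = 0")
  case True
  have "summable (\<lambda>n. norm (hyp_coeff a b c n * 0 ^ n))"
    by (rule summable_finite[of "{0}"]) auto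
  thus ?thesis using True by simp
next
  case False
  obtain K where K: "K > 0" "\<And>n. norm (hyp_coeff a b c n) \<le> K * (real n + 1) powr (Re a + Re b - Re c - 1)"
    using hyp_coeff_bound[OF assms(1)] by metis
  show ?thesis
  proof (rule summable_comparison_test')
    show "summable (\<lambda>n. K * ((real n + 1) powr (Re a + Re b - Re c - 1) * norm z ^ n))"
      using False assms by (intro summable_mult summable_powr_times_power) auto
    show "norm (norm (hyp_coeff a b c n * z ^ n)) \<le> K * ((real n + 1) powr (Re a + Re b - Re c - 1) * norm z ^ n)" for n
      using mult_right_mono[OF K(2)[of n], of "norm z ^ n"] by (simp add: norm_mult norm_power mult.assoc)
  qed
qed

lemma fps_conv_radius_hyp:
  assumes "Re c > 0"
  shows "fps_conv_radius (hyp_fps a b c) \<ge> 1"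
proof -
  have "conv_radius (hyp_coeff a b c) \<ge> ereal 1"
  proof (rule conv_radius_geI_ex)
    fix r :: real assume "0 < r" "ereal r < ereal 1"
    thus "\<exists>z. norm z = r \<and> summable (\<lambda>n. hyp_coeff a b c n * z ^ n)"
      using summable_norm_cancel[OF summable_hyp[OF assms, of "of_real r"]]
      by (intro exI[of _ "of_real r"]) auto
  qed
  thus ?thesis by (simp add: fps_conv_radius_def hyp_fps_def one_ereal_def)
qed

lemma sums_hyp:
  assumes "Re c > 0" "norm z < 1"
  shows "(\<lambda>n. hyp_coeff a b c n * z ^ n) sums eval_fps (hyp_fps a b c) z"
  using summable_sums[OF summable_norm_cancel[OF summable_hyp[OF assms]]] by (simp add: eval_fps_def)

lemma ball_subset_eball_hyp:
  assumes "Re c > 0"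
  shows "ball 0 1 \<subseteq> eball (0 :: complex) (fps_conv_radius (hyp_fps a b c))"
proof
  fix x :: complex assume "x \<in> ball 0 1"
  hence "ereal (dist 0 x) < 1" by (simp add: one_ereal_def)
  also note fps_conv_radius_hyp[OF assms, of a b]
  finally show "x \<in> eball 0 (fps_conv_radius (hyp_fps a b c))" by (simp add: in_eball_iff)
qed

text \<open>
  Pfaff's form of the continuation. It has the advantage over the Taylor series at \<open>0\<close> that the
  points \<open>1 - 1 / y\<close> with \<open>0 < y < 1\<close>, at which \<open>F\<^sub>3\<close> needs Gauss's function, are moved to \<open>1 - y\<close>.
\<close>

definition pfaff :: "complex \<Rightarrow> complex \<Rightarrow> complex \<Rightarrow> complex \<Rightarrow> complex" where
  "pfaff a b c z = (1 - z) powr (- a) * eval_fps (hyp_fps a (c - b) c) (z / (z - 1))"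

abbreviation left_half :: "complex set" where
  "left_half \<equiv> {z. Re z < 1 / 2}"

lemma left_half_props: "open left_half" "convex left_half" "0 \<in> left_half"
  using open_halfspace_Re_lt[of "1 / 2"] convex_halfspace_Re_lt[of "1 / 2"] by auto

lemma norm_pfaff_argument:
  assumes "z \<in> left_half"
  shows "norm (z / (z - 1)) < 1"
proof -
  have "(norm z)\<^sup>2 < (norm (z - 1))\<^sup>2"
    using assms unfolding cmod_power2 by (simp add: power2_eq_square algebra_simps)
  hence "norm z < norm (z - 1)" by (rule power2_less_imp_less) simp
  thus ?thesis by (simp add: norm_divide divide_simps)
qed

lemma holomorphic_pfaff:
  assumes "Re c > 0"
  shows "pfaff a b c holomorphic_on left_half"
proof -
  have "(eval_fps (hyp_fps a (c - b) c) \<circ> (\<lambda>z. z / (z - 1))) holomorphic_on left_half"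
  proof (rule holomorphic_on_compose_gen)
    show "(\<lambda>z. z / (z - 1)) holomorphic_on left_half"
      by (intro holomorphic_intros) auto
    show "eval_fps (hyp_fps a (c - b) c) holomorphic_on ball 0 1"
      using ball_subset_eball_hyp[OF assms] by (rule holomorphic_on_eval_fps)
    show "(\<lambda>z. z / (z - 1)) ` left_half \<subseteq> ball 0 1"
      using norm_pfaff_argument by auto
  qed
  hence "(\<lambda>z. eval_fps (hyp_fps a (c - b) c) (z / (z - 1))) holomorphic_on left_half"
    by (simp only: o_def)
  moreover have "(\<lambda>z. (1 - z) powr (- a)) holomorphic_on left_half"
    by (intro holomorphic_intros) (auto simp: complex_nonpos_Reals_iff)
  ultimately show ?thesis unfolding pfaff_def [abs_def] by (intro holomorphic_on_mult)
qed

definition binom_fps :: "complex \<Rightarrow> complex fps" where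
  "binom_fps a = Abs_fps (\<lambda>n. pochhammer a n / fact n)"

lemma has_fps_expansion_binom: "(\<lambda>z. (1 - z) powr (- a)) has_fps_expansion binom_fps a"
proof (rule has_fps_expansionI)
  have "eventually (\<lambda>z :: complex. z \<in> ball 0 1) (nhds 0)"
    by (intro eventually_nhds_in_open) auto
  thus "eventually (\<lambda>z. (\<lambda>n. fps_nth (binom_fps a) n * z ^ n) sums (1 - z) powr (- a)) (nhds 0)"
    by eventually_elim (simp only: binom_fps_def fps_nth_Abs_fps, rule binomial_series_pochhammer, simp)
qed

lemma binom_fps_add: "binom_fps (a + b) = binom_fps a * binom_fps b"
proof (rule fps_ext)
  fix n
  have p: "pochhammer x k / fact k = (- 1) ^ k * (- x gchoose k)" for x :: complex and k
    by (simp add: gbinomial_pochhammer mult.assoc [symmetric] power_mult_distrib [symmetric])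
  have "fps_nth (binom_fps a * binom_fps b) n = (\<Sum>k = 0..n. (- 1) ^ n * ((- a gchoose k) * (- b gchoose (n - k))))"
    unfolding fps_mult_nth binom_fps_def fps_nth_Abs_fps p
    by (intro sum.cong refl) (simp add: power_add [symmetric] mult_ac)
  also have "\<dots> = (- 1) ^ n * (- (a + b) gchoose n)"
    using gbinomial_Vandermonde[of "- a" "- b" n] by (simp add: sum_distrib_left [symmetric])
  finally show "fps_nth (binom_fps (a + b)) n = fps_nth (binom_fps a * binom_fps b) n"
    by (simp add: p binom_fps_def)
qed

lemma binom_fps_power: "binom_fps 1 ^ n = binom_fps (of_nat n)"
proof (induction n)
  case 0
  show ?case by (rule fps_ext) (simp add: binom_fps_def pochhammer_0_left)
next
  case (Suc n)
  thus ?case by (simp add: binom_fps_add)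
qed

text \<open>
  Near \<open>0\<close>, Pfaff's transformation is an identity of formal power series, and the coefficients
  are compared by the theorem of Chu and Vandermonde.
\<close>

lemma has_fps_expansion_pfaff:
  assumes "Re c > 0"
  shows "pfaff a b c has_fps_expansion hyp_fps a b c"
proof -
  define F where "F = hyp_fps a (c - b) c"
  define G where "G = - (fps_X * binom_fps 1)"
  have G0: "fps_nth G 0 = 0" by (simp add: G_def)
  have "fps_conv_radius F > 0"
    using fps_conv_radius_hyp[OF assms, of a "c - b"] unfolding F_def by (rule less_le_trans[rotated]) simp
  hence F: "eval_fps F has_fps_expansion F" by (rule eval_fps_has_fps_expansion)
  have "(\<lambda>z. - (z * (1 - z) powr (- 1))) has_fps_expansion G" unfolding G_def
    by (intro fps_expansion_intros has_fps_expansion_binom)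
  also have "(\<lambda>z. - (z * (1 - z) powr (- 1))) = (\<lambda>z :: complex. z / (z - 1))"
  proof
    fix z :: complex
    show "- (z * (1 - z) powr (- 1)) = z / (z - 1)"
      by (cases "z = 1") (auto simp: powr_minus divide_simps algebra_simps)
  qed
  finally have "(\<lambda>z. z / (z - 1)) has_fps_expansion G" .
  from has_fps_expansion_compose[OF F this G0]
  have "(\<lambda>z. (1 - z) powr (- a) * (eval_fps F \<circ> (\<lambda>z. z / (z - 1))) z) has_fps_expansion binom_fps a * (F oo G)"
    by (intro has_fps_expansion_mult has_fps_expansion_binom)
  also have "(\<lambda>z. (1 - z) powr (- a) * (eval_fps F \<circ> (\<lambda>z. z / (z - 1))) z) = pfaff a b c"
    by (simp add: pfaff_def [abs_def] F_def)
  also have "binom_fps a * (F oo G) = hyp_fps a b c"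
  proof (rule fps_ext)
    fix n
    have Gz: "fps_nth (G ^ i) j = 0" if "j < i" for i j
      using startsby_zero_power_prefix[OF G0] that by blast
    have "fps_nth (binom_fps a * (F oo G)) n =
        (\<Sum>j = 0..n. fps_nth (binom_fps a) j * (\<Sum>i = 0..n - j. fps_nth F i * fps_nth (G ^ i) (n - j)))"
      by (simp add: fps_mult_nth fps_compose_nth)
    also have "\<dots> = (\<Sum>j = 0..n. \<Sum>i = 0..n. fps_nth F i * (fps_nth (binom_fps a) j * fps_nth (G ^ i) (n - j)))"
    proof (intro sum.cong refl)
      fix j
      have "(\<Sum>i = 0..n - j. fps_nth F i * fps_nth (G ^ i) (n - j)) = (\<Sum>i = 0..n. fps_nth F i * fps_nth (G ^ i) (n - j))"
        by (intro sum.mono_neutral_left) (auto simp: Gz)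
      thus "fps_nth (binom_fps a) j * (\<Sum>i = 0..n - j. fps_nth F i * fps_nth (G ^ i) (n - j)) =
          (\<Sum>i = 0..n. fps_nth F i * (fps_nth (binom_fps a) j * fps_nth (G ^ i) (n - j)))"
        by (simp add: sum_distrib_left mult_ac)
    qed
    also have "\<dots> = (\<Sum>i = 0..n. fps_nth F i * fps_nth (binom_fps a * G ^ i) n)"
      by (subst sum.swap) (simp add: fps_mult_nth sum_distrib_left)
    also have "\<dots> = (\<Sum>i = 0..n. pochhammer a n / fact n *
        (pochhammer (c - b) i * pochhammer (- of_nat n) i / (fact i * pochhammer c i)))"
    proof (intro sum.cong refl)
      fix i assume "i \<in> {0..n}"
      hence i: "i \<le> n" by simp
      have "binom_fps a * G ^ i = fps_const ((- 1) ^ i) * (fps_X ^ i * binom_fps (a + of_nat i))"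
        by (simp add: G_def power_minus[of "fps_X * binom_fps 1"] power_mult_distrib binom_fps_power binom_fps_add
            fps_const_power [symmetric] fps_const_neg [symmetric] del: fps_const_power fps_const_neg)
      hence 1: "fps_nth (binom_fps a * G ^ i) n = (- 1) ^ i * (pochhammer (a + of_nat i) (n - i) / fact (n - i))"
        using i by (simp add: fps_X_power_mult_nth binom_fps_def)
      have 2: "pochhammer a n = pochhammer a i * pochhammer (a + of_nat i) (n - i)"
        using i by (rule pochhammer_product)
      have "(of_nat (n choose i) :: complex) = (- 1) ^ i * pochhammer (- of_nat n) i / fact i"
        by (simp add: binomial_gbinomial gbinomial_pochhammer)
      hence "fact n / fact (n - i) = (- 1 :: complex) ^ i * pochhammer (- of_nat n) i" 
        using i by (simp add: binomial_fact field_simps)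
      hence 3: "pochhammer (- of_nat n) i = (- 1) ^ i * (fact n / fact (n - i) :: complex)"
        by (simp add: mult.assoc [symmetric] power_mult_distrib [symmetric] del: times_divide_eq_right)
      show "fps_nth F i * fps_nth (binom_fps a * G ^ i) n = pochhammer a n / fact n *
        (pochhammer (c - b) i * pochhammer (- of_nat n) i / (fact i * pochhammer c i))"
        unfolding 1 2 3 by (simp add: F_def hyp_coeff_def field_simps)
    qed
    also have "\<dots> = pochhammer a n / fact n * (pochhammer b n / pochhammer c n)"
    proof -
      have "\<forall>i\<in>{0..<n}. c \<noteq> - of_nat i"
        using add_of_nat_nonzero[OF assms] by (simp add: eq_neg_iff_add_eq_0)
      from Vandermonde_pochhammer[OF this, of "c - b"] show ?thesis
        unfolding sum_distrib_left [symmetric] by simp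
    qed
    finally show "fps_nth (binom_fps a * (F oo G)) n = fps_nth (hyp_fps a b c) n"
      by (simp add: hyp_coeff_def field_simps)
  qed
  finally show ?thesis .
qed

lemma fps_expansion_identity:
  fixes f g :: "complex \<Rightarrow> complex"
  assumes "f has_fps_expansion F" "g has_fps_expansion F"
    and "f holomorphic_on S" "g holomorphic_on S" "open S" "connected S" "0 \<in> S" "z \<in> S"
  shows "f z = g z"
proof -
  have "eventually (\<lambda>z. eval_fps F z = f z \<and> eval_fps F z = g z \<and> z \<in> S) (nhds 0)"
    using assms by (intro eventually_conj eventually_nhds_in_open) (auto simp: has_fps_expansion_def)
  then obtain U where "open U" "0 \<in> U" and "\<forall>z\<in>U. eval_fps F z = f z \<and> eval_fps F z = g z \<and> z \<in> S"
    unfolding eventually_nhds by blast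
  hence U: "\<And>z. z \<in> U \<Longrightarrow> f z = g z \<and> z \<in> S" by metis
  show ?thesis
    by (rule analytic_continuation_open[of U S f g]) (use assms U \<open>open U\<close> \<open>0 \<in> U\<close> in auto)
qed

text \<open>
  Near \<open>0\<close>, Pfaff's form and Gauss's series agree; both are holomorphic on the intersection of the
  half-plane and the unit disc, which is convex and therefore connected.
\<close>

lemma sums_pfaff:
  assumes "Re c > 0" "z \<in> left_half" "norm z < 1"
  shows "(\<lambda>k. pochhammer a k * pochhammer b k / pochhammer c k * z ^ k / fact k) sums pfaff a b c z"
proof -
  have "fps_conv_radius (hyp_fps a b c) > 0"
    using fps_conv_radius_hyp[OF assms(1), of a b] by (rule less_le_trans[rotated]) simp
  hence "eval_fps (hyp_fps a b c) z = pfaff a b c z"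
    using assms left_half_props
    by (intro fps_expansion_identity[of _ "hyp_fps a b c" _ "left_half \<inter> ball 0 1"]
        has_fps_expansion_pfaff eval_fps_has_fps_expansion holomorphic_on_eval_fps
        holomorphic_on_subset[OF holomorphic_pfaff] convex_connected convex_Int open_Int
        order_trans[OF _ ball_subset_eball_hyp]) auto
  thus ?thesis using sums_hyp[OF assms(1,3), of a b] by (simp add: hyp_coeff_def mult_ac)
qed

text \<open>
  Pfaff's form on the half-plane qualifies as a continuation, and any other continuation coincides
  with it on the convex intersection of their domains, which contains \<open>0\<close> and \<open>z\<close>.
\<close>

lemma hyp2F1_eq_pfaff:
  assumes c: "Re c > 0" and z: "z \<in> left_half"
  shows "hyp2F1 a b c z = pfaff a b c z"
  unfolding hyp2F1_def
proof (rule the_equality)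
  let ?P = "\<lambda>w. \<exists>S f. open S \<and> convex S \<and> 0 \<in> S \<and> z \<in> S \<and> f holomorphic_on S \<and>
        (\<forall>y\<in>S. cmod y < 1 \<longrightarrow>
           (\<lambda>k. pochhammer a k * pochhammer b k / pochhammer c k * y ^ k / fact k) sums f y) \<and> w = f z"
  show "?P (pfaff a b c z)"
    using left_half_props holomorphic_pfaff[OF c] sums_pfaff[OF c] z
    by (intro exI[of _ left_half] exI[of _ "pfaff a b c"]) blast
  fix w assume "?P w"
  then obtain S f where S: "open S" "convex S" "0 \<in> S" "z \<in> S" "f holomorphic_on S"
    and f: "\<And>y. y \<in> S \<Longrightarrow> cmod y < 1 \<Longrightarrow>
      (\<lambda>k. pochhammer a k * pochhammer b k / pochhammer c k * y ^ k / fact k) sums f y" and w: "w = f z"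
    by blast
  have "f z = pfaff a b c z"
  proof (rule analytic_continuation_open[of "S \<inter> left_half \<inter> ball 0 1" "S \<inter> left_half" f "pfaff a b c"])
    fix y assume y: "y \<in> S \<inter> left_half \<inter> ball 0 1"
    thus "f y = pfaff a b c y" using f[of y] sums_pfaff[OF c, of y a b] sums_unique2 by auto
  next
    show "connected (S \<inter> left_half)"
      using S left_half_props by (intro convex_connected convex_Int)
    have "0 \<in> S \<inter> left_half \<inter> ball 0 1" using S by simp
    thus "S \<inter> left_half \<inter> ball 0 1 \<noteq> {}" by blast
  qed (use S z left_half_props holomorphic_pfaff[OF c] in \<open>auto intro: holomorphic_on_subset\<close>)
  thus "w = pfaff a b c z" using w by simp
qed

lemma pfaff_at:
  assumes "Re c > 0" "0 < y" "y < 1"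
  shows "pfaff a b c (of_real (1 - 1 / y)) =
    of_real y powr a * (\<Sum>n. hyp_coeff a (c - b) c n * of_real ((1 - y) ^ n))"
proof -
  have "(1 - complex_of_real (1 - 1 / y)) powr (- a) = of_real y powr a"
  proof -
    have "(1 - complex_of_real (1 - 1 / y)) powr (- a) = inverse (of_real y) powr (- a)"
      by (simp add: inverse_eq_divide)
    also have "\<dots> = of_real y powr a"
      using assms by (subst powr_minus) (simp add: powr_def Ln_inverse complex_nonpos_Reals_iff exp_minus [symmetric])
    finally show ?thesis .
  qed
  moreover have "complex_of_real (1 - 1 / y) / (of_real (1 - 1 / y) - 1) = of_real (1 - y)"
    using assms by (simp add: field_simps)
  ultimately show ?thesis by (simp add: pfaff_def eval_fps_def)
qed

text \<open>
  The hypergeometric differential equation: the first two derivatives of Gauss's function are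
  multiples of the functions with all parameters raised by \<open>1\<close> and by \<open>2\<close>. The identity is checked on
  power series coefficients and extends to the half-plane by the identity theorem.
\<close>

lemma pfaff_recurrence:
  assumes c: "Re c > 0" and z: "z \<in> left_half"
  shows "pfaff a b c z = (1 - (a + b + 1) / c * z) * pfaff (a + 1) (b + 1) (c + 1) z +
    (a + 1) * (b + 1) / (c * (c + 1)) * (z * (1 - z)) * pfaff (a + 2) (b + 2) (c + 2) z"
proof -
  define k where "k = (a + b + 1) / c"
  define m where "m = (a + 1) * (b + 1) / (c * (c + 1))"
  define F1 where "F1 = hyp_fps (a + 1) (b + 1) (c + 1)"
  define F2 where "F2 = hyp_fps (a + 2) (b + 2) (c + 2)"
  define f1 where "f1 = pfaff (a + 1) (b + 1) (c + 1)"
  define f2 where "f2 = pfaff (a + 2) (b + 2) (c + 2)"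
  define g where "g = (\<lambda>z. f1 z - k * (z * f1 z) + m * (z * f2 z) - m * (z * (z * f2 z)))"
  have c': "Re (c + 1) > 0" "Re (c + 2) > 0" using c by auto
  have cnz: "c + of_nat j \<noteq> 0" for j by (rule add_of_nat_nonzero[OF c])
  have "g has_fps_expansion (F1 - fps_const k * (fps_X * F1) + fps_const m * (fps_X * F2)
      - fps_const m * (fps_X * (fps_X * F2)))"
    unfolding g_def f1_def f2_def F1_def F2_def
    by (intro fps_expansion_intros has_fps_expansion_pfaff c')
  also have "F1 - fps_const k * (fps_X * F1) + fps_const m * (fps_X * F2)
      - fps_const m * (fps_X * (fps_X * F2)) = hyp_fps a b c"
  proof (rule fps_ext)
    fix n :: nat
    have nz: "c \<noteq> 0" "c + 1 \<noteq> 0" using cnz[of 0] cnz[of 1] by auto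
    consider "n = 0" | "n = 1" | j where "n = Suc (Suc j)" by (metis not0_implies_Suc One_nat_def)
    thus "fps_nth (F1 - fps_const k * (fps_X * F1) + fps_const m * (fps_X * F2)
      - fps_const m * (fps_X * (fps_X * F2))) n = fps_nth (hyp_fps a b c) n"
    proof cases
      case 1 thus ?thesis by (simp add: F1_def F2_def hyp_coeff_def)
    next
      case 2
      have "(a + 1) * (b + 1) / (c + 1) - (a + b + 1) / c + (a + 1) * (b + 1) / (c * (c + 1)) = a * b / c"
        using nz by (simp add: divide_simps) algebra
      thus ?thesis by (simp add: 2 F1_def F2_def hyp_coeff_def k_def m_def)
    next
      case (3 j)
      define A where "A = pochhammer (a + 2) j"
      define B where "B = pochhammer (b + 2) j"
      define C where "C = pochhammer (c + 2) j"
      define J :: complex where "J = of_nat j"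
      have Cnz: "C \<noteq> 0" unfolding C_def by (rule pochhammer_nonzero_Re_pos) (use c in auto)
      have nzs: "c + 2 + J \<noteq> 0" "J + 1 \<noteq> 0" "J + 2 \<noteq> 0"
        using cnz[of "2 + j"] of_nat_neq_0[of j, where 'a = complex] of_nat_neq_0[of "Suc j", where 'a = complex]
        by (simp_all add: J_def add_ac)
      have p2: "pochhammer (x + 1) (Suc j) = (x + 1) * pochhammer (x + 2) j" for x :: complex
        using pochhammer_rec[of "x + 1" j] by (simp add: add.assoc)
      have p3: "pochhammer x (Suc (Suc j)) = x * ((x + 1) * pochhammer (x + 2) j)" for x :: complex
        by (simp only: pochhammer_rec[of x "Suc j"] p2)
      have p4: "pochhammer (x + 1) (Suc (Suc j)) = (x + 1) * (pochhammer (x + 2) j * (x + 2 + J))" for x :: complex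
        by (subst pochhammer_Suc, subst p2) (simp add: J_def add_ac mult_ac)
      have p5: "pochhammer (x + 2) (Suc j) = pochhammer (x + 2) j * (x + 2 + J)" for x :: complex
        by (simp add: pochhammer_Suc J_def)
      have f: "fact (Suc j) = (J + 1) * fact j" "fact (Suc (Suc j)) = (J + 2) * ((J + 1) * fact j)"
        by (simp_all add: J_def algebra_simps)
      have "fps_nth (F1 - fps_const k * (fps_X * F1) + fps_const m * (fps_X * F2)
        - fps_const m * (fps_X * (fps_X * F2))) n =
        hyp_coeff (a + 1) (b + 1) (c + 1) (Suc (Suc j)) - k * hyp_coeff (a + 1) (b + 1) (c + 1) (Suc j)
        + m * hyp_coeff (a + 2) (b + 2) (c + 2) (Suc j) - m * hyp_coeff (a + 2) (b + 2) (c + 2) j"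
        by (simp add: 3 F1_def F2_def)
      also have "\<dots> = hyp_coeff a b c (Suc (Suc j))"
        unfolding hyp_coeff_def p2 p5 p3[of a] p3[of b] p3[of c] p4[of a] p4[of b] p4[of c] f k_def m_def A_def [symmetric] B_def [symmetric] C_def [symmetric]
        using nz nzs Cnz by (simp add: divide_simps) algebra
      finally show ?thesis by (simp add: 3)
    qed
  qed
  finally have g: "g has_fps_expansion hyp_fps a b c" .
  have "g holomorphic_on left_half"
    unfolding g_def f1_def f2_def by (intro holomorphic_intros holomorphic_pfaff c')
  hence "pfaff a b c z = g z"
    using z left_half_props
    by (intro fps_expansion_identity[OF has_fps_expansion_pfaff[OF c] g, of left_half]
        holomorphic_pfaff[OF c] convex_connected)
  also have "g z = (1 - k * z) * f1 z + m * (z * (1 - z)) * f2 z"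
    by (simp add: g_def algebra_simps)
  finally show ?thesis by (simp only: k_def m_def f1_def f2_def)
qed


section \<open>A uniform bound for Gauss's function\<close>

text \<open>The coefficients are dominated by those of the binomial series of \<open>y\<^bsup>-p\<^esup> = (1 - (1 - y))\<^bsup>-p\<^esup>\<close>.\<close>

lemma powr_series_bound:
  fixes p :: real
  assumes "p > 0"
  obtains C where "C > 0"
    "\<And>y. 0 < y \<Longrightarrow> y < 1 \<Longrightarrow> (\<Sum>l. (real l + 1) powr (p - 1) * (1 - y) ^ l) \<le> C * y powr (- p)"
proof -
  have "Re (complex_of_real p) > 0" using assms by simp
  then obtain C where C: "C > 0" "\<And>l. norm (pochhammer 1 l / pochhammer (complex_of_real p) l) \<le> C * (real l + 1) powr (Re 1 - Re (of_real p))"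
    using pochhammer_quotient_bound_0[of "of_real p" 1] by metis
  have le: "(real l + 1) powr (p - 1) \<le> C * (pochhammer p l / fact l)" for l
  proof -
    have pos: "pochhammer p l > 0" using assms by (rule pochhammer_pos)
    have "norm (pochhammer 1 l / pochhammer (complex_of_real p) l) = fact l / pochhammer p l"
      using pos by (simp add: pochhammer_fact [symmetric] norm_divide pochhammer_of_real)
    with C(2)[of l] have "fact l / pochhammer p l \<le> C / (real l + 1) powr (p - 1)"
      by (simp add: powr_diff)
    thus ?thesis using pos by (simp add: field_simps)
  qed
  have "(\<Sum>l. (real l + 1) powr (p - 1) * (1 - y) ^ l) \<le> C * y powr (- p)" if y: "0 < y" "y < 1" for y
  proof -
    have "norm (complex_of_real (1 - y)) < 1" using y by (simp only: norm_of_real)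
    from binomial_series_pochhammer[OF this, of "of_real p"]
    moreover have "(1 - complex_of_real (1 - y)) powr (- of_real p) = of_real (y powr (- p))"
      using y powr_of_real[of y "- p"] by simp
    moreover have "pochhammer (of_real p) l / fact l * of_real (1 - y) ^ l =
        complex_of_real (pochhammer p l / fact l * (1 - y) ^ l)" for l
      by (simp add: pochhammer_of_real)
    ultimately have "(\<lambda>l. complex_of_real (pochhammer p l / fact l * (1 - y) ^ l)) sums of_real (y powr (- p))"
      by (simp only:)
    hence s: "(\<lambda>l. pochhammer p l / fact l * (1 - y) ^ l) sums y powr (- p)"
      by (simp only: sums_of_real_iff)
    have "(\<Sum>l. (real l + 1) powr (p - 1) * (1 - y) ^ l) \<le> (\<Sum>l. C * (pochhammer p l / fact l * (1 - y) ^ l))"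
    proof (intro suminf_le summable_powr_times_power summable_mult sums_summable[OF s])
      show "(real l + 1) powr (p - 1) * (1 - y) ^ l \<le> C * (pochhammer p l / fact l * (1 - y) ^ l)" for l
        using mult_right_mono[OF le[of l], of "(1 - y) ^ l"] y by (simp add: mult.assoc)
    qed (use y in auto)
    also have "\<dots> = C * y powr (- p)" using s suminf_mult[OF sums_summable[OF s], of C] by (simp only: sums_unique[OF s])
    finally show ?thesis .
  qed
  thus ?thesis using that C(1) by blast
qed

text \<open>
  When both upper parameters have positive real part, Pfaff's series may be estimated term by term:
  once with the decay of the quotient \<open>(c - b)\<^sub>l / (c)\<^sub>l\<close> dropped, and once with \<open>k + l + 1\<close> replaced
  by \<open>l + 1\<close> in it. The former is good for \<open>(k + 1) y \<ge> 1\<close>, the latter for \<open>(k + 1) y \<le> 1\<close>.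
\<close>

lemma pfaff_bound_positive:
  assumes g: "Re g > 0" and l: "0 < \<kappa>" "\<kappa> < Re a" "\<kappa> < Re b"
  obtains C where "C > 0" "\<And>k y. 0 < y \<Longrightarrow> y < 1 \<Longrightarrow>
    norm (pfaff a b (g + of_nat k) (of_real (1 - 1 / y))) \<le> C * (1 + 1 / ((real k + 1) * y)) powr (- \<kappa>)"
proof -
  have al: "Re a > 0" "Re a - \<kappa> > 0" using l by auto
  obtain K1 where K1: "K1 > 0" "\<And>n. norm (pochhammer a n / fact n) \<le> K1 * (real n + 1) powr (Re a - 1)"
    using pochhammer_fact_bound by metis
  obtain K2 where K2: "K2 > 0" "\<And>k l. norm (pochhammer (g - b + of_nat k) l / pochhammer (g + of_nat k) l) \<le>
       K2 * ((real k + 1) / (real k + real l + 1)) powr Re b"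
    using pochhammer_quotient_bound[OF g] by metis
  obtain C1 where C1: "C1 > 0" "\<And>y. 0 < y \<Longrightarrow> y < 1 \<Longrightarrow> (\<Sum>l. (real l + 1) powr (Re a - 1) * (1 - y) ^ l) \<le> C1 * y powr (- Re a)"
    using powr_series_bound[OF al(1)] by metis
  obtain C2 where C2: "C2 > 0" "\<And>y. 0 < y \<Longrightarrow> y < 1 \<Longrightarrow> (\<Sum>l. (real l + 1) powr (Re a - \<kappa> - 1) * (1 - y) ^ l) \<le> C2 * y powr (- (Re a - \<kappa>))"
    using powr_series_bound[OF al(2)] by metis
  define C where "C = K1 * K2 * max C1 C2 * 2 powr \<kappa>"
  have "C > 0" using K1 K2 C1 C2 by (simp add: C_def)
  moreover have "norm (pfaff a b (g + of_nat k) (of_real (1 - 1 / y))) \<le> C * (1 + 1 / ((real k + 1) * y)) powr (- \<kappa>)"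
    if y: "0 < y" "y < 1" for k y
  proof -
    have c: "Re (g + of_nat k) > 0" using g by simp
    define s where "s = (real k + 1) * y"
    have s: "s > 0" using y by (simp add: s_def)
    define u where "u n = norm (hyp_coeff a (g + of_nat k - b) (g + of_nat k) n * of_real ((1 - y) ^ n))" for n
    have "norm (complex_of_real (1 - y)) < 1" using y by (simp only: norm_of_real)
    hence su: "summable u"
      unfolding u_def [abs_def] of_real_power by (rule summable_hyp[OF c])
    have u_le: "u n \<le> K1 * K2 * ((real n + 1) powr (Re a - 1) * ((real k + 1) / (real k + real n + 1)) powr \<kappa> * (1 - y) ^ n)" for n
    proof -
      have "u n = norm (pochhammer a n / fact n) * norm (pochhammer (g - b + of_nat k) n / pochhammer (g + of_nat k) n) * (1 - y) ^ n"
      proof -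
        have "hyp_coeff a (g + of_nat k - b) (g + of_nat k) n = pochhammer a n / fact n *
            (pochhammer (g - b + of_nat k) n / pochhammer (g + of_nat k) n)"
          by (simp add: hyp_coeff_def diff_add_eq mult.commute)
        moreover have "norm (complex_of_real ((1 - y) ^ n)) = (1 - y) ^ n"
          using y by (simp only: norm_of_real abs_of_nonneg zero_le_power diff_ge_0_iff_ge less_imp_le)
        ultimately show ?thesis unfolding u_def by (simp only: norm_mult)
      qed
      also have "\<dots> \<le> (K1 * (real n + 1) powr (Re a - 1)) * (K2 * ((real k + 1) / (real k + real n + 1)) powr \<kappa>) * (1 - y) ^ n"
      proof (intro mult_right_mono mult_mono K1 order_trans[OF K2(2)] mult_left_mono)
        show "((real k + 1) / (real k + real n + 1)) powr Re b \<le> ((real k + 1) / (real k + real n + 1)) powr \<kappa>"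
          using l by (intro powr_mono') auto
      qed (use y K1 K2 in auto)
      finally show ?thesis by (simp add: mult_ac)
    qed
    have ya: "y powr Re a > 0" using y by simp
    have bnd: "norm (pfaff a b (g + of_nat k) (of_real (1 - 1 / y))) \<le> y powr Re a * (\<Sum>n. u n)"
      unfolding pfaff_at[OF c y] norm_mult using su y
      by (intro mult_mono order_trans[OF summable_norm[OF su [unfolded u_def [abs_def]]]])
        (simp_all only: norm_of_real_powr u_def order_refl norm_ge_zero powr_ge_zero)
    have "(\<Sum>n. u n) \<le> (\<Sum>n. K1 * K2 * ((real n + 1) powr (Re a - 1) * (1 - y) ^ n))"
    proof (intro suminf_le su summable_mult summable_powr_times_power order_trans[OF u_le] mult_left_mono mult_right_mono)
      show "(real n + 1) powr (Re a - 1) * ((real k + 1) / (real k + real n + 1)) powr \<kappa> \<le> (real n + 1) powr (Re a - 1)" for n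
        using l by (intro mult_right_le_one_le powr_le1) auto
    qed (use y K1 K2 in auto)
    also have "\<dots> = K1 * K2 * (\<Sum>n. (real n + 1) powr (Re a - 1) * (1 - y) ^ n)"
      using y by (intro suminf_mult summable_powr_times_power) auto
    also have "\<dots> \<le> K1 * K2 * (C1 * y powr (- Re a))"
      using y K1 K2 by (intro mult_left_mono C1) auto
    finally have "y powr Re a * (\<Sum>n. u n) \<le> y powr Re a * (K1 * K2 * (C1 * y powr (- Re a)))"
      using ya by (intro mult_left_mono) auto
    also have "\<dots> = K1 * K2 * C1" using y by (simp add: powr_minus field_simps)
    finally have b1: "y powr Re a * (\<Sum>n. u n) \<le> K1 * K2 * C1" .
    have "(\<Sum>n. u n) \<le> (\<Sum>n. K1 * K2 * (real k + 1) powr \<kappa> * ((real n + 1) powr (Re a - \<kappa> - 1) * (1 - y) ^ n))"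
    proof (intro suminf_le su summable_mult summable_powr_times_power)
      fix n
      have "((real k + 1) / (real k + real n + 1)) powr \<kappa> \<le> ((real k + 1) / (real n + 1)) powr \<kappa>"
        using l by (intro powr_mono2 divide_left_mono) auto
      also have "\<dots> = (real k + 1) powr \<kappa> / (real n + 1) powr \<kappa>" by (simp add: powr_divide)
      finally have "(real n + 1) powr (Re a - 1) * ((real k + 1) / (real k + real n + 1)) powr \<kappa> * (1 - y) ^ n
          \<le> (real n + 1) powr (Re a - 1) * ((real k + 1) powr \<kappa> / (real n + 1) powr \<kappa>) * (1 - y) ^ n"
        using y by (intro mult_right_mono mult_left_mono) auto
      also have "\<dots> = (real k + 1) powr \<kappa> * ((real n + 1) powr (Re a - \<kappa> - 1) * (1 - y) ^ n)"
        by (simp add: powr_diff mult_ac)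
      finally have "K1 * K2 * ((real n + 1) powr (Re a - 1) * ((real k + 1) / (real k + real n + 1)) powr \<kappa> * (1 - y) ^ n) \<le>
          K1 * K2 * ((real k + 1) powr \<kappa> * ((real n + 1) powr (Re a - \<kappa> - 1) * (1 - y) ^ n))"
        using K1 K2 by (intro mult_left_mono) auto
      with u_le[of n] show "u n \<le> K1 * K2 * (real k + 1) powr \<kappa> * ((real n + 1) powr (Re a - \<kappa> - 1) * (1 - y) ^ n)"
        by (simp only: mult.assoc)
    qed (use y in auto)
    also have "\<dots> = K1 * K2 * (real k + 1) powr \<kappa> * (\<Sum>n. (real n + 1) powr (Re a - \<kappa> - 1) * (1 - y) ^ n)"
      using y by (intro suminf_mult summable_powr_times_power) auto
    also have "\<dots> \<le> K1 * K2 * (real k + 1) powr \<kappa> * (C2 * y powr (- (Re a - \<kappa>)))"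
      using y K1 K2 by (intro mult_left_mono C2) auto
    finally have "y powr Re a * (\<Sum>n. u n) \<le> y powr Re a * (K1 * K2 * (real k + 1) powr \<kappa> * (C2 * y powr (- (Re a - \<kappa>))))"
      using ya by (intro mult_left_mono) auto
    also have "\<dots> = K1 * K2 * C2 * s powr \<kappa>"
    proof -
      have "s powr \<kappa> = (real k + 1) powr \<kappa> * y powr \<kappa>"
        unfolding s_def by (subst powr_mult) (use y in auto)
      moreover have "y powr Re a * y powr (- (Re a - \<kappa>)) = y powr \<kappa>"
        by (simp add: powr_add [symmetric])
      ultimately show ?thesis by (simp add: mult_ac)
    qed
    finally have b2: "y powr Re a * (\<Sum>n. u n) \<le> K1 * K2 * C2 * s powr \<kappa>" .
    have "y powr Re a * (\<Sum>n. u n) \<le> K1 * K2 * max C1 C2 * min 1 s powr \<kappa>"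
    proof (cases "s \<le> 1")
      case True
      have "K1 * K2 * C2 * s powr \<kappa> \<le> K1 * K2 * max C1 C2 * s powr \<kappa>"
        using K1 K2 by (intro mult_right_mono mult_left_mono) auto
      with b2 True show ?thesis by (simp add: min_def)
    next
      case False
      have "K1 * K2 * C1 \<le> K1 * K2 * max C1 C2" using K1 K2 by (intro mult_left_mono) auto
      with b1 False show ?thesis by (simp add: min_def)
    qed
    also have "min 1 s powr \<kappa> \<le> 2 powr \<kappa> * (1 + 1 / s) powr (- \<kappa>)"
    proof -
      have "min 1 s \<le> 2 / (1 + 1 / s)" using s by (auto simp: min_def field_simps)
      hence "min 1 s powr \<kappa> \<le> (2 / (1 + 1 / s)) powr \<kappa>"
        using s l by (intro powr_mono2) auto
      also have "\<dots> = 2 powr \<kappa> * (1 + 1 / s) powr (- \<kappa>)"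
        using s by (subst powr_divide) (auto simp: powr_minus divide_inverse)
      finally show ?thesis .
    qed
    finally have "y powr Re a * (\<Sum>n. u n) \<le> K1 * K2 * max C1 C2 * (2 powr \<kappa> * (1 + 1 / s) powr (- \<kappa>))"
      using K1 K2 C1 C2 by (simp add: mult_left_mono)
    with bnd show ?thesis by (simp add: C_def s_def mult.assoc)
  qed
  ultimately show ?thesis using that by blast
qed

text \<open>
  The general case is reduced to the preceding one by the recurrence: with \<open>s = (k + 1) y\<close> its two
  coefficients are of order \<open>1 + 1/s\<close> and \<open>1/s\<^sup>2\<close>, which is exactly what the bound loses when the
  upper parameters are lowered by \<open>1\<close> and \<open>2\<close>. A termwise estimate would not do here, because for
  \<open>Re a < 0\<close> and \<open>Re b < 0\<close> there is cancellation in Pfaff's series.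
\<close>

lemma pfaff_bound:
  assumes "Re g > 0" "- Re a < \<nu>" "- Re b < \<nu>"
  obtains C where "C > 0" "\<And>k y. 0 < y \<Longrightarrow> y < 1 \<Longrightarrow>
    norm (pfaff a b (g + of_nat k) (of_real (1 - 1 / y))) \<le> C * (1 + 1 / ((real k + 1) * y)) powr \<nu>"
proof -
  define bounded where "bounded a b g \<nu> \<longleftrightarrow> (\<exists>C>0. \<forall>k y. 0 < y \<and> y < 1 \<longrightarrow>
    norm (pfaff a b (g + of_nat k) (of_real (1 - 1 / y))) \<le> C * (1 + 1 / ((real k + 1) * y)) powr \<nu>)" for a b g and \<nu> :: real
  have main: "\<forall>a b g \<nu>. Re g > 0 \<and> - Re a < \<nu> \<and> - Re b < \<nu> \<and> \<nu> < real N \<longrightarrow> bounded a b g \<nu>" for N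
  proof (induction N)
    case 0
    show ?case
    proof (intro allI impI)
      fix a b g and \<nu> :: real assume *: "Re g > 0 \<and> - Re a < \<nu> \<and> - Re b < \<nu> \<and> \<nu> < real 0"
      obtain C where "C > 0" "\<And>k y. 0 < y \<Longrightarrow> y < 1 \<Longrightarrow>
        norm (pfaff a b (g + of_nat k) (of_real (1 - 1 / y))) \<le> C * (1 + 1 / ((real k + 1) * y)) powr (- (- \<nu>))"
        using pfaff_bound_positive[of g "- \<nu>" a b] * by auto
      thus "bounded a b g \<nu>"
        unfolding bounded_def by auto
    qed
  next
    case (Suc N)
    show ?case
    proof (intro allI impI)
      fix a b g and \<nu> :: real assume *: "Re g > 0 \<and> - Re a < \<nu> \<and> - Re b < \<nu> \<and> \<nu> < real (Suc N)"
      have "Re (g + 1) > 0 \<and> - Re (a + 1) < \<nu> - 1 \<and> - Re (b + 1) < \<nu> - 1 \<and> \<nu> - 1 < real N" using * by auto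
      with Suc obtain C1 where C1: "C1 > 0" "\<And>k y. 0 < y \<Longrightarrow> y < 1 \<Longrightarrow>
        norm (pfaff (a + 1) (b + 1) (g + 1 + of_nat k) (of_real (1 - 1 / y))) \<le> C1 * (1 + 1 / ((real k + 1) * y)) powr (\<nu> - 1)"
        unfolding bounded_def by metis
      have "Re (g + 2) > 0 \<and> - Re (a + 2) < \<nu> - 2 \<and> - Re (b + 2) < \<nu> - 2 \<and> \<nu> - 2 < real N" using * by auto
      with Suc obtain C2 where C2: "C2 > 0" "\<And>k y. 0 < y \<Longrightarrow> y < 1 \<Longrightarrow>
        norm (pfaff (a + 2) (b + 2) (g + 2 + of_nat k) (of_real (1 - 1 / y))) \<le> C2 * (1 + 1 / ((real k + 1) * y)) powr (\<nu> - 2)"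
        unfolding bounded_def by metis
      define d where "d = min 1 (Re g)"
      have d: "d > 0" using * by (simp add: d_def)
      define M1 where "M1 = norm (a + b + 1) / d"
      define M2 where "M2 = norm ((a + 1) * (b + 1)) / d\<^sup>2"
      have M: "M1 \<ge> 0" "M2 \<ge> 0" using d by (auto simp: M1_def M2_def)
      have "norm (pfaff a b (g + of_nat k) (of_real (1 - 1 / y))) \<le>
          ((1 + M1) * C1 + M2 * C2) * (1 + 1 / ((real k + 1) * y)) powr \<nu>" if y: "0 < y" "y < 1" for k y
      proof -
        define z where "z = complex_of_real (1 - 1 / y)"
        define c where "c = g + of_nat k"
        define s where "s = (real k + 1) * y"
        define q where "q = 1 + 1 / s"
        have s: "s > 0" using y by (simp add: s_def)
        have q: "q \<ge> 1" "1 / s \<le> q" using s by (auto simp: q_def)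
        have c: "Re c > 0" using * by (simp add: c_def)
        have c1: "norm c \<ge> d * (real k + 1)"
          using norm_add_of_nat_ge[of g k] * by (simp add: c_def d_def)
        have "d * (real k + 1) \<le> Re c"
          using * by (simp add: c_def d_def min_def algebra_simps)
            (smt (verit) mult_left_le_one_le mult_right_mono of_nat_0_le_iff mult_less_cancel_right2 mult_right_le_one_le)
        also have "\<dots> \<le> norm (c + 1)"
          using complex_Re_le_cmod[of "c + 1"] by simp
        finally have c2: "norm (c + 1) \<ge> d * (real k + 1)" .
        have dk: "d * (real k + 1) > 0" using d by simp
        have cpos: "norm c > 0" "norm (c + 1) > 0" using c1 c2 dk by linarith+
        have z: "z \<in> left_half" using y by (simp add: z_def field_simps)
        have nz: "norm z \<le> 1 / y" "norm (1 - z) = 1 / y"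
        proof -
          have "1 / y \<ge> 1" using y by simp
          hence "norm z = 1 / y - 1" unfolding z_def norm_of_real by simp
          thus "norm z \<le> 1 / y" by simp
          have "1 - z = of_real (1 / y)" by (simp add: z_def)
          thus "norm (1 - z) = 1 / y" using y by (simp only: norm_of_real) simp
        qed
        have "norm ((a + b + 1) / c * z) \<le> norm (a + b + 1) / (d * (real k + 1)) * (1 / y)"
          unfolding norm_mult norm_divide using y c1 d dk cpos nz
          by (intro mult_mono divide_left_mono mult_pos_pos) auto
        also have "\<dots> = M1 * (1 / s)" by (simp add: M1_def s_def)
        also have "\<dots> \<le> M1 * q" using M q by (intro mult_left_mono) auto
        finally have k1: "norm (1 - (a + b + 1) / c * z) \<le> (1 + M1) * q"
          using norm_triangle_ineq4[of 1 "(a + b + 1) / c * z"] q by (simp add: algebra_simps)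
        have "norm ((a + 1) * (b + 1) / (c * (c + 1)) * (z * (1 - z))) \<le>
            norm ((a + 1) * (b + 1)) / ((d * (real k + 1)) * (d * (real k + 1))) * (1 / y * (1 / y))"
          unfolding norm_mult[of _ "z * (1 - z)"] norm_divide norm_mult[of c] norm_mult[of z]
          using y c1 c2 d dk cpos nz
          by (intro mult_mono divide_left_mono mult_pos_pos) auto
        also have "\<dots> = M2 * (1 / s)\<^sup>2" by (simp add: M2_def s_def power2_eq_square)
        also have "\<dots> \<le> M2 * q\<^sup>2" using M q s by (intro mult_left_mono power_mono) auto
        finally have k2: "norm ((a + 1) * (b + 1) / (c * (c + 1)) * (z * (1 - z))) \<le> M2 * q\<^sup>2" .
        have e: "g + 1 + of_nat k = c + 1" "g + 2 + of_nat k = c + 2" by (simp_all add: c_def)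
        have P1: "norm (pfaff (a + 1) (b + 1) (c + 1) z) \<le> C1 * q powr (\<nu> - 1)"
          using C1(2)[OF y, of k] unfolding e by (simp add: z_def q_def s_def)
        have P2: "norm (pfaff (a + 2) (b + 2) (c + 2) z) \<le> C2 * q powr (\<nu> - 2)"
          using C2(2)[OF y, of k] unfolding e by (simp add: z_def q_def s_def)
        have "norm (pfaff a b c z) \<le> (1 + M1) * q * (C1 * q powr (\<nu> - 1)) + M2 * q\<^sup>2 * (C2 * q powr (\<nu> - 2))"
          unfolding pfaff_recurrence[OF c z] using M C1 C2 q
          by (intro norm_triangle_le add_mono)
             (unfold norm_mult[of _ "pfaff _ _ _ _"], (intro mult_mono k1 k2 P1 P2; force)+)
        also have "\<dots> = ((1 + M1) * C1 + M2 * C2) * q powr \<nu>"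
        proof -
          have "q powr (\<nu> - 1) = q powr \<nu> / q" "q powr (\<nu> - 2) = q powr \<nu> / q\<^sup>2"
            using q by (simp_all add: powr_diff powr_numeral)
          moreover have "q \<noteq> 0" using q by auto
          ultimately have "(1 + M1) * q * (C1 * q powr (\<nu> - 1)) = (1 + M1) * C1 * q powr \<nu>"
            "M2 * q\<^sup>2 * (C2 * q powr (\<nu> - 2)) = M2 * C2 * q powr \<nu>"
            by simp_all
          thus ?thesis by (simp only: distrib_right)
        qed
        finally show ?thesis by (simp add: c_def z_def q_def s_def)
      qed
      thus "bounded a b g \<nu>"
        using C1 C2 M unfolding bounded_def by (intro exI[of _ "(1 + M1) * C1 + M2 * C2"]) (auto intro!: add_pos_nonneg mult_pos_pos)
    qed
  qed
  obtain N :: nat where "\<nu> < real N" using reals_Archimedean2 by blast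
  hence "Re g > 0 \<and> - Re a < \<nu> \<and> - Re b < \<nu> \<and> \<nu> < real N" using assms by simp
  from main[of N, THEN spec, THEN spec, THEN spec, THEN spec, THEN mp, OF this]
  obtain C where "C > 0" "\<forall>k y. 0 < y \<and> y < 1 \<longrightarrow>
    norm (pfaff a b (g + of_nat k) (of_real (1 - 1 / y))) \<le> C * (1 + 1 / ((real k + 1) * y)) powr \<nu>"
    unfolding bounded_def by (elim exE conjE)
  thus ?thesis by (intro that[of C]) simp_all
qed


section \<open>The fractional integral of a power\<close>

text \<open>Expanding Gauss's function by Pfaff's series produces Beta integrals and a Gauss series at \<open>1\<close>.\<close>

lemma pfaff_moment:
  assumes c: "Re c > 0" and ra: "Re (r + a) > 0" and rb: "Re (r + b) > 0"
  defines "F \<equiv> (\<lambda>y. of_real (1 - y) powr (c - 1) * of_real y powr (r - 1) * pfaff a b c (of_real (1 - 1 / y)))"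
  shows "set_integrable lborel {0<..<1} F"
    and "(LINT y:{0<..<1}|lborel. F y) =
      Gamma c * Gamma (r + a) * Gamma (r + b) * rGamma (c + r) * rGamma (r + a + b)" (is "_ = ?V")
proof -
  define h where "h = hyp_coeff a (c - b) c"
  define f where "f l y = h l * (of_real y powr (r + a - 1) * of_real (1 - y) powr (c + of_nat l - 1))"
    for l and y :: real
  have cl: "Re (c + of_nat l) > 0" for l using c by simp
  have norm_f: "norm (f l y) = norm (h l) * (y powr (Re (r + a) - 1) * (1 - y) powr (Re c + real l - 1))"
    if "y \<in> {0<..<1}" for l y
    using that unfolding f_def norm_mult by (subst (1 2) norm_of_real_powr) auto
  have 1: "set_integrable lborel {0<..<1} (f l)" for l
    unfolding f_def by (intro set_integrable_mult_right set_integrable_beta_complex ra cl)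
  have intf: "(LINT y:{0<..<1}|lborel. f l y) =
      Gamma c * Gamma (r + a) * gauss_term a (c - b) (c + r + a) l" for l
  proof -
    have "(LINT y:{0<..<1}|lborel. f l y) =
        h l * (Gamma (r + a) * Gamma (c + of_nat l) * rGamma (r + a + (c + of_nat l)))"
      unfolding f_def using beta_integral_complex[OF ra cl[of l]] by simp
    thus ?thesis using pochhammer_nonzero_Re_pos[OF c, of l]
      by (simp add: Gamma_plus_of_nat[OF c] h_def hyp_coeff_def gauss_term_def algebra_simps)
  qed
  have F_sums: "(\<lambda>l. f l y) sums F y" and sumn: "summable (\<lambda>l. norm (f l y))" if y: "y \<in> {0<..<1}" for y
  proof -
    have y': "0 < y" "y < 1" "0 < 1 - y" using y by auto
    have n: "norm (complex_of_real (1 - y)) < 1" using y by (simp only: norm_of_real) auto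
    have f_eq: "f l y = of_real y powr (r + a - 1) * of_real (1 - y) powr (c - 1) * (h l * of_real (1 - y) ^ l)" for l
      unfolding f_def of_real_powr_plus_nat[OF y'(3)] by (simp only: mult_ac)
    show "summable (\<lambda>l. norm (f l y))"
      unfolding f_eq norm_mult[of "_ * _ powr _"] h_def by (intro summable_mult summable_hyp[OF c n])
    have "summable (\<lambda>l. h l * of_real (1 - y) ^ l)"
      unfolding h_def by (rule summable_norm_cancel[OF summable_hyp[OF c n]])
    hence "(\<lambda>l. f l y) sums (of_real y powr (r + a - 1) * of_real (1 - y) powr (c - 1) *
        (\<Sum>l. h l * of_real (1 - y) ^ l))"
      unfolding f_eq by (intro sums_mult summable_sums)
    also have "of_real y powr (r + a - 1) = of_real y powr (r - 1) * complex_of_real y powr a"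
      by (simp add: powr_add [symmetric] algebra_simps)
    also have "of_real y powr (r - 1) * of_real y powr a * of_real (1 - y) powr (c - 1) *
        (\<Sum>l. h l * of_real (1 - y) ^ l) = F y"
      unfolding F_def pfaff_at[OF c y'(1,2)] h_def of_real_power by (simp only: mult_ac)
    finally show "(\<lambda>l. f l y) sums F y" .
  qed
  have 3: "summable (\<lambda>l. LINT y:{0<..<1}|lborel. norm (f l y))"
  proof -
    obtain K1 where K1: "K1 > 0" "\<And>n. norm (h n) \<le> K1 * (real n + 1) powr (Re a + Re (c - b) - Re c - 1)"
      using hyp_coeff_bound[OF c] unfolding h_def by metis
    obtain K2 where K2: "K2 > 0" "\<And>k. Beta (Re c + real k) (Re (r + a)) \<le> K2 * (real k + 1) powr (- Re (r + a))"
      using Beta_growth[OF c ra] by metis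
    have eq: "(LINT y:{0<..<1}|lborel. norm (f l y)) = norm (h l) * Beta (Re c + real l) (Re (r + a))" for l
    proof -
      have "(LINT y:{0<..<1}|lborel. norm (f l y)) =
          (LINT y:{0<..<1}|lborel. norm (h l) * (y powr (Re (r + a) - 1) * (1 - y) powr (Re c + real l - 1)))"
        by (intro set_lebesgue_integral_cong) (use norm_f in auto)
      also have "\<dots> = norm (h l) * Beta (Re (r + a)) (Re c + real l)"
        using set_integrable_beta_real(2)[OF ra, of "Re c + real l"] c by simp
      finally show ?thesis by (simp add: Beta_commute)
    qed
    show ?thesis unfolding eq
    proof (rule summable_comparison_test'[OF summable_mult[OF summable_Suc_powr]])
      show "- Re b - Re r - 1 < -1" using rb by simp
      fix n
      have "Beta (Re c + real n) (Re (r + a)) \<ge> 0"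
        using c ra by (simp add: Beta_def Gamma_real_pos less_imp_le)
      hence "norm (norm (h n) * Beta (Re c + real n) (Re (r + a))) = norm (h n) * Beta (Re c + real n) (Re (r + a))"
        by simp
      also have "\<dots> \<le> (K1 * (real n + 1) powr (Re a + Re (c - b) - Re c - 1)) * (K2 * (real n + 1) powr (- Re (r + a)))"
        by (intro mult_mono K1 K2) (use K1 \<open>Beta (Re c + real n) (Re (r + a)) \<ge> 0\<close> in auto)
      also have "\<dots> = K1 * K2 * ((real n + 1) powr (Re a + Re (c - b) - Re c - 1) * (real n + 1) powr (- Re (r + a)))"
        by (simp only: mult_ac)
      also have "(real n + 1) powr (Re a + Re (c - b) - Re c - 1) * (real n + 1) powr (- Re (r + a)) =
          (real n + 1) powr (- Re b - Re r - 1)"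
        by (rule powr_Suc_mult) simp
      finally show "norm (norm (h n) * Beta (Re c + real n) (Re (r + a))) \<le> K1 * K2 * (real n + 1) powr (- Re b - Re r - 1)" .
    qed
  qed
  have I: "(\<lambda>l. LINT y:{0<..<1}|lborel. f l y) sums ?V"
  proof -
    have "Re ((c + r + a) - a - (c - b)) > 0" using rb by simp
    from gauss_sums[OF this] have "gauss_term a (c - b) (c + r + a) sums
        (Gamma (r + b) * rGamma (c + r) * rGamma (r + a + b))"
      by (simp add: algebra_simps)
    from sums_mult[OF this, of "Gamma c * Gamma (r + a)"] show ?thesis
      unfolding intf by (simp only: mult.assoc)
  qed
  note termwise = integrate_series_termwise[where f = f, OF 1 sumn 3 sums_unique[OF F_sums] I]
  show "set_integrable lborel {0<..<1} F" by (rule termwise(1))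
  show "(LINT y:{0<..<1}|lborel. F y) = ?V" by (rule termwise(2))
qed

lemma one_plus_inverse_powr_le:
  fixes s \<nu> :: real
  assumes "s > 0"
  shows "(1 + 1 / s) powr \<nu> \<le> 2 powr \<bar>\<nu>\<bar> * (s powr (- \<nu>) + s powr (- min \<nu> 0))"
proof (cases "\<nu> \<ge> 0")
  case True
  have "(1 + 1 / s) powr \<nu> \<le> (2 * max 1 (1 / s)) powr \<nu>"
    using True assms by (intro powr_mono2) auto
  also have "\<dots> = 2 powr \<nu> * max 1 (1 / s) powr \<nu>" by (subst powr_mult) auto
  also have "max 1 (1 / s) powr \<nu> \<le> 1 + (1 / s) powr \<nu>" by (simp add: max_def)
  also have "(1 / s) powr \<nu> = s powr (- \<nu>)" using assms by (simp add: powr_divide powr_minus inverse_eq_divide)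
  finally show ?thesis using True assms by (simp add: mult_left_mono add.commute)
next
  case False
  have "(1 + 1 / s) powr \<nu> \<le> (1 / s) powr \<nu>"
    using False assms by (intro powr_mono2') auto
  also have "(1 / s) powr \<nu> = s powr (- \<nu>)" using assms by (simp add: powr_divide powr_minus inverse_eq_divide)
  also have "\<dots> \<le> 2 powr \<bar>\<nu>\<bar> * (s powr (- \<nu>) + s powr (- min \<nu> 0))"
  proof -
    have "1 * s powr (- \<nu>) \<le> 2 powr \<bar>\<nu>\<bar> * (s powr (- \<nu>) + s powr (- min \<nu> 0))"
      by (intro mult_mono ge_one_powr_ge_zero) auto
    thus ?thesis by simp
  qed
  finally show ?thesis .
qed

text \<open>
  The uniform bound for Gauss's function is integrated against the weight: a factor \<open>((k + 1) y)\<^bsup>-\<epsilon>\<^esup>\<close>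
  with \<open>\<epsilon> < Re r\<close> turns the weight into a Beta kernel of the same total order \<open>(k + 1)\<^bsup>-Re r\<^esup>\<close>.
\<close>

lemma pfaff_moment_bound:
  assumes g: "Re g > 0" and ra: "Re (r + a) > 0" and rb: "Re (r + b) > 0"
  defines "F \<equiv> (\<lambda>k y. of_real (1 - y) powr (g + of_nat k - 1) * of_real y powr (r - 1) *
    pfaff a b (g + of_nat k) (of_real (1 - 1 / y)))"
  obtains K where "K > 0" "\<And>k. (LINT y:{0<..<1}|lborel. norm (F k y)) \<le> K * (real k + 1) powr (- Re r)"
proof -
  \<comment> \<open>above the threshold of \<open>pfaff_bound\<close>, and below \<open>Re r\<close>, so that \<open>y\<^bsup>r-1-\<nu>\<^esup>\<close> is still integrable at \<open>0\<close>\<close>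
  define \<nu> where "\<nu> = (max (- Re a) (- Re b) + Re r) / 2"
  have nu: "- Re a < \<nu>" "- Re b < \<nu>" "\<nu> < Re r" using ra rb by (auto simp: \<nu>_def)
  obtain C where C: "C > 0" "\<And>k y. 0 < y \<Longrightarrow> y < 1 \<Longrightarrow>
    norm (pfaff a b (g + of_nat k) (of_real (1 - 1 / y))) \<le> C * (1 + 1 / ((real k + 1) * y)) powr \<nu>"
    using pfaff_bound[OF g nu(1,2)] by metis
  define \<eta> where "\<eta> = min \<nu> 0"
  have eta: "\<eta> < Re r" using nu by (simp add: \<eta>_def)
  obtain K1 where K1: "K1 > 0" "\<And>k. Beta (Re g + real k) (Re r - \<nu>) \<le> K1 * (real k + 1) powr (- (Re r - \<nu>))"
    using Beta_growth[OF g, of "Re r - \<nu>"] nu by auto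
  obtain K2 where K2: "K2 > 0" "\<And>k. Beta (Re g + real k) (Re r - \<eta>) \<le> K2 * (real k + 1) powr (- (Re r - \<eta>))"
    using Beta_growth[OF g, of "Re r - \<eta>"] eta by auto
  define M where "M = C * 2 powr \<bar>\<nu>\<bar>"
  have M: "M > 0" using C by (simp add: M_def)
  define b1 where "b1 \<epsilon> k y = (real k + 1) powr (- \<epsilon>) * (y powr (Re r - \<epsilon> - 1) * (1 - y) powr (Re g + real k - 1))"
    for \<epsilon> k and y :: real
  have int_b1: "set_integrable lborel {0<..<1} (b1 \<epsilon> k)"
    "(LINT y:{0<..<1}|lborel. b1 \<epsilon> k y) = (real k + 1) powr (- \<epsilon>) * Beta (Re g + real k) (Re r - \<epsilon>)"
    if "\<epsilon> < Re r" for \<epsilon> k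
  proof -
    have p: "Re r - \<epsilon> > 0" "Re g + real k > 0" using that g by auto
    show "set_integrable lborel {0<..<1} (b1 \<epsilon> k)"
      unfolding b1_def by (intro set_integrable_mult_right set_integrable_beta_real p)
    show "(LINT y:{0<..<1}|lborel. b1 \<epsilon> k y) = (real k + 1) powr (- \<epsilon>) * Beta (Re g + real k) (Re r - \<epsilon>)"
      unfolding b1_def using set_integrable_beta_real(2)[OF p] by (simp add: Beta_commute)
  qed
  have le: "norm (F k y) \<le> M * (b1 \<nu> k y + b1 \<eta> k y)" if y: "y \<in> {0<..<1}" for k y
  proof -
    have y': "0 < y" "y < 1" "0 < 1 - y" using y by auto
    define s where "s = (real k + 1) * y"
    have s: "s > 0" using y by (simp add: s_def)
    have "norm (F k y) = (1 - y) powr (Re g + real k - 1) * y powr (Re r - 1) *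
        norm (pfaff a b (g + of_nat k) (of_real (1 - 1 / y)))"
      unfolding F_def norm_mult using y' by (subst (1 2) norm_of_real_powr) auto
    also have "\<dots> \<le> (1 - y) powr (Re g + real k - 1) * y powr (Re r - 1) *
        (C * (2 powr \<bar>\<nu>\<bar> * (s powr (- \<nu>) + s powr (- \<eta>))))"
    proof (intro mult_left_mono order_trans[OF C(2)[OF y'(1,2)]])
      show "(1 + 1 / ((real k + 1) * y)) powr \<nu> \<le> 2 powr \<bar>\<nu>\<bar> * (s powr (- \<nu>) + s powr (- \<eta>))"
        using one_plus_inverse_powr_le[OF s, of \<nu>] by (simp only: s_def \<eta>_def)
    qed (use C in auto)
    also have "\<dots> = M * (b1 \<nu> k y + b1 \<eta> k y)"
    proof -
      have "y powr (Re r - 1) * s powr (- \<epsilon>) = (real k + 1) powr (- \<epsilon>) * y powr (Re r - \<epsilon> - 1)" for \<epsilon>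
      proof -
        have "s powr (- \<epsilon>) = (real k + 1) powr (- \<epsilon>) * y powr (- \<epsilon>)"
          unfolding s_def by (subst powr_mult) (use y' in auto)
        moreover have "y powr (Re r - 1) * y powr (- \<epsilon>) = y powr (Re r - \<epsilon> - 1)"
          unfolding powr_add [symmetric] by (rule arg_cong[where f = "\<lambda>e. y powr e"]) simp
        ultimately show ?thesis by (simp add: mult_ac)
      qed
      hence "b1 \<epsilon> k y = (1 - y) powr (Re g + real k - 1) * (y powr (Re r - 1) * s powr (- \<epsilon>))" for \<epsilon>
        by (simp add: b1_def mult_ac)
      thus ?thesis by (simp add: M_def algebra_simps)
    qed
    finally show ?thesis .
  qed
  have "(LINT y:{0<..<1}|lborel. norm (F k y)) \<le> (M * (K1 + K2)) * (real k + 1) powr (- Re r)" for k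
  proof -
    have gk: "Re (g + of_nat k) > 0" using g by simp
    have "(LINT y:{0<..<1}|lborel. norm (F k y)) \<le> (LINT y:{0<..<1}|lborel. M * (b1 \<nu> k y + b1 \<eta> k y))"
      using pfaff_moment(1)[OF gk ra rb] le int_b1(1)[OF nu(3)] int_b1(1)[OF eta] unfolding F_def
      by (intro set_integral_mono set_integrable_norm set_integrable_mult_right set_integral_add) auto
    also have "\<dots> = M * ((real k + 1) powr (- \<nu>) * Beta (Re g + real k) (Re r - \<nu>) +
        (real k + 1) powr (- \<eta>) * Beta (Re g + real k) (Re r - \<eta>))"
      using int_b1[OF nu(3)] int_b1[OF eta] by (simp add: set_integral_add)
    also have "\<dots> \<le> M * ((real k + 1) powr (- \<nu>) * (K1 * (real k + 1) powr (- (Re r - \<nu>))) +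
        (real k + 1) powr (- \<eta>) * (K2 * (real k + 1) powr (- (Re r - \<eta>))))"
      using M by (intro mult_left_mono add_mono K1 K2) auto
    also have "\<dots> = (M * (K1 + K2)) * (real k + 1) powr (- Re r)"
    proof -
      have "(real k + 1) powr (- \<epsilon>) * (real k + 1) powr (- (Re r - \<epsilon>)) = (real k + 1) powr (- Re r)" for \<epsilon>
        by (rule powr_Suc_mult) simp
      hence "(real k + 1) powr (- \<epsilon>) * (Q * (real k + 1) powr (- (Re r - \<epsilon>))) = Q * (real k + 1) powr (- Re r)" for \<epsilon> Q
        by (metis mult.left_commute)
      thus ?thesis by (simp only: distrib_left distrib_right mult.assoc)
    qed
    finally show ?thesis .
  qed
  thus ?thesis using that[of "M * (K1 + K2)"] M K1 K2 by simp
qed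

text \<open>
  The integral of a power over \<open>(0, 1)\<close>: integrating the series of \<open>F\<^sub>3\<close> termwise leaves a second
  Gauss series at \<open>1\<close>, in the summation index of the outer series.
\<close>

lemma F3_moment:
  assumes g: "Re \<gamma> > 0" and ra: "Re (r + \<alpha>') > 0" and rb: "Re (r + \<beta>') > 0"
    and rc: "Re (\<gamma> + r - \<alpha> - \<beta>) > 0"
  defines "F \<equiv> (\<lambda>y. of_real (1 - y) powr (\<gamma> - 1) * of_real y powr (r - 1) *
    appell_F3 \<alpha> \<alpha>' \<beta> \<beta>' \<gamma> (of_real (1 - y)) (of_real (1 - 1 / y)))"
  shows "set_integrable lborel {0<..<1} F"
    and "(LINT y:{0<..<1}|lborel. F y) =
      Gamma \<gamma> * Gamma (r + \<alpha>') * Gamma (r + \<beta>') * rGamma (r + \<alpha>' + \<beta>') *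
      (Gamma (\<gamma> + r - \<alpha> - \<beta>) * rGamma (\<gamma> + r - \<alpha>) * rGamma (\<gamma> + r - \<beta>))" (is "_ = ?V")
proof -
  define A where "A = hyp_coeff \<alpha> \<beta> \<gamma>"
  define H where "H k y = of_real (1 - y) powr (\<gamma> + of_nat k - 1) * of_real y powr (r - 1) *
    pfaff \<alpha>' \<beta>' (\<gamma> + of_nat k) (of_real (1 - 1 / y))" for k and y :: real
  define f where "f k y = A k * H k y" for k y
  have gk: "Re (\<gamma> + of_nat k) > 0" for k using g by simp
  have 1: "set_integrable lborel {0<..<1} (f k)" for k
    unfolding f_def H_def by (intro set_integrable_mult_right pfaff_moment(1) gk ra rb)
  have intf: "(LINT y:{0<..<1}|lborel. f k y) =
      Gamma \<gamma> * Gamma (r + \<alpha>') * Gamma (r + \<beta>') * rGamma (r + \<alpha>' + \<beta>') * gauss_term \<alpha> \<beta> (\<gamma> + r) k" for k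
  proof -
    have "(LINT y:{0<..<1}|lborel. f k y) = A k *
        (Gamma (\<gamma> + of_nat k) * Gamma (r + \<alpha>') * Gamma (r + \<beta>') * rGamma (\<gamma> + of_nat k + r) * rGamma (r + \<alpha>' + \<beta>'))"
      unfolding f_def H_def using pfaff_moment(2)[OF gk ra rb] by simp
    moreover have "A k * Gamma (\<gamma> + of_nat k) = Gamma \<gamma> * (pochhammer \<alpha> k * pochhammer \<beta> k / fact k)"
      using pochhammer_nonzero_Re_pos[OF g, of k] by (simp add: A_def hyp_coeff_def Gamma_plus_of_nat[OF g])
    moreover have "\<gamma> + of_nat k + r = \<gamma> + r + of_nat k" by simp
    ultimately show ?thesis unfolding gauss_term_def by (metis mult.assoc mult.commute)
  qed
  obtain K1 where K1: "K1 > 0" "\<And>k. norm (A k) \<le> K1 * (real k + 1) powr (Re \<alpha> + Re \<beta> - Re \<gamma> - 1)"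
    using hyp_coeff_bound[OF g] unfolding A_def by metis
  have sumn: "summable (\<lambda>k. norm (f k y))" if y: "y \<in> {0<..<1}" for y
  proof -
    have y': "0 < y" "y < 1" "0 < 1 - y" using y by auto
    \<comment> \<open>With \<open>\<nu> \<ge> 0\<close> the bound decreases in \<open>k\<close>, so at fixed \<open>y\<close> it is a constant.\<close>
    define \<nu> where "\<nu> = max 0 (max (- Re \<alpha>') (- Re \<beta>')) + 1"
    have nu: "- Re \<alpha>' < \<nu>" "- Re \<beta>' < \<nu>" "\<nu> \<ge> 0" by (auto simp: \<nu>_def)
    obtain C where C: "C > 0" "\<And>k y. 0 < y \<Longrightarrow> y < 1 \<Longrightarrow>
      norm (pfaff \<alpha>' \<beta>' (\<gamma> + of_nat k) (of_real (1 - 1 / y))) \<le> C * (1 + 1 / ((real k + 1) * y)) powr \<nu>"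
      using pfaff_bound[OF g nu(1,2)] by metis
    define D where "D = K1 * ((1 - y) powr (Re \<gamma> - 1) * y powr (Re r - 1)) * (C * (1 + 1 / y) powr \<nu>)"
    show ?thesis
    proof (rule summable_comparison_test')
      show "summable (\<lambda>k. D * ((real k + 1) powr (Re \<alpha> + Re \<beta> - Re \<gamma> - 1) * (1 - y) ^ k))"
        using y' by (intro summable_mult summable_powr_times_power) auto
      fix k
      have "norm (pfaff \<alpha>' \<beta>' (\<gamma> + of_nat k) (of_real (1 - 1 / y))) \<le> C * (1 + 1 / y) powr \<nu>"
      proof (intro order_trans[OF C(2)[OF y'(1,2)]] mult_left_mono powr_mono2 nu add_left_mono)
        show "1 / ((real k + 1) * y) \<le> 1 / y"
          using y' by (intro divide_left_mono mult_pos_pos) (auto simp: algebra_simps)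
      qed (use y' C in auto)
      moreover have "norm (of_real (1 - y) powr (\<gamma> + of_nat k - 1) * of_real y powr (r - 1) :: complex) =
          ((1 - y) powr (Re \<gamma> - 1) * y powr (Re r - 1)) * (1 - y) ^ k"
        unfolding of_real_powr_plus_nat[OF y'(3)] norm_mult norm_of_real_powr[OF y'(1)] norm_of_real_powr[OF y'(3)]
          norm_power norm_of_real using y' by simp
      ultimately have "norm (f k y) \<le> (K1 * (real k + 1) powr (Re \<alpha> + Re \<beta> - Re \<gamma> - 1)) *
          ((((1 - y) powr (Re \<gamma> - 1) * y powr (Re r - 1)) * (1 - y) ^ k) * (C * (1 + 1 / y) powr \<nu>))"
        unfolding f_def H_def norm_mult[of "A k"] norm_mult[of "_ * _"]
        using K1 y' by (intro mult_mono K1 mult_nonneg_nonneg) auto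
      also have "\<dots> = D * ((real k + 1) powr (Re \<alpha> + Re \<beta> - Re \<gamma> - 1) * (1 - y) ^ k)"
        unfolding D_def by (simp only: mult_ac)
      finally show "norm (norm (f k y)) \<le> D * ((real k + 1) powr (Re \<alpha> + Re \<beta> - Re \<gamma> - 1) * (1 - y) ^ k)"
        by simp
    qed
  qed
  have 3: "summable (\<lambda>k. LINT y:{0<..<1}|lborel. norm (f k y))"
  proof -
    obtain K2 where "K2 > 0" and "\<And>k. (LINT y:{0<..<1}|lborel. norm (of_real (1 - y) powr (\<gamma> + of_nat k - 1) *
        of_real y powr (r - 1) * pfaff \<alpha>' \<beta>' (\<gamma> + of_nat k) (of_real (1 - 1 / y)))) \<le> K2 * (real k + 1) powr (- Re r)"
      by (rule pfaff_moment_bound[OF g ra rb]) blast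
    hence K2: "K2 > 0" "\<And>k. (LINT y:{0<..<1}|lborel. norm (H k y)) \<le> K2 * (real k + 1) powr (- Re r)"
      by (simp_all only: H_def)
    have nonneg: "(LINT y:{0<..<1}|lborel. norm (H k y)) \<ge> 0" for k
      unfolding set_lebesgue_integral_def by (intro integral_nonneg_AE) auto
    have eq: "(LINT y:{0<..<1}|lborel. norm (f k y)) = norm (A k) * (LINT y:{0<..<1}|lborel. norm (H k y))" for k
      by (simp add: f_def norm_mult)
    show ?thesis unfolding eq
    proof (rule summable_comparison_test'[OF summable_mult[OF summable_Suc_powr]])
      show "Re \<alpha> + Re \<beta> - Re \<gamma> - Re r - 1 < -1" using rc by simp
      fix k
      have "norm (norm (A k) * (LINT y:{0<..<1}|lborel. norm (H k y))) = norm (A k) * (LINT y:{0<..<1}|lborel. norm (H k y))"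
        using nonneg by simp
      also have "\<dots> \<le> (K1 * (real k + 1) powr (Re \<alpha> + Re \<beta> - Re \<gamma> - 1)) * (K2 * (real k + 1) powr (- Re r))"
        by (intro mult_mono K1 K2) (use K1 nonneg in auto)
      also have "\<dots> = K1 * K2 * ((real k + 1) powr (Re \<alpha> + Re \<beta> - Re \<gamma> - 1) * (real k + 1) powr (- Re r))"
        by (simp only: mult_ac)
      also have "(real k + 1) powr (Re \<alpha> + Re \<beta> - Re \<gamma> - 1) * (real k + 1) powr (- Re r) =
          (real k + 1) powr (Re \<alpha> + Re \<beta> - Re \<gamma> - Re r - 1)"
        by (rule powr_Suc_mult) simp
      finally show "norm (norm (A k) * (LINT y:{0<..<1}|lborel. norm (H k y))) \<le>
          K1 * K2 * (real k + 1) powr (Re \<alpha> + Re \<beta> - Re \<gamma> - Re r - 1)" .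
    qed
  qed
  have F_eq: "F y = (\<Sum>k. f k y)" if y: "y \<in> {0<..<1}" for y
  proof -
    have y': "0 < y" "y < 1" "0 < 1 - y" using y by auto
    define T where "T k = A k * of_real (1 - y) ^ k * pfaff \<alpha>' \<beta>' (\<gamma> + of_nat k) (of_real (1 - 1 / y))" for k
    define P where "P = complex_of_real (1 - y) powr (\<gamma> - 1) * of_real y powr (r - 1)"
    have P: "P \<noteq> 0" using y' by (simp add: P_def)
    have lh: "complex_of_real (1 - 1 / y) \<in> left_half" using y' by (simp add: field_simps)
    have "complex_of_real (1 - y) \<in> of_real ` {0..<1}" "complex_of_real (1 - 1 / y) \<in> of_real ` {..0}"
      using y' by (intro imageI; simp add: field_simps)+
    hence "appell_F3 \<alpha> \<alpha>' \<beta> \<beta>' \<gamma> (of_real (1 - y)) (of_real (1 - 1 / y)) = (\<Sum>k. T k)"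
      unfolding appell_F3_def hyp2F1_eq_pfaff[OF gk lh] T_def A_def hyp_coeff_def by (simp add: mult_ac)
    hence Fy: "F y = P * (\<Sum>k. T k)" by (simp only: F_def P_def)
    have f_eq: "f k y = P * T k" for k
      unfolding f_def H_def P_def T_def of_real_powr_plus_nat[OF y'(3)] by (simp only: mult_ac)
    have "summable (\<lambda>k. f k y)" using sumn[OF y] by (rule summable_norm_cancel)
    hence "summable T" unfolding f_eq using P summable_cmult_iff[of P T] by simp
    thus ?thesis unfolding Fy f_eq by (rule suminf_mult [symmetric])
  qed
  have I: "(\<lambda>k. LINT y:{0<..<1}|lborel. f k y) sums ?V"
    unfolding intf by (intro sums_mult gauss_sums rc)
  note termwise = integrate_series_termwise[where f = f, OF 1 sumn 3 F_eq I]
  show "set_integrable lborel {0<..<1} F" by (rule termwise(1))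
  show "(LINT y:{0<..<1}|lborel. F y) = ?V"
    by (rule termwise(2))
qed

lemma set_lborel_scale:
  fixes f :: "real \<Rightarrow> complex"
  assumes "x > 0"
  shows "set_integrable lborel {0<..<x} f \<longleftrightarrow> set_integrable lborel {0<..<1} (\<lambda>y. f (x * y))"
    and "(LINT t:{0<..<x}|lborel. f t) = of_real x * (LINT y:{0<..<1}|lborel. f (x * y))"
proof -
  have eq: "(\<lambda>y. indicator {0<..<x} (0 + x * y) *\<^sub>R f (0 + x * y)) = (\<lambda>y. indicator {0<..<1} y *\<^sub>R f (x * y))"
    using assms by (auto simp: fun_eq_iff indicator_def zero_less_mult_iff)
  show "set_integrable lborel {0<..<x} f \<longleftrightarrow> set_integrable lborel {0<..<1} (\<lambda>y. f (x * y))"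
    unfolding set_integrable_def eq [symmetric] using assms
    by (intro lborel_integrable_real_affine_iff [symmetric]) auto
  show "(LINT t:{0<..<x}|lborel. f t) = of_real x * (LINT y:{0<..<1}|lborel. f (x * y))"
    unfolding set_lebesgue_integral_def eq [symmetric] using assms
    by (subst lborel_integral_real_affine[where c = x and t = 0]) (auto simp: scaleR_conv_of_real)
qed

text \<open>
  The substitution \<open>t = x y\<close> makes the arguments of \<open>F\<^sub>3\<close> independent of \<open>x\<close>. The remaining integral is
  that of \<open>F3_moment\<close> with \<open>r = \<rho> - \<alpha>'\<close>, because of the factor \<open>t\<^bsup>-\<alpha>'\<^esup>\<close> in the integrand.
\<close>

theorem msm_power:
  assumes x: "x > 0" and g: "Re \<gamma> > 0" and 1: "Re \<rho> > 0" and 2: "Re (\<rho> + \<beta>' - \<alpha>') > 0"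
    and 3: "Re (\<rho> + \<gamma> - \<alpha> - \<alpha>' - \<beta>) > 0"
  shows "set_integrable lborel {0<..<x} (msm_integrand \<alpha> \<alpha>' \<beta> \<beta>' \<gamma> (\<lambda>t. of_real t powr (\<rho> - 1)) x)"
    and "(LINT t:{0<..<x}|lborel. msm_integrand \<alpha> \<alpha>' \<beta> \<beta>' \<gamma> (\<lambda>t. of_real t powr (\<rho> - 1)) x t) =
      of_real x powr (\<gamma> + \<rho> - \<alpha>' - 1) * (Gamma \<gamma> *
      (Gamma \<rho> * Gamma (\<rho> + \<beta>' - \<alpha>') * Gamma (\<rho> + \<gamma> - \<alpha> - \<alpha>' - \<beta>) *
       rGamma (\<rho> + \<beta>') * rGamma (\<rho> + \<gamma> - \<alpha> - \<alpha>') * rGamma (\<rho> + \<gamma> - \<alpha>' - \<beta>)))" (is "_ = ?V")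
proof -
  define r where "r = \<rho> - \<alpha>'"
  define F where "F = (\<lambda>y. of_real (1 - y) powr (\<gamma> - 1) * of_real y powr (r - 1) *
    appell_F3 \<alpha> \<alpha>' \<beta> \<beta>' \<gamma> (of_real (1 - y)) (of_real (1 - 1 / y)))"
  have r: "Re (r + \<alpha>') > 0" "Re (r + \<beta>') > 0" "Re (\<gamma> + r - \<alpha> - \<beta>) > 0"
    using 1 2 3 by (auto simp: r_def)
  note F = F3_moment[OF g r, folded F_def]
  define G where "G = msm_integrand \<alpha> \<alpha>' \<beta> \<beta>' \<gamma> (\<lambda>t. of_real t powr (\<rho> - 1)) x"
  define Q where "Q = complex_of_real x powr (\<gamma> + \<rho> - \<alpha>' - 2)"
  have G: "G (x * y) = Q * F y" if y: "y \<in> {0<..<1}" for y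
  proof -
    have mult: "complex_of_real (x * t) powr w = of_real x powr w * of_real t powr w" if "t > 0" for t w
      using x that by (simp add: powr_times_real)
    have e: "x - x * y = x * (1 - y)" "x * y / x = y" "x / (x * y) = 1 / y"
      using x by (auto simp: algebra_simps)
    have Q: "of_real x powr (\<gamma> - 1) * of_real x powr (- \<alpha>') * of_real x powr (\<rho> - 1) = Q"
      unfolding Q_def powr_add [symmetric] by (rule arg_cong[where f = "\<lambda>z. of_real x powr z"]) simp
    have R: "complex_of_real y powr (- \<alpha>') * of_real y powr (\<rho> - 1) = of_real y powr (r - 1)"
      unfolding r_def powr_add [symmetric] by (rule arg_cong[where f = "\<lambda>z. of_real y powr z"]) simp
    have "G (x * y) = (of_real x powr (\<gamma> - 1) * of_real x powr (- \<alpha>') * of_real x powr (\<rho> - 1)) *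
        (of_real (1 - y) powr (\<gamma> - 1) * (of_real y powr (- \<alpha>') * of_real y powr (\<rho> - 1)) *
          appell_F3 \<alpha> \<alpha>' \<beta> \<beta>' \<gamma> (of_real (1 - y)) (of_real (1 - 1 / y)))"
      unfolding G_def msm_integrand_def e using y by (subst (1 2 3) mult) (auto simp: mult_ac)
    thus ?thesis unfolding Q R F_def .
  qed
  have "set_integrable lborel {0<..<1} (\<lambda>y. G (x * y)) \<longleftrightarrow> set_integrable lborel {0<..<1} (\<lambda>y. Q * F y)"
    by (intro set_integrable_cong) (use G in auto)
  thus "set_integrable lborel {0<..<x} G"
    unfolding set_lborel_scale(1)[OF x] using F(1) by (simp add: set_integrable_mult_right)
  have "(LINT t:{0<..<x}|lborel. G t) = of_real x * (LINT y:{0<..<1}|lborel. Q * F y)"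
    unfolding set_lborel_scale(2)[OF x] by (intro arg_cong2[of _ _ _ _ "(*)"] refl set_lebesgue_integral_cong) (use G in auto)
  also have "\<dots> = (of_real x * Q) * (LINT y:{0<..<1}|lborel. F y)" by simp
  also have "of_real x * Q = of_real x powr (\<gamma> + \<rho> - \<alpha>' - 1)"
  proof -
    have "of_real x powr (1 + (\<gamma> + \<rho> - \<alpha>' - 2)) = of_real x * Q"
      using x unfolding Q_def by (subst powr_add) (simp add: powr_to_1)
    moreover have "1 + (\<gamma> + \<rho> - \<alpha>' - 2) = \<gamma> + \<rho> - \<alpha>' - 1" by simp
    ultimately show ?thesis by metis
  qed
  finally show "(LINT t:{0<..<x}|lborel. G t) = ?V"
    unfolding F(2) by (simp add: r_def algebra_simps)
qed


section \<open>The Gamma function on vertical lines\<close>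

text \<open>Termwise, \<open>\<bar>z + k\<bar>\<^sup>2 \<ge> k\<^sup>2 + 1 \<ge> (k + 1)\<^sup>2 / 2\<close> in the series of the trigamma function.\<close>

lemma norm_Polygamma_1_le:
  assumes "x \<ge> 0" "\<bar>y\<bar> \<ge> 1"
  shows "norm (Polygamma 1 (Complex x y)) \<le> pi\<^sup>2 / 3"
proof -
  define z where "z = Complex x y"
  have z: "z \<noteq> 0" using assms by (auto simp: z_def complex_eq_iff)
  have s: "(\<lambda>k. inverse ((z + of_nat k) ^ Suc 1)) sums ((-1) ^ Suc 1 * Polygamma 1 z / fact 1)"
    by (rule Polygamma_LIMSEQ) (use z in auto)
  have le: "norm (inverse ((z + of_nat k) ^ Suc 1)) \<le> 2 * (1 / (real k + 1)\<^sup>2)" for k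
  proof -
    have "(real k + 1)\<^sup>2 / 2 \<le> (real k)\<^sup>2 + 1"
      using sum_squares_bound[of "real k" 1] by (simp add: power2_eq_square algebra_simps)
    also have "\<dots> \<le> (x + real k)\<^sup>2 + y\<^sup>2"
      using assms by (intro add_mono power_mono) (auto simp: abs_le_square_iff [of 1, simplified])
    also have "\<dots> = (norm (z + of_nat k))\<^sup>2"
      by (simp add: z_def cmod_power2)
    also have "\<dots> = norm ((z + of_nat k) ^ Suc 1)"
      by (simp only: norm_power Suc_1)
    finally have "inverse (norm ((z + of_nat k) ^ Suc 1)) \<le> inverse ((real k + 1)\<^sup>2 / 2)"
      by (intro le_imp_inverse_le) auto
    thus ?thesis unfolding norm_inverse by (simp add: inverse_eq_divide del: power_Suc)
  qed
  have q: "(\<lambda>k. 2 * (1 / (real k + 1)\<^sup>2)) sums (2 * (pi\<^sup>2 / 6))"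
    using inverse_squares_sums by (intro sums_mult) (simp add: add_ac)
  have "norm (\<Sum>k. inverse ((z + of_nat k) ^ Suc 1)) \<le> (\<Sum>k. 2 * (1 / (real k + 1)\<^sup>2))"
    by (rule norm_suminf_le[OF le sums_summable[OF q]])
  thus ?thesis using s q by (simp add: sums_iff z_def)
qed

text \<open>
  On a horizontal segment \<open>0 \<le> x \<le> 1\<close> the function \<open>log \<bar>\<Gamma>(x + i y)\<bar>\<close> has a second derivative that is
  bounded uniformly in \<open>\<bar>y\<bar> \<ge> 1\<close>, so that up to a bounded error it is the linear interpolation of its
  values at the end points, which differ by \<open>log \<bar>y\<bar>\<close>.
\<close>

lemma ln_norm_Gamma_interpolation:
  assumes y: "\<bar>y\<bar> \<ge> 1" and x: "0 \<le> x" "x \<le> 1"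
  shows "\<bar>ln (norm (Gamma (Complex x y))) - (ln (norm (Gamma (Complex 0 y))) + x * ln \<bar>y\<bar>)\<bar> \<le> pi\<^sup>2 / 3"
proof -
  define M where "M = pi\<^sup>2 / 3"
  define g where "g x = Re (ln_Gamma (Complex x y))" for x
  define g1 where "g1 x = Re (Digamma (Complex x y))" for x
  define g2 where "g2 x = Re (Polygamma 1 (Complex x y))" for x
  have C: "Complex t y = of_real t + \<i> * of_real y" for t by (simp add: complex_eq_iff)
  have nonneg: "Complex t y \<notin> \<real>\<^sub>\<le>\<^sub>0" "Complex t y \<notin> \<int>\<^sub>\<le>\<^sub>0" for t
    using y by (auto simp: complex_nonpos_Reals_iff elim!: nonpos_Ints_cases simp: complex_eq_iff)
  have deriv: "((\<lambda>t. Re (f (Complex t y))) has_real_derivative Re D) (at t)"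
    if "(f has_field_derivative D) (at (Complex t y))" for f D t
  proof -
    have "((\<lambda>w. f (w + \<i> * of_real y)) has_field_derivative D) (at (of_real t))"
      using that unfolding C by (simp add: DERIV_shift)
    hence "((\<lambda>t. f (of_real t + \<i> * of_real y)) has_vector_derivative D) (at t)"
      by (rule has_vector_derivative_real_field)
    hence "((\<lambda>t. Re (f (of_real t + \<i> * of_real y))) has_vector_derivative Re D) (at t)"
      by (rule bounded_linear.has_vector_derivative[OF bounded_linear_Re])
    thus ?thesis unfolding C by (simp add: has_real_derivative_iff_has_vector_derivative)
  qed
  have d1: "(g has_real_derivative g1 t) (at t)" for t
    unfolding g_def g1_def by (intro deriv has_field_derivative_ln_Gamma_complex nonneg)
  have d2: "(g1 has_real_derivative g2 t) (at t)" for t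
    unfolding g1_def g2_def using has_field_derivative_Polygamma[OF nonneg(2), of 0 t]
    by (intro deriv) simp
  have g2: "\<bar>g2 t\<bar> \<le> M" if "t \<in> {0..1}" for t
    using norm_Polygamma_1_le[of t y] that y abs_Re_le_cmod[of "Polygamma 1 (Complex t y)"]
    by (simp add: g2_def M_def)
  have g_eq: "g t = ln (norm (Gamma (Complex t y)))" for t
    by (simp add: g_def Gamma_complex_altdef nonneg)
  \<comment> \<open>Adding and subtracting the parabola \<open>M t\<^sup>2 / 2\<close> makes \<open>g\<close> convex and concave, respectively.\<close>
  have cvx1: "convex_on {0..1} (\<lambda>t. g t + M / 2 * t\<^sup>2)"
  proof (rule f''_ge0_imp_convex)
    fix t :: real assume "t \<in> {0..1}"
    show "((\<lambda>t. g t + M / 2 * t\<^sup>2) has_real_derivative g1 t + M * t) (at t)"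
      by (rule derivative_eq_intros d1 refl | simp)+
    show "((\<lambda>t. g1 t + M * t) has_real_derivative g2 t + M) (at t)"
      by (rule derivative_eq_intros d2 refl | simp)+
    show "0 \<le> g2 t + M" using g2[OF \<open>t \<in> {0..1}\<close>] by linarith
  qed simp
  have cvx2: "convex_on {0..1} (\<lambda>t. M / 2 * t\<^sup>2 - g t)"
  proof (rule f''_ge0_imp_convex)
    fix t :: real assume "t \<in> {0..1}"
    show "((\<lambda>t. M / 2 * t\<^sup>2 - g t) has_real_derivative M * t - g1 t) (at t)"
      by (rule derivative_eq_intros d1 refl | simp)+
    show "((\<lambda>t. M * t - g1 t) has_real_derivative M - g2 t) (at t)"
      by (rule derivative_eq_intros d2 refl | simp)+
    show "0 \<le> M - g2 t" using g2[OF \<open>t \<in> {0..1}\<close>] by linarith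
  qed simp
  have M0: "M \<ge> 0" by (simp add: M_def)
  have Mx: "0 \<le> M / 2 * x - M / 2 * x\<^sup>2" "M / 2 * x - M / 2 * x\<^sup>2 \<le> M"
  proof -
    have "x\<^sup>2 \<le> x" "0 \<le> x\<^sup>2" using x by (auto simp: power2_eq_square mult_left_le_one_le)
    hence "M / 2 * x\<^sup>2 \<le> M / 2 * x" "0 \<le> M / 2 * x\<^sup>2" "M / 2 * x \<le> M / 2 * 1"
      using M0 x by (intro mult_left_mono mult_nonneg_nonneg; simp)+
    thus "0 \<le> M / 2 * x - M / 2 * x\<^sup>2" "M / 2 * x - M / 2 * x\<^sup>2 \<le> M" using M0 by linarith+
  qed
  have "g x + M / 2 * x\<^sup>2 \<le> (1 - x) * g 0 + x * (g 1 + M / 2)"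
    using convex_onD[OF cvx1, of x 0 1] x by simp
  hence 1: "g x - ((1 - x) * g 0 + x * g 1) \<le> M" using Mx by (simp add: algebra_simps)
  have "M / 2 * x\<^sup>2 - g x \<le> (1 - x) * (- g 0) + x * (M / 2 - g 1)"
    using convex_onD[OF cvx2, of x 0 1] x by simp
  hence 2: "- M \<le> g x - ((1 - x) * g 0 + x * g 1)" using Mx by (simp add: algebra_simps)
  have nz: "Gamma (Complex 0 y) \<noteq> 0" using nonneg(2)[of 0] by (simp add: Gamma_eq_zero_iff)
  have "Gamma (Complex 1 y) = Complex 0 y * Gamma (Complex 0 y)"
    using Gamma_plus1[of "Complex 0 y"] nonneg(2)[of 0] by (simp add: C add_ac)
  hence "norm (Gamma (Complex 1 y)) = \<bar>y\<bar> * norm (Gamma (Complex 0 y))"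
  proof -
    have "norm (Complex 0 y) = \<bar>y\<bar>" by (simp add: cmod_def)
    thus ?thesis using \<open>Gamma (Complex 1 y) = _\<close> by (simp only: norm_mult)
  qed
  hence "g 1 = g 0 + ln \<bar>y\<bar>"
    using nz y unfolding g_eq by (simp add: ln_mult)
  hence "(1 - x) * g 0 + x * g 1 = g 0 + x * ln \<bar>y\<bar>" by (simp add: algebra_simps)
  hence "\<bar>g x - (g 0 + x * ln \<bar>y\<bar>)\<bar> \<le> M" using 1 2 by linarith
  thus ?thesis unfolding g_eq M_def .
qed

text \<open>The reflection formula at \<open>z = i y\<close>, where \<open>\<Gamma>(-z)\<close> is the complex conjugate of \<open>\<Gamma>(z)\<close>.\<close>

lemma norm_Gamma_imaginary_axis:
  assumes "\<bar>y\<bar> \<ge> 1"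
  shows "(norm (Gamma (Complex 0 y)))\<^sup>2 = 2 * pi / (\<bar>y\<bar> * (exp (pi * \<bar>y\<bar>) - exp (- (pi * \<bar>y\<bar>))))"
proof -
  define z where "z = Complex 0 y"
  have z: "z = \<i> * of_real y" "cnj z = - z" by (simp_all add: z_def complex_eq_iff)
  have "norm (Gamma z * Gamma (- z)) = norm (Gamma z) * norm (cnj (Gamma z))"
    by (simp add: norm_mult cnj_Gamma z(2))
  hence "(norm (Gamma z))\<^sup>2 = norm (Gamma z * Gamma (- z))" by (simp add: power2_eq_square)
  also have "\<dots> = pi / (\<bar>y\<bar> * norm (sin (\<i> * of_real (pi * y))))"
    unfolding Gamma_reflection_complex' by (simp add: norm_divide norm_mult z(1) mult_ac)
  also have "norm (sin (\<i> * of_real (pi * y))) = \<bar>exp (pi * y) - exp (- (pi * y))\<bar> / 2"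
  proof -
    have "sin (\<i> * of_real (pi * y)) = \<i> * of_real ((exp (pi * y) - exp (- (pi * y))) / 2)"
      unfolding sin_i_times by (simp add: exp_minus exp_of_real [symmetric])
    thus ?thesis by (simp only: norm_mult norm_ii norm_of_real) simp
  qed
  also have "\<bar>exp (pi * y) - exp (- (pi * y))\<bar> = exp (pi * \<bar>y\<bar>) - exp (- (pi * \<bar>y\<bar>))"
  proof (cases "y \<ge> 0")
    case True
    hence "exp (- (pi * y)) \<le> exp (pi * y)" by simp
    thus ?thesis using True by simp
  next
    case False
    hence "exp (pi * y) \<le> exp (- (pi * y))" by (simp add: mult_le_0_iff)
    thus ?thesis using False by simp
  qed
  finally show ?thesis by (simp add: z_def)
qed

definition vertical_rate :: "real \<Rightarrow> real \<Rightarrow> real \<Rightarrow> real" where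
  "vertical_rate e d \<tau> = \<bar>\<tau>\<bar> powr e * exp (- d * \<bar>\<tau>\<bar>)"

lemma eventually_at_infinity_abs: "eventually (\<lambda>\<tau> :: real. \<bar>\<tau>\<bar> \<ge> c) at_infinity"
  by (auto simp: eventually_at_infinity)

lemma vertical_rate_mult: "vertical_rate e d \<tau> * vertical_rate e' d' \<tau> = vertical_rate (e + e') (d + d') \<tau>"
proof -
  have "- (d + d') * \<bar>\<tau>\<bar> = - d * \<bar>\<tau>\<bar> + - d' * \<bar>\<tau>\<bar>" by (simp add: algebra_simps)
  thus ?thesis unfolding vertical_rate_def by (simp only: powr_add exp_add mult_ac)
qed

lemma vertical_rate_divide: "vertical_rate e d \<tau> / vertical_rate e' d' \<tau> = vertical_rate (e - e') (d - d') \<tau>"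
proof -
  have "- (d - d') * \<bar>\<tau>\<bar> = - d * \<bar>\<tau>\<bar> - - d' * \<bar>\<tau>\<bar>" by (simp add: algebra_simps)
  thus ?thesis unfolding vertical_rate_def by (simp only: powr_diff exp_diff times_divide_times_eq)
qed

lemma Gamma_imaginary_axis_bigtheta:
  "(\<lambda>y. norm (Gamma (Complex 0 y))) \<in> \<Theta>[at_infinity](vertical_rate (- 1 / 2) (pi / 2))"
proof -
  have bounds: "exp (- pi * t) / t \<le> 2 * pi / (t * (exp (pi * t) - exp (- (pi * t)))) \<and>
      2 * pi / (t * (exp (pi * t) - exp (- (pi * t)))) \<le> 16 * (exp (- pi * t) / t)" if t: "t \<ge> 1" for t :: real
  proof -
    define E where "E = exp (pi * t)"
    have "pi * t \<ge> 1 * 1" using pi_ge_two t by (intro mult_mono) auto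
    hence "E \<ge> 2" using exp_ge_add_one_self[of "pi * t"] unfolding E_def by linarith
    moreover have "exp (- (pi * t)) = 1 / E" "exp (- pi * t) = 1 / E" by (simp_all add: E_def exp_minus inverse_eq_divide)
    moreover have "1 / E \<le> E / 2"
    proof -
      have "2 * 1 \<le> E * E" using \<open>E \<ge> 2\<close> by (intro mult_mono) auto
      thus ?thesis using \<open>E \<ge> 2\<close> by (simp add: field_simps)
    qed
    moreover have "1 / E > 0" using \<open>E \<ge> 2\<close> by simp
    ultimately have E: "E / 2 \<le> E - 1 / E" "E - 1 / E \<le> E" "E > 0" by linarith+
    \<comment> \<open>\<open>E - 1/E\<close> lies between \<open>E/2\<close> and \<open>E\<close>, and \<open>1 \<le> 2\<pi> \<le> 8\<close>\<close>
    have d: "1 / E / t \<le> 2 * pi / (t * (E - 1 / E)) \<and> 2 * pi / (t * (E - 1 / E)) \<le> 16 * (1 / E / t)"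
    proof
      have "1 / E / t = 1 / (t * E)" by simp
      also have "\<dots> \<le> 2 * pi / (t * (E - 1 / E))"
        using E t pi_ge_two by (intro frac_le mult_left_mono mult_pos_pos) auto
      finally show "1 / E / t \<le> 2 * pi / (t * (E - 1 / E))" .
      have "2 * pi / (t * (E - 1 / E)) \<le> 8 / (t * (E / 2))"
        using E t pi_less_4 by (intro frac_le mult_left_mono mult_pos_pos) auto
      also have "\<dots> = 16 * (1 / E / t)" by simp
      finally show "2 * pi / (t * (E - 1 / E)) \<le> 16 * (1 / E / t)" .
    qed
    have e: "exp (- (pi * t)) = 1 / E" "exp (- pi * t) = 1 / E" "exp (pi * t) = E"
      by (simp_all add: E_def exp_minus inverse_eq_divide)
    show ?thesis unfolding e by (rule d)
  qed
  show ?thesis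
  proof (rule bigthetaI'[of 1 4])
    show "eventually (\<lambda>y. 1 * norm (vertical_rate (- 1 / 2) (pi / 2) y) \<le> norm (norm (Gamma (Complex 0 y))) \<and>
        norm (norm (Gamma (Complex 0 y))) \<le> 4 * norm (vertical_rate (- 1 / 2) (pi / 2) y)) at_infinity"
      using eventually_at_infinity_abs[of 1]
    proof eventually_elim
      case (elim y)
      have sq: "(vertical_rate (- 1 / 2) (pi / 2) y)\<^sup>2 = exp (- pi * \<bar>y\<bar>) / \<bar>y\<bar>"
      proof -
        have 1: "\<bar>y\<bar> powr (- 1 / 2) * \<bar>y\<bar> powr (- 1 / 2) = 1 / \<bar>y\<bar>"
          unfolding powr_add [symmetric] using elim by (simp add: powr_minus_divide)
        have 2: "exp (- (pi / 2) * \<bar>y\<bar>) * exp (- (pi / 2) * \<bar>y\<bar>) = exp (- pi * \<bar>y\<bar>)"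
          unfolding exp_add [symmetric] by (rule arg_cong[where f = exp]) (simp add: field_simps)
        have "(vertical_rate (- 1 / 2) (pi / 2) y)\<^sup>2 = (\<bar>y\<bar> powr (- 1 / 2) * \<bar>y\<bar> powr (- 1 / 2)) *
            (exp (- (pi / 2) * \<bar>y\<bar>) * exp (- (pi / 2) * \<bar>y\<bar>))"
          unfolding vertical_rate_def power2_eq_square by (simp only: mult_ac)
        thus ?thesis unfolding 1 2 by simp
      qed
      have nonneg: "vertical_rate (- 1 / 2) (pi / 2) y \<ge> 0" by (simp add: vertical_rate_def)
      have "(vertical_rate (- 1 / 2) (pi / 2) y)\<^sup>2 \<le> (norm (Gamma (Complex 0 y)))\<^sup>2"
        "(norm (Gamma (Complex 0 y)))\<^sup>2 \<le> (4 * vertical_rate (- 1 / 2) (pi / 2) y)\<^sup>2"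
        unfolding norm_Gamma_imaginary_axis[OF elim] power_mult_distrib sq using bounds[OF elim] by simp_all
      hence "vertical_rate (- 1 / 2) (pi / 2) y \<le> norm (Gamma (Complex 0 y))"
        "norm (Gamma (Complex 0 y)) \<le> 4 * vertical_rate (- 1 / 2) (pi / 2) y"
        using nonneg by (auto intro: power2_le_imp_le)
      thus ?case using nonneg by simp
    qed
  qed auto
qed

lemma Gamma_strip_bigtheta:
  assumes "0 \<le> x" "x \<le> 1"
  shows "(\<lambda>y. norm (Gamma (Complex x y))) \<in> \<Theta>[at_infinity](vertical_rate (x - 1 / 2) (pi / 2))"
proof -
  define M where "M = pi\<^sup>2 / 3"
  have "(\<lambda>y. norm (Gamma (Complex x y))) \<in> \<Theta>[at_infinity](\<lambda>y. norm (Gamma (Complex 0 y)) * vertical_rate x 0 y)"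
  proof (rule bigthetaI'[of "exp (- M)" "exp M"])
    show "eventually (\<lambda>y. exp (- M) * norm (norm (Gamma (Complex 0 y)) * vertical_rate x 0 y) \<le> norm (norm (Gamma (Complex x y))) \<and>
        norm (norm (Gamma (Complex x y))) \<le> exp M * norm (norm (Gamma (Complex 0 y)) * vertical_rate x 0 y)) at_infinity"
      using eventually_at_infinity_abs[of 1]
    proof eventually_elim
      case (elim y)
      have nz: "norm (Gamma (Complex t y)) > 0" for t
      proof -
        have "Complex t y \<notin> \<int>\<^sub>\<le>\<^sub>0" using elim by (auto simp: complex_eq_iff elim!: nonpos_Ints_cases)
        thus ?thesis by (simp add: Gamma_eq_zero_iff del: complex_eq_iff)
      qed
      define L where "L = ln (norm (Gamma (Complex x y)))"
      define R where "R = ln (norm (Gamma (Complex 0 y))) + x * ln \<bar>y\<bar>"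
      have "exp R = norm (Gamma (Complex 0 y)) * vertical_rate x 0 y"
        using nz elim by (auto simp: R_def exp_add vertical_rate_def powr_def)
      moreover have "exp L = norm (Gamma (Complex x y))" using nz by (simp add: L_def)
      moreover have "\<bar>L - R\<bar> \<le> M"
        using ln_norm_Gamma_interpolation[OF elim assms] by (simp add: L_def R_def M_def)
      hence "exp (- M + R) \<le> exp L" "exp L \<le> exp (M + R)" by (auto simp: abs_le_iff)
      hence "exp (- M) * exp R \<le> exp L" "exp L \<le> exp M * exp R" by (simp_all only: exp_add)
      ultimately show ?case by (simp add: vertical_rate_def abs_mult)
    qed
  qed auto
  also have "(\<lambda>y. norm (Gamma (Complex 0 y)) * vertical_rate x 0 y) \<in>
      \<Theta>[at_infinity](\<lambda>y. vertical_rate (- 1 / 2) (pi / 2) y * vertical_rate x 0 y)"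
    by (intro landau_theta.mult Gamma_imaginary_axis_bigtheta) auto
  also have "(\<lambda>y. vertical_rate (- 1 / 2) (pi / 2) y * vertical_rate x 0 y) = vertical_rate (x - 1 / 2) (pi / 2)"
    by (simp add: vertical_rate_mult fun_eq_iff algebra_simps)
  finally show ?thesis .
qed

lemma norm_Complex_bigtheta: "(\<lambda>y. norm (Complex x y)) \<in> \<Theta>[at_infinity](vertical_rate 1 0)"
proof (rule bigthetaI'[of 1 "\<bar>x\<bar> + 1"])
  show "eventually (\<lambda>y. 1 * norm (vertical_rate 1 0 y) \<le> norm (norm (Complex x y)) \<and>
      norm (norm (Complex x y)) \<le> (\<bar>x\<bar> + 1) * norm (vertical_rate 1 0 y)) at_infinity"
    using eventually_at_infinity_abs[of 1]
  proof eventually_elim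
    case (elim y)
    have "norm (Complex x y) \<le> \<bar>x\<bar> + \<bar>y\<bar>" using cmod_le[of "Complex x y"] by simp
    also have "\<dots> \<le> (\<bar>x\<bar> + 1) * \<bar>y\<bar>" using elim mult_left_mono[of 1 "\<bar>y\<bar>" "\<bar>x\<bar>"] by (simp add: algebra_simps)
    finally show ?case using abs_Im_le_cmod[of "Complex x y"] by (simp add: vertical_rate_def)
  qed
qed auto

text \<open>
  The functional equation moves the strip \<open>0 \<le> x \<le> 1\<close> by \<open>1\<close> in either direction, at the cost of a
  factor of order \<open>\<bar>y\<bar>\<close>.
\<close>

lemma Gamma_vertical_bigtheta:
  "(\<lambda>y. norm (Gamma (Complex x y))) \<in> \<Theta>[at_infinity](vertical_rate (x - 1 / 2) (pi / 2))"
proof -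
  define S where "S x \<longleftrightarrow> (\<lambda>y. norm (Gamma (Complex x y))) \<in> \<Theta>[at_infinity](vertical_rate (x - 1 / 2) (pi / 2))" for x
  have eq: "eventually (\<lambda>y. norm (Gamma (Complex (x + 1) y)) = norm (Gamma (Complex x y)) * norm (Complex x y)) at_infinity" (is ?A)
    "eventually (\<lambda>y. norm (Gamma (Complex x y)) = norm (Gamma (Complex (x + 1) y)) * inverse (norm (Complex x y))) at_infinity" (is ?B)
    for x
  proof -
    have *: "Gamma (Complex (x + 1) y) = Complex x y * Gamma (Complex x y)" "norm (Complex x y) \<noteq> 0" if "\<bar>y\<bar> \<ge> 1" for y
    proof -
      have "Complex x y \<notin> \<int>\<^sub>\<le>\<^sub>0" using that by (auto simp: complex_eq_iff elim!: nonpos_Ints_cases)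
      hence "Gamma (Complex x y + 1) = Complex x y * Gamma (Complex x y)" by (rule Gamma_plus1)
      moreover have "Complex x y + 1 = Complex (x + 1) y" by (simp add: complex_eq_iff)
      ultimately show "Gamma (Complex (x + 1) y) = Complex x y * Gamma (Complex x y)" by simp
      show "norm (Complex x y) \<noteq> 0" using that by (auto simp: complex_eq_iff)
    qed
    show ?A
      using eventually_at_infinity_abs[of 1] by eventually_elim (simp only: * norm_mult mult.commute)
    show ?B
      using eventually_at_infinity_abs[of 1]
    proof eventually_elim
      case (elim y)
      show ?case unfolding *(1)[OF elim] norm_mult divide_inverse [symmetric]
        using *(2)[OF elim] by (simp only: nonzero_mult_div_cancel_left not_False_eq_True)
    qed
  qed
  have up: "S (x + 1)" if "S x" for x
  proof -
    have "(\<lambda>y. norm (Gamma (Complex x y)) * norm (Complex x y)) \<in>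
        \<Theta>[at_infinity](\<lambda>y. vertical_rate (x - 1 / 2) (pi / 2) y * vertical_rate 1 0 y)"
      using that unfolding S_def by (intro landau_theta.mult norm_Complex_bigtheta)
    also have "(\<lambda>y. vertical_rate (x - 1 / 2) (pi / 2) y * vertical_rate 1 0 y) = vertical_rate (x + 1 - 1 / 2) (pi / 2)"
      by (simp add: vertical_rate_mult fun_eq_iff algebra_simps)
    finally show ?thesis unfolding S_def by (subst landau_theta.in_cong[OF eq(1)])
  qed
  have down: "S x" if "S (x + 1)" for x
  proof -
    have "(\<lambda>y. norm (Gamma (Complex (x + 1) y)) * inverse (norm (Complex x y))) \<in>
        \<Theta>[at_infinity](\<lambda>y. vertical_rate (x + 1 - 1 / 2) (pi / 2) y * inverse (vertical_rate 1 0 y))"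
      using that unfolding S_def by (intro landau_theta.mult iffD2[OF bigtheta_inverse] norm_Complex_bigtheta)
    also have "(\<lambda>y. vertical_rate (x + 1 - 1 / 2) (pi / 2) y * inverse (vertical_rate 1 0 y)) = vertical_rate (x - 1 / 2) (pi / 2)"
      unfolding divide_inverse [symmetric] vertical_rate_divide by (simp add: algebra_simps)
    finally show ?thesis unfolding S_def by (subst landau_theta.in_cong[OF eq(2)])
  qed
  have main: "\<forall>x. - real n \<le> x \<and> x \<le> real n + 1 \<longrightarrow> S x" for n
  proof (induction n)
    case 0 show ?case using Gamma_strip_bigtheta by (simp add: S_def)
  next
    case (Suc n)
    show ?case
    proof (intro allI impI)
      fix x assume x: "- real (Suc n) \<le> x \<and> x \<le> real (Suc n) + 1"
      consider "- real n \<le> x \<and> x \<le> real n + 1" | "- real n \<le> x + 1 \<and> x + 1 \<le> real n + 1"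
        | "- real n \<le> x - 1 \<and> x - 1 \<le> real n + 1" using x by (simp, linarith)
      thus "S x" using Suc up[of "x - 1"] down[of x] by cases auto
    qed
  qed
  obtain n where "\<bar>x\<bar> < real n" using reals_Archimedean2 by blast
  hence "- real n \<le> x \<and> x \<le> real n + 1" by linarith
  thus ?thesis using main[of n] unfolding S_def by blast
qed

text \<open>For \<open>s = i \<tau>\<close> the point \<open>c + C s\<close> runs through the vertical line with real part \<open>Re c\<close>.\<close>

lemma Gamma_linear_bigtheta:
  fixes c :: complex and C :: real
  assumes "C \<noteq> 0"
  shows "(\<lambda>\<tau>. norm (Gamma (c + of_real C * (\<i> * of_real \<tau>)))) \<in>
    \<Theta>[at_infinity](vertical_rate (Re c - 1 / 2) (pi / 2 * \<bar>C\<bar>))"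
proof -
  define l where "l \<tau> = Im c + C * \<tau>" for \<tau>
  have eq: "c + of_real C * (\<i> * of_real \<tau>) = Complex (Re c) (l \<tau>)" for \<tau>
    by (simp add: complex_eq_iff l_def)
  \<comment> \<open>\<open>Im c\<close> is negligible against \<open>C \<tau>\<close>; in the exponential it only costs a constant factor.\<close>
  have ev: "eventually (\<lambda>\<tau>. \<bar>C\<bar> / 2 * \<bar>\<tau>\<bar> \<le> \<bar>l \<tau>\<bar> \<and> \<bar>l \<tau>\<bar> \<le> 2 * \<bar>C\<bar> * \<bar>\<tau>\<bar>) at_infinity"
    using eventually_at_infinity_abs[of "2 * \<bar>Im c\<bar> / \<bar>C\<bar>"]
  proof eventually_elim
    case (elim \<tau>)
    hence "2 * \<bar>Im c\<bar> \<le> \<bar>C\<bar> * \<bar>\<tau>\<bar>" using assms by (simp add: field_simps)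
    hence "2 * \<bar>Im c\<bar> \<le> \<bar>C * \<tau>\<bar>" by (simp add: abs_mult)
    hence "\<bar>C * \<tau>\<bar> / 2 \<le> \<bar>l \<tau>\<bar> \<and> \<bar>l \<tau>\<bar> \<le> 2 * \<bar>C * \<tau>\<bar>" unfolding l_def by linarith
    thus ?case by (simp add: abs_mult)
  qed
  have l_theta: "l \<in> \<Theta>[at_infinity](\<lambda>\<tau>. \<tau>)"
    using ev assms by (intro bigthetaI'[of "\<bar>C\<bar> / 2" "2 * \<bar>C\<bar>"]) auto
  have lim: "filterlim l at_infinity at_infinity"
    unfolding filterlim_at_infinity_conv_norm_at_top[of l]
  proof (rule filterlim_at_top_mono)
    show "filterlim (\<lambda>\<tau>. \<bar>C\<bar> / 2 * \<bar>\<tau>\<bar>) at_top at_infinity"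
    proof (rule filterlim_tendsto_pos_mult_at_top)
      show "filterlim (\<lambda>\<tau> :: real. \<bar>\<tau>\<bar>) at_top at_infinity"
        unfolding real_norm_def [symmetric] by (rule filterlim_norm_at_top)
    qed (use assms in auto)
    show "eventually (\<lambda>\<tau>. \<bar>C\<bar> / 2 * \<bar>\<tau>\<bar> \<le> norm (l \<tau>)) at_infinity"
      using ev by eventually_elim simp
  qed
  have "(\<lambda>\<tau>. norm (Gamma (Complex (Re c) (l \<tau>)))) \<in> \<Theta>[at_infinity](\<lambda>\<tau>. vertical_rate (Re c - 1 / 2) (pi / 2) (l \<tau>))"
    using landau_theta.compose[OF Gamma_vertical_bigtheta lim, of "Re c"] by (simp add: o_def)
  also have "(\<lambda>\<tau>. vertical_rate (Re c - 1 / 2) (pi / 2) (l \<tau>)) \<in> \<Theta>[at_infinity](vertical_rate (Re c - 1 / 2) (pi / 2 * \<bar>C\<bar>))"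
    unfolding vertical_rate_def [abs_def]
  proof (intro landau_theta.mult bigtheta_powr l_theta)
    show "(\<lambda>\<tau>. exp (- (pi / 2) * \<bar>l \<tau>\<bar>)) \<in> \<Theta>[at_infinity](\<lambda>\<tau>. exp (- (pi / 2 * \<bar>C\<bar>) * \<bar>\<tau>\<bar>))"
    proof (intro bigthetaI'[of "exp (- (pi / 2 * \<bar>Im c\<bar>))" "exp (pi / 2 * \<bar>Im c\<bar>)"] always_eventually allI)
      fix \<tau>
      have "\<bar>C * \<tau>\<bar> \<le> \<bar>l \<tau>\<bar> + \<bar>Im c\<bar>" "\<bar>l \<tau>\<bar> \<le> \<bar>C * \<tau>\<bar> + \<bar>Im c\<bar>" unfolding l_def by linarith+
      hence "pi / 2 * \<bar>C * \<tau>\<bar> \<le> pi / 2 * (\<bar>l \<tau>\<bar> + \<bar>Im c\<bar>)" "pi / 2 * \<bar>l \<tau>\<bar> \<le> pi / 2 * (\<bar>C * \<tau>\<bar> + \<bar>Im c\<bar>)"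
        by (auto intro!: mult_left_mono simp del: times_divide_eq_left)
      hence "exp (- (pi / 2 * \<bar>Im c\<bar>) + - (pi / 2 * \<bar>C\<bar>) * \<bar>\<tau>\<bar>) \<le> exp (- (pi / 2) * \<bar>l \<tau>\<bar>)"
        "exp (- (pi / 2) * \<bar>l \<tau>\<bar>) \<le> exp (pi / 2 * \<bar>Im c\<bar> + - (pi / 2 * \<bar>C\<bar>) * \<bar>\<tau>\<bar>)"
        by (auto simp: abs_mult algebra_simps)
      thus "exp (- (pi / 2 * \<bar>Im c\<bar>)) * norm (exp (- (pi / 2 * \<bar>C\<bar>) * \<bar>\<tau>\<bar>)) \<le> norm (exp (- (pi / 2) * \<bar>l \<tau>\<bar>)) \<and>
        norm (exp (- (pi / 2) * \<bar>l \<tau>\<bar>)) \<le> exp (pi / 2 * \<bar>Im c\<bar>) * norm (exp (- (pi / 2 * \<bar>C\<bar>) * \<bar>\<tau>\<bar>))"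
        by (simp only: real_norm_def abs_exp_cancel exp_add)
    qed auto
  qed
  finally show ?thesis by (simp add: eq)
qed


section \<open>Absolute convergence of the defining integral\<close>

lemma prod_list_bigtheta:
  fixes f :: "'a \<Rightarrow> real \<Rightarrow> real"
  assumes "\<And>x. x \<in> set xs \<Longrightarrow> f x \<in> \<Theta>[at_infinity](vertical_rate (e x) (d x))"
  shows "(\<lambda>\<tau>. \<Prod>x\<leftarrow>xs. f x \<tau>) \<in> \<Theta>[at_infinity](vertical_rate (\<Sum>x\<leftarrow>xs. e x) (\<Sum>x\<leftarrow>xs. d x))"
  using assms
proof (induction xs)
  case Nil
  show ?case
    by (intro bigthetaI_cong eventually_mono[OF eventually_at_infinity_abs[of 1]]) (auto simp: vertical_rate_def)
next
  case (Cons x xs)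
  have "(\<lambda>\<tau>. f x \<tau> * (\<Prod>x\<leftarrow>xs. f x \<tau>)) \<in> \<Theta>[at_infinity](\<lambda>\<tau>. vertical_rate (e x) (d x) \<tau> *
      vertical_rate (\<Sum>x\<leftarrow>xs. e x) (\<Sum>x\<leftarrow>xs. d x) \<tau>)"
    by (intro landau_theta.mult Cons) (use Cons.prems in auto)
  thus ?case by (simp add: vertical_rate_mult)
qed

lemma log_Gamma_branchD:
  assumes "log_Gamma_branch \<Lambda>"
  shows "continuous_on {s. Re s = 0 \<and> c + of_real C * s \<notin> \<int>\<^sub>\<le>\<^sub>0} (\<Lambda> c C \<kappa>)"
    and "Re s = 0 \<Longrightarrow> c + of_real C * s \<notin> \<int>\<^sub>\<le>\<^sub>0 \<Longrightarrow> exp (\<Lambda> c C \<kappa> s) = Gamma (c + of_real C * s)"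
  using assms unfolding log_Gamma_branch_def Let_def by blast+

lemma norm_Gamma_pow:
  assumes "log_Gamma_branch \<Lambda>" "Re s = 0"
  shows "norm (Gamma_pow \<Lambda> c C \<kappa> s) = norm (Gamma (c + of_real C * s)) powr \<kappa>"
proof (cases "c + of_real C * s \<in> \<int>\<^sub>\<le>\<^sub>0")
  case True
  thus ?thesis by (simp add: Gamma_pow_def Gamma_eq_zero_iff)
next
  case False
  have "norm (Gamma (c + of_real C * s)) = exp (Re (\<Lambda> c C \<kappa> s))"
    unfolding log_Gamma_branchD(2)[OF assms False, of \<kappa>, symmetric] by simp
  thus ?thesis using False by (simp add: Gamma_pow_def powr_def)
qed

lemma Gamma_pow_1:
  assumes "log_Gamma_branch \<Lambda>" "Re s = 0"
  shows "Gamma_pow \<Lambda> c C 1 s = Gamma (c + of_real C * s)"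
  using log_Gamma_branchD(2)[OF assms, of c C 1] by (auto simp: Gamma_pow_def Gamma_eq_zero_iff)

lemma Gamma_pow_bigtheta:
  assumes "log_Gamma_branch \<Lambda>" "C \<noteq> 0"
  shows "(\<lambda>\<tau>. norm (Gamma_pow \<Lambda> c C \<kappa> (\<i> * of_real \<tau>))) \<in>
    \<Theta>[at_infinity](vertical_rate ((Re c - 1 / 2) * \<kappa>) (pi / 2 * (\<kappa> * \<bar>C\<bar>)))"
proof -
  have "(\<lambda>\<tau>. \<bar>norm (Gamma (c + of_real C * (\<i> * of_real \<tau>)))\<bar> powr \<kappa>) \<in>
      \<Theta>[at_infinity](\<lambda>\<tau>. \<bar>vertical_rate (Re c - 1 / 2) (pi / 2 * \<bar>C\<bar>) \<tau>\<bar> powr \<kappa>)"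
    by (intro bigtheta_powr Gamma_linear_bigtheta assms)
  also have "(\<lambda>\<tau>. \<bar>norm (Gamma (c + of_real C * (\<i> * of_real \<tau>)))\<bar> powr \<kappa>) =
      (\<lambda>\<tau>. norm (Gamma_pow \<Lambda> c C \<kappa> (\<i> * of_real \<tau>)))"
    using norm_Gamma_pow[OF assms(1)] by simp
  also have "(\<lambda>\<tau>. \<bar>vertical_rate (Re c - 1 / 2) (pi / 2 * \<bar>C\<bar>) \<tau>\<bar> powr \<kappa>) =
      vertical_rate ((Re c - 1 / 2) * \<kappa>) (pi / 2 * (\<kappa> * \<bar>C\<bar>))"
  proof
    fix \<tau>
    have "exp (- (pi / 2 * \<bar>C\<bar>) * \<bar>\<tau>\<bar>) powr \<kappa> = exp (- (pi / 2 * (\<kappa> * \<bar>C\<bar>)) * \<bar>\<tau>\<bar>)"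
      by (simp add: powr_def)
    thus "\<bar>vertical_rate (Re c - 1 / 2) (pi / 2 * \<bar>C\<bar>) \<tau>\<bar> powr \<kappa> =
        vertical_rate ((Re c - 1 / 2) * \<kappa>) (pi / 2 * (\<kappa> * \<bar>C\<bar>)) \<tau>"
      unfolding vertical_rate_def abs_mult by (subst powr_mult) (auto simp: powr_powr)
  qed
  finally show ?thesis .
qed

lemma norm_prod_list:
  fixes f :: "'a \<Rightarrow> complex"
  shows "norm (\<Prod>x\<leftarrow>xs. f x) = (\<Prod>x\<leftarrow>xs. norm (f x))"
  by (induction xs) (auto simp: norm_mult)

text \<open>
  The factor \<open>\<Gamma>\<^sup>\<kappa>(c + C s)\<close> contributes \<open>(Re c - 1/2) \<kappa>\<close> to the exponent of \<open>\<bar>\<tau>\<bar>\<close> and \<open>\<kappa> \<bar>C\<bar>\<close> times \<open>\<pi>/2\<close> to the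
  exponential rate. Summed with the sign of the exponent in the kernel, the former give \<open>\<Omega>\<close> and the latter \<open>\<pi>\<Delta>/2\<close>.
\<close>

lemma I_kernel_bigtheta:
  assumes "log_Gamma_branch \<Lambda>"
    and us: "\<forall>(a, A, \<alpha>)\<in>set us. A > 0 \<and> \<alpha> > 0" and ls: "\<forall>(b, B, \<beta>)\<in>set ls. B > 0 \<and> \<beta> > 0"
  shows "(\<lambda>\<tau>. norm (I_kernel \<Lambda> m n us ls (\<i> * of_real \<tau>))) \<in>
    \<Theta>[at_infinity](vertical_rate (I_Omega us ls) (pi / 2 * I_Delta m n us ls))"
proof -
  define eP where "eP = (\<lambda>(c :: complex, C :: real, \<kappa> :: real). (Re c - 1 / 2) * \<kappa>)"
  define eM where "eM = (\<lambda>(c :: complex, C :: real, \<kappa> :: real). (Re (1 - c) - 1 / 2) * \<kappa>)"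
  define d where "d = (\<lambda>(c :: complex, C :: real, \<kappa> :: real). pi / 2 * (\<kappa> * \<bar>C\<bar>))"
  have P: "(\<lambda>\<tau>. \<Prod>x\<leftarrow>xs. norm (case x of (c, C, \<kappa>) \<Rightarrow> Gamma_pow \<Lambda> c C \<kappa> (\<i> * of_real \<tau>))) \<in>
      \<Theta>[at_infinity](vertical_rate (\<Sum>x\<leftarrow>xs. eP x) (\<Sum>x\<leftarrow>xs. d x))"
    and M: "(\<lambda>\<tau>. \<Prod>x\<leftarrow>xs. norm (case x of (c, C, \<kappa>) \<Rightarrow> Gamma_pow \<Lambda> (1 - c) (- C) \<kappa> (\<i> * of_real \<tau>))) \<in>
      \<Theta>[at_infinity](vertical_rate (\<Sum>x\<leftarrow>xs. eM x) (\<Sum>x\<leftarrow>xs. d x))"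
    if xs: "\<forall>(a, A, \<alpha>)\<in>set xs. A > 0 \<and> \<alpha> > 0" for xs
  proof (goal_cases)
    case 1
    show ?case
    proof (intro prod_list_bigtheta)
      fix x assume "x \<in> set xs"
      with xs obtain c C \<kappa> where "x = (c, C, \<kappa>)" "C \<noteq> 0" by (cases x) auto
      thus "(\<lambda>\<tau>. norm (case x of (c, C, \<kappa>) \<Rightarrow> Gamma_pow \<Lambda> c C \<kappa> (\<i> * of_real \<tau>))) \<in> \<Theta>[at_infinity](vertical_rate (eP x) (d x))"
        using Gamma_pow_bigtheta[OF assms(1), of C c \<kappa>] by (simp add: eP_def d_def)
    qed
  next
    case 2
    show ?case
    proof (intro prod_list_bigtheta)
      fix x assume "x \<in> set xs"
      with xs obtain c C \<kappa> where "x = (c, C, \<kappa>)" "C \<noteq> 0" by (cases x) auto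
      thus "(\<lambda>\<tau>. norm (case x of (c, C, \<kappa>) \<Rightarrow> Gamma_pow \<Lambda> (1 - c) (- C) \<kappa> (\<i> * of_real \<tau>))) \<in> \<Theta>[at_infinity](vertical_rate (eM x) (d x))"
        using Gamma_pow_bigtheta[OF assms(1), of "- C" "1 - c" \<kappa>] by (simp add: eM_def d_def)
    qed
  qed
  have sub: "\<forall>(b, B, \<beta>)\<in>set (take m ls). B > 0 \<and> \<beta> > 0" "\<forall>(b, B, \<beta>)\<in>set (drop m ls). B > 0 \<and> \<beta> > 0"
    "\<forall>(a, A, \<alpha>)\<in>set (take n us). A > 0 \<and> \<alpha> > 0" "\<forall>(a, A, \<alpha>)\<in>set (drop n us). A > 0 \<and> \<alpha> > 0"
    using us ls by (auto dest!: in_set_takeD in_set_dropD)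
  have "(\<lambda>\<tau>. norm (I_kernel \<Lambda> m n us ls (\<i> * of_real \<tau>))) \<in>
    \<Theta>[at_infinity](\<lambda>\<tau>. (vertical_rate (\<Sum>x\<leftarrow>take m ls. eP x) (\<Sum>x\<leftarrow>take m ls. d x) \<tau> *
      vertical_rate (\<Sum>x\<leftarrow>take n us. eM x) (\<Sum>x\<leftarrow>take n us. d x) \<tau>) *
      inverse (vertical_rate (\<Sum>x\<leftarrow>drop m ls. eM x) (\<Sum>x\<leftarrow>drop m ls. d x) \<tau> *
      vertical_rate (\<Sum>x\<leftarrow>drop n us. eP x) (\<Sum>x\<leftarrow>drop n us. d x) \<tau>))" (is "_ \<in> \<Theta>[_](?R)")
    unfolding I_kernel_def divide_inverse norm_mult norm_inverse inverse_mult_distrib norm_prod_list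
    by (intro landau_theta.mult iffD2[OF bigtheta_inverse] P M sub)
  also have "?R = vertical_rate (I_Omega us ls) (pi / 2 * I_Delta m n us ls)"
  proof -
    have eM: "(\<Sum>x\<leftarrow>xs. eM x) = - (\<Sum>x\<leftarrow>xs. eP x)" for xs
      by (induction xs) (auto simp: eM_def eP_def algebra_simps)
    have half: "(\<Sum>(c, C, \<kappa>)\<leftarrow>xs. (1 / 2 - Re c) * \<kappa>) = - (\<Sum>x\<leftarrow>xs. eP x)" for xs :: "triple list"
      by (induction xs) (auto simp: eP_def algebra_simps)
    have split: "(\<Sum>x\<leftarrow>xs. eP x) = (\<Sum>x\<leftarrow>take k xs. eP x) + (\<Sum>x\<leftarrow>drop k xs. eP x)" for xs k
      by (metis append_take_drop_id map_append sum_list.append)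
    have dd: "(\<Sum>x\<leftarrow>xs. d x) = pi / 2 * (\<Sum>(c, C, \<kappa>)\<leftarrow>xs. \<kappa> * C)"
      if "\<forall>(a, A, \<alpha>)\<in>set xs. A > 0 \<and> \<alpha> > 0" for xs
      using that by (induction xs) (auto simp: d_def algebra_simps)
    show ?thesis
      unfolding vertical_rate_mult divide_inverse [symmetric] vertical_rate_divide I_Omega_def I_Delta_def half eM
        dd[OF sub(1)] dd[OF sub(2)] dd[OF sub(3)] dd[OF sub(4)] split[of ls m] split[of us n]
      by (simp add: algebra_simps)
  qed
  finally show ?thesis .
qed

lemma continuous_on_prod_list:
  fixes f :: "'a \<Rightarrow> real \<Rightarrow> real"
  assumes "\<And>x. x \<in> set xs \<Longrightarrow> continuous_on S (f x)"
  shows "continuous_on S (\<lambda>\<tau>. \<Prod>x\<leftarrow>xs. f x \<tau>)"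
  using assms by (induction xs) (auto intro!: continuous_intros)

text \<open>
  The denominator factors may have poles on the contour. Their reciprocals are powers of \<open>\<bar>1 / \<Gamma>\<bar>\<close>,
  so the modulus of the kernel is continuous on the whole contour, although the kernel need not be.
\<close>

lemma continuous_norm_I_kernel:
  assumes br: "log_Gamma_branch \<Lambda>"
    and us: "\<forall>(a, A, \<alpha>)\<in>set us. A > 0 \<and> \<alpha> > 0" and ls: "\<forall>(b, B, \<beta>)\<in>set ls. B > 0 \<and> \<beta> > 0"
    and sep: "I_separation m n us ls"
  shows "continuous_on UNIV (\<lambda>\<tau>. norm (I_kernel \<Lambda> m n us ls (\<i> * of_real \<tau>)))"
proof -
  have num: "continuous_on UNIV (\<lambda>\<tau>. norm (Gamma_pow \<Lambda> c C \<kappa> (\<i> * of_real \<tau>)))"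
    if "\<And>s. Re s = 0 \<Longrightarrow> c + of_real C * s \<notin> \<int>\<^sub>\<le>\<^sub>0" for c C \<kappa>
  proof -
    have "continuous_on UNIV (\<lambda>\<tau>. norm (Gamma (c + of_real C * (\<i> * of_real \<tau>))) powr \<kappa>)"
      using that by (intro continuous_intros continuous_on_compose2[OF continuous_on_Gamma[of "- \<int>\<^sub>\<le>\<^sub>0"]])
        (auto simp: Gamma_eq_zero_iff)
    thus ?thesis by (simp add: norm_Gamma_pow[OF br])
  qed
  have den: "continuous_on UNIV (\<lambda>\<tau>. inverse (norm (Gamma_pow \<Lambda> c C \<kappa> (\<i> * of_real \<tau>))))" if "\<kappa> > 0" for c C \<kappa>
  proof -
    have "continuous_on UNIV (\<lambda>\<tau>. norm (rGamma (c + of_real C * (\<i> * of_real \<tau>))) powr \<kappa>)"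
      using that by (intro continuous_on_powr' continuous_intros continuous_on_compose2[OF continuous_on_rGamma[of UNIV]]) auto
    also have "(\<lambda>\<tau>. norm (rGamma (c + of_real C * (\<i> * of_real \<tau>))) powr \<kappa>) =
        (\<lambda>\<tau>. inverse (norm (Gamma_pow \<Lambda> c C \<kappa> (\<i> * of_real \<tau>))))"
      by (simp add: norm_Gamma_pow[OF br] rGamma_inverse_Gamma norm_inverse inverse_powr)
    finally show ?thesis .
  qed
  have inv_prod: "inverse (\<Prod>x\<leftarrow>xs. f x) = (\<Prod>x\<leftarrow>xs. inverse (f x))" for xs and f :: "triple \<Rightarrow> real"
    by (induction xs) auto
  define gP where "gP x \<tau> = norm (case x of (c, C, \<kappa>) \<Rightarrow> Gamma_pow \<Lambda> c C \<kappa> (\<i> * of_real \<tau>))" for x \<tau>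
  define gM where "gM x \<tau> = norm (case x of (c, C, \<kappa>) \<Rightarrow> Gamma_pow \<Lambda> (1 - c) (- C) \<kappa> (\<i> * of_real \<tau>))" for x \<tau>
  have eq: "norm (I_kernel \<Lambda> m n us ls (\<i> * of_real \<tau>)) =
     ((\<Prod>x\<leftarrow>take m ls. gP x \<tau>) *
      (\<Prod>x\<leftarrow>take n us. gM x \<tau>)) *
      ((\<Prod>x\<leftarrow>drop m ls. inverse (gM x \<tau>)) *
      (\<Prod>x\<leftarrow>drop n us. inverse (gP x \<tau>)))" for \<tau>
    by (simp only: I_kernel_def divide_inverse inverse_mult_distrib norm_mult norm_inverse norm_prod_list inv_prod gP_def gM_def)
  have sep1: "c + of_real C * s \<notin> \<int>\<^sub>\<le>\<^sub>0" if "(c, C, \<kappa>) \<in> set (take m ls)" "Re s = 0" for c C \<kappa> s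
    using sep that unfolding I_separation_def by fastforce
  have sep2: "1 - c + of_real (- C) * s \<notin> \<int>\<^sub>\<le>\<^sub>0" if "(c, C, \<kappa>) \<in> set (take n us)" "Re s = 0" for c C \<kappa> s
    using sep that unfolding I_separation_def by fastforce
  show ?thesis unfolding eq
  proof (intro continuous_on_mult continuous_on_prod_list)
    fix x assume x: "x \<in> set (take m ls)"
    obtain c C \<kappa> where eq: "x = (c, C, \<kappa>)" by (cases x)
    show "continuous_on UNIV (\<lambda>\<tau>. gP x \<tau>)"
      using num[of c C \<kappa>, OF sep1] x unfolding eq gP_def gM_def by simp
  next
    fix x assume x: "x \<in> set (take n us)"
    obtain c C \<kappa> where eq: "x = (c, C, \<kappa>)" by (cases x)
    show "continuous_on UNIV (\<lambda>\<tau>. gM x \<tau>)"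
      using num[of "1 - c" "- C" \<kappa>, OF sep2] x unfolding eq gP_def gM_def by simp
  next
    fix x assume x: "x \<in> set (drop m ls)"
    obtain c C \<kappa> where eq: "x = (c, C, \<kappa>)" by (cases x)
    have "\<kappa> > 0" using in_set_dropD[OF x] ls eq by auto
    thus "continuous_on UNIV (\<lambda>\<tau>. inverse (gM x \<tau>))"
      using den[of \<kappa> "1 - c" "- C"] unfolding eq gP_def gM_def by simp
  next
    fix x assume x: "x \<in> set (drop n us)"
    obtain c C \<kappa> where eq: "x = (c, C, \<kappa>)" by (cases x)
    have "\<kappa> > 0" using in_set_dropD[OF x] us eq by auto
    thus "continuous_on UNIV (\<lambda>\<tau>. inverse (gP x \<tau>))"
      using den[of \<kappa> c C] unfolding eq gP_def gM_def by simp
  qed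
qed

lemma measurable_Gamma_pow:
  assumes br: "log_Gamma_branch \<Lambda>" and C: "C \<noteq> 0"
  shows "(\<lambda>\<tau>. Gamma_pow \<Lambda> c C \<kappa> (\<i> * of_real \<tau>)) \<in> borel_measurable borel"
proof (rule borel_measurable_continuous_countable_exceptions)
  define X where "X = {\<tau> :: real. c + of_real C * (\<i> * of_real \<tau>) \<in> \<int>\<^sub>\<le>\<^sub>0}"
  \<comment> \<open>There is at most one pole on the contour; off it the branch of the logarithm is continuous.\<close>
  have "X \<subseteq> {- Im c / C}"
    using C by (auto simp: X_def complex_eq_iff field_simps elim!: nonpos_Ints_cases)
  thus "countable X" by (meson countable_finite finite.emptyI finite.insertI finite_subset)
  have "continuous_on (- X) (\<lambda>\<tau>. exp (of_real \<kappa> * \<Lambda> c C \<kappa> (\<i> * of_real \<tau>)))"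
    by (intro continuous_intros continuous_on_compose2[OF log_Gamma_branchD(1)[OF br]]) (auto simp: X_def)
  thus "continuous_on (- X) (\<lambda>\<tau>. Gamma_pow \<Lambda> c C \<kappa> (\<i> * of_real \<tau>))"
    by (rule continuous_on_eq) (auto simp: X_def Gamma_pow_def)
qed

lemma measurable_prod_list:
  fixes f :: "'a \<Rightarrow> real \<Rightarrow> complex"
  assumes "\<And>x. x \<in> set xs \<Longrightarrow> f x \<in> borel_measurable borel"
  shows "(\<lambda>\<tau>. \<Prod>x\<leftarrow>xs. f x \<tau>) \<in> borel_measurable borel"
  using assms by (induction xs) (auto intro!: borel_measurable_times)

lemma measurable_I_kernel:
  assumes br: "log_Gamma_branch \<Lambda>"
    and us: "\<forall>(a, A, \<alpha>)\<in>set us. A > 0 \<and> \<alpha> > 0" and ls: "\<forall>(b, B, \<beta>)\<in>set ls. B > 0 \<and> \<beta> > 0"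
  shows "(\<lambda>\<tau>. I_kernel \<Lambda> m n us ls (\<i> * of_real \<tau>)) \<in> borel_measurable borel"
  unfolding I_kernel_def
  by (intro borel_measurable_divide borel_measurable_times measurable_prod_list)
     (use us ls measurable_Gamma_pow[OF br] in \<open>auto dest!: in_set_takeD in_set_dropD split: prod.splits\<close>)

lemma set_integrable_powr_to_inf:
  assumes "p < -1"
  shows "set_integrable lborel {1..} (\<lambda>t :: real. t powr p)"
proof -
  have "(\<lambda>t :: real. t powr p) integrable_on {1..}"
    using has_integral_powr_to_inf[OF assms, of 1] by (auto simp: integrable_on_def)
  hence "(\<lambda>t :: real. t powr p) absolutely_integrable_on {1..}"
    by (intro nonnegative_absolutely_integrable_1) auto
  hence "integrable lebesgue (\<lambda>t :: real. indicator {1..} t *\<^sub>R t powr p)"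
    by (simp add: set_integrable_def)
  thus ?thesis unfolding set_integrable_def
    by (subst (asm) integrable_completion) auto
qed

lemma integrable_of_tail_bound:
  fixes f :: "real \<Rightarrow> complex"
  assumes meas: "f \<in> borel_measurable borel" and cont: "continuous_on UNIV (\<lambda>\<tau>. norm (f \<tau>))"
    and tail: "(\<lambda>\<tau>. norm (f \<tau>)) \<in> O[at_infinity](\<lambda>\<tau>. \<bar>\<tau>\<bar> powr p)" and p: "p < -1"
  shows "integrable lborel f"
proof -
  obtain K where "K > 0" and "eventually (\<lambda>\<tau>. norm (norm (f \<tau>)) \<le> K * norm (\<bar>\<tau>\<bar> powr p)) at_infinity"
    using tail by (rule landau_o.bigE)
  then obtain T0 where T0: "\<And>\<tau>. \<bar>\<tau>\<bar> \<ge> T0 \<Longrightarrow> norm (f \<tau>) \<le> K * \<bar>\<tau>\<bar> powr p"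
    by (auto simp: eventually_at_infinity)
  define T where "T = max T0 1"
  define h where "h t = indicator {1..} t * t powr p" for t :: real
  have h: "integrable lborel h"
    using set_integrable_powr_to_inf[OF p] by (simp add: set_integrable_def h_def [abs_def])
  have h': "integrable lborel (\<lambda>t. h (- t))"
    using lborel_integrable_real_affine[OF h, of "-1" 0] by simp
  have c: "integrable lborel (\<lambda>t. indicator {-T..T} t *\<^sub>R norm (f t))"
    by (intro borel_integrable_compact continuous_on_subset[OF cont]) auto
  have "integrable lborel (\<lambda>t. indicator {-T..T} t *\<^sub>R norm (f t) + K * (h t + h (- t)))"
    by (intro Bochner_Integration.integrable_add integrable_mult_right c h h')
  thus ?thesis
  proof (rule Bochner_Integration.integrable_bound)
    show "f \<in> borel_measurable lborel" using meas by simp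
    show "AE t in lborel. norm (f t) \<le> norm (indicator {-T..T} t *\<^sub>R norm (f t) + K * (h t + h (- t)))"
    proof (rule AE_I2)
      fix t :: real
      have hn: "h s \<ge> 0" for s by (simp add: h_def)
      show "norm (f t) \<le> norm (indicator {-T..T} t *\<^sub>R norm (f t) + K * (h t + h (- t)))"
      proof (cases "t \<in> {-T..T}")
        case True
        have "K * (h t + h (- t)) \<ge> 0" using hn \<open>K > 0\<close> by (intro mult_nonneg_nonneg add_nonneg_nonneg) auto
        thus ?thesis using True by simp
      next
        case False
        hence "\<bar>t\<bar> \<ge> T" by auto
        hence t: "\<bar>t\<bar> \<ge> T0" "\<bar>t\<bar> \<ge> 1" by (auto simp: T_def)
        hence "\<bar>t\<bar> powr p \<le> h t + h (- t)" using hn[of t] hn[of "- t"] by (cases "t \<ge> 0") (auto simp: h_def)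
        hence "K * \<bar>t\<bar> powr p \<le> K * (h t + h (- t))" using \<open>K > 0\<close> by (intro mult_left_mono) auto
        with T0[OF t(1)] show ?thesis using False by simp
      qed
    qed
  qed
qed

text \<open>
  The two alternatives of the convergence condition correspond to exponential decay of the integrand
  and to the boundary case in which only the power \<open>\<bar>\<tau>\<bar>\<^bsup>\<Omega>\<^esup>\<close> is left.
\<close>

theorem I_fun_integrable:
  assumes br: "log_Gamma_branch \<Lambda>" and adm: "I_admissible m n us ls \<theta>"
  shows "integrable lborel (\<lambda>\<tau>. I_kernel \<Lambda> m n us ls (\<i> * of_real \<tau>) *
    exp (- (\<i> * of_real \<tau>) * (of_real x + \<i> * of_real \<theta>)))"
proof -
  have us: "\<forall>(a, A, \<alpha>)\<in>set us. A > 0 \<and> \<alpha> > 0" and ls: "\<forall>(b, B, \<beta>)\<in>set ls. B > 0 \<and> \<beta> > 0"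
    and sep: "I_separation m n us ls" and conv: "I_convergence 0 m n us ls \<theta>"
    using adm unfolding I_admissible_def by blast+
  define e where "e = I_Omega us ls"
  define D where "D = I_Delta m n us ls"
  define f where "f \<tau> = I_kernel \<Lambda> m n us ls (\<i> * of_real \<tau>) *
    exp (- (\<i> * of_real \<tau>) * (of_real x + \<i> * of_real \<theta>))" for \<tau>
  have norm_f: "norm (f \<tau>) = norm (I_kernel \<Lambda> m n us ls (\<i> * of_real \<tau>)) * exp (\<theta> * \<tau>)" for \<tau>
    by (simp add: f_def norm_mult mult.commute)
  define \<delta> where "\<delta> = pi / 2 * D - \<bar>\<theta>\<bar>"
  have conv': "\<delta> > 0 \<or> \<delta> = 0 \<and> e < -1"
    using conv unfolding I_convergence_def Let_def by (auto simp: D_def e_def \<delta>_def)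
  have "(\<lambda>\<tau>. norm (f \<tau>)) \<in> O[at_infinity](vertical_rate e \<delta>)"
  proof -
    have "(\<lambda>\<tau>. norm (I_kernel \<Lambda> m n us ls (\<i> * of_real \<tau>)) * exp (\<theta> * \<tau>)) \<in>
        O[at_infinity](\<lambda>\<tau>. vertical_rate e (pi / 2 * D) \<tau> * exp (\<bar>\<theta>\<bar> * \<bar>\<tau>\<bar>))"
    proof (intro landau_o.big.mult)
      show "(\<lambda>\<tau>. norm (I_kernel \<Lambda> m n us ls (\<i> * of_real \<tau>))) \<in> O[at_infinity](vertical_rate e (pi / 2 * D))"
        unfolding e_def D_def by (rule bigthetaD1[OF I_kernel_bigtheta[OF br us ls]])
      show "(\<lambda>\<tau>. exp (\<theta> * \<tau>)) \<in> O[at_infinity](\<lambda>\<tau>. exp (\<bar>\<theta>\<bar> * \<bar>\<tau>\<bar>))"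
        by (intro landau_o.bigI[of 1] always_eventually) (auto simp: abs_mult [symmetric])
    qed
    also have "(\<lambda>\<tau>. vertical_rate e (pi / 2 * D) \<tau> * exp (\<bar>\<theta>\<bar> * \<bar>\<tau>\<bar>)) = vertical_rate e (pi / 2 * D - \<bar>\<theta>\<bar>)"
    proof
      fix \<tau>
      have "- (pi / 2 * D) * \<bar>\<tau>\<bar> + \<bar>\<theta>\<bar> * \<bar>\<tau>\<bar> = - (pi / 2 * D - \<bar>\<theta>\<bar>) * \<bar>\<tau>\<bar>" by (simp add: algebra_simps)
      thus "vertical_rate e (pi / 2 * D) \<tau> * exp (\<bar>\<theta>\<bar> * \<bar>\<tau>\<bar>) = vertical_rate e (pi / 2 * D - \<bar>\<theta>\<bar>) \<tau>"
        unfolding vertical_rate_def mult.assoc exp_add [symmetric] by simp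
    qed
    finally show ?thesis by (simp only: norm_f \<delta>_def)
  qed
  moreover obtain p where p: "p < -1" and "vertical_rate e (\<delta>) \<in> O[at_infinity](\<lambda>\<tau>. \<bar>\<tau>\<bar> powr p)"
  proof (cases "\<delta> > 0")
    case True
    hence "(\<lambda>t :: real. t powr e * exp (- \<delta> * t)) \<in> O(\<lambda>t. t powr (-2))" by real_asymp
    moreover have "filterlim (\<lambda>\<tau> :: real. \<bar>\<tau>\<bar>) at_top at_infinity"
      unfolding real_norm_def [symmetric] by (rule filterlim_norm_at_top)
    ultimately have "(\<lambda>t :: real. \<bar>t\<bar> powr e * exp (- \<delta> * \<bar>t\<bar>)) \<in> O[at_infinity](\<lambda>t. \<bar>t\<bar> powr (-2))"
      by (rule landau_o.big.compose)
    hence "vertical_rate e \<delta> \<in> O[at_infinity](\<lambda>t. \<bar>t\<bar> powr (-2))"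
      unfolding vertical_rate_def [abs_def] .
    thus ?thesis by (intro that[of "-2"]) simp_all
  next
    case False
    with conv' have "\<delta> = 0" "e < -1" by auto
    thus ?thesis by (intro that[of e]) (simp_all add: vertical_rate_def [abs_def])
  qed
  ultimately have tail: "(\<lambda>\<tau>. norm (f \<tau>)) \<in> O[at_infinity](\<lambda>\<tau>. \<bar>\<tau>\<bar> powr p)"
    using landau_o.big_trans by blast
  have "integrable lborel f"
  proof (rule integrable_of_tail_bound[OF _ _ tail p])
    show "f \<in> borel_measurable borel"
      unfolding f_def by (intro borel_measurable_times measurable_I_kernel[OF br us ls] borel_measurable_continuous_onI continuous_intros)
    show "continuous_on UNIV (\<lambda>\<tau>. norm (f \<tau>))"
      unfolding norm_f by (intro continuous_intros continuous_norm_I_kernel[OF br us ls sep])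
  qed
  thus ?thesis unfolding f_def [abs_def] .
qed


section \<open>The fractional integral of the I-function\<close>

text \<open>
  The factor by which the fractional integral multiplies \<open>t\<^bsup>\<rho>-1\<^esup>\<close>, apart from a power of \<open>x\<close>. The
  reciprocals of \<open>\<Gamma>\<close> in it may vanish.
\<close>

definition msm_multiplier ::
  "complex \<Rightarrow> complex \<Rightarrow> complex \<Rightarrow> complex \<Rightarrow> complex \<Rightarrow> complex \<Rightarrow> complex" where
  "msm_multiplier \<alpha> \<alpha>' \<beta> \<beta>' \<gamma> \<rho> =
     Gamma \<rho> * Gamma (\<rho> + \<beta>' - \<alpha>') * Gamma (\<rho> + \<gamma> - \<alpha> - \<alpha>' - \<beta>) *
     rGamma (\<rho> + \<beta>') * rGamma (\<rho> + \<gamma> - \<alpha> - \<alpha>') * rGamma (\<rho> + \<gamma> - \<alpha>' - \<beta>)"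

text \<open>
  The new triples have exponent \<open>1\<close>, for which the value of \<open>\<Gamma>\<^sup>\<kappa>\<close> is that of \<open>\<Gamma>\<close> whatever the branch.
\<close>

lemma I_kernel_extend:
  assumes br: "log_Gamma_branch \<Lambda>" and m: "m \<le> length ls" and s: "Re s = 0"
  shows "I_kernel \<Lambda> m (n + 3)
      ([(1 - \<rho>, \<mu>, 1), (1 + \<alpha>' - \<beta>' - \<rho>, \<mu>, 1), (1 + \<alpha> + \<alpha>' + \<beta> - \<gamma> - \<rho>, \<mu>, 1)] @ us)
      (ls @ [(1 - \<beta>' - \<rho>, \<mu>, 1), (1 + \<alpha> + \<alpha>' - \<gamma> - \<rho>, \<mu>, 1), (1 + \<alpha>' + \<beta> - \<gamma> - \<rho>, \<mu>, 1)]) s =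
    I_kernel \<Lambda> m n us ls s * msm_multiplier \<alpha> \<alpha>' \<beta> \<beta>' \<gamma> (\<rho> - of_real \<mu> * s)"
proof -
  have lists: "take m (ls @ X) = take m ls" "drop m (ls @ X) = drop m ls @ X"
    "take (n + 3) ([u1, u2, u3] @ us) = [u1, u2, u3] @ take n us" "drop (n + 3) ([u1, u2, u3] @ us) = drop n us"
    for X and u1 u2 u3 :: triple
    using m by (simp_all add: numeral_3_eq_3)
  have e: "1 - (1 - \<rho>) + of_real (- \<mu>) * s = \<rho> - of_real \<mu> * s"
    "1 - (1 + \<alpha>' - \<beta>' - \<rho>) + of_real (- \<mu>) * s = \<rho> - of_real \<mu> * s + \<beta>' - \<alpha>'"
    "1 - (1 + \<alpha> + \<alpha>' + \<beta> - \<gamma> - \<rho>) + of_real (- \<mu>) * s = \<rho> - of_real \<mu> * s + \<gamma> - \<alpha> - \<alpha>' - \<beta>"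
    "1 - (1 - \<beta>' - \<rho>) + of_real (- \<mu>) * s = \<rho> - of_real \<mu> * s + \<beta>'"
    "1 - (1 + \<alpha> + \<alpha>' - \<gamma> - \<rho>) + of_real (- \<mu>) * s = \<rho> - of_real \<mu> * s + \<gamma> - \<alpha> - \<alpha>'"
    "1 - (1 + \<alpha>' + \<beta> - \<gamma> - \<rho>) + of_real (- \<mu>) * s = \<rho> - of_real \<mu> * s + \<gamma> - \<alpha>' - \<beta>"
    by simp_all
  show ?thesis
    unfolding I_kernel_def lists
    by (simp only: map_append prod_list.append list.map prod_list.Cons prod_list.Nil prod.case Gamma_pow_1[OF br s] e)
       (simp only: msm_multiplier_def rGamma_inverse_Gamma divide_inverse inverse_mult_distrib
         mult_1_left mult_1_right inverse_1 mult_ac)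
qed

text \<open>
  On the positive half-line the dependence of the I-function on \<open>t\<close> is confined to the factor
  \<open>t\<^bsup>-\<mu>s\<^esup>\<close> with \<open>s = i \<tau>\<close>, written as an exponential.
\<close>

lemma I_fun_monomial:
  assumes "a \<noteq> 0" "t > 0"
  shows "I_fun \<Lambda> m n us ls \<theta> (a * of_real (t powr \<mu>)) = 1 / (2 * of_real pi) *
    (\<integral>\<tau>. I_kernel \<Lambda> m n us ls (\<i> * of_real \<tau>) *
       exp (- (\<i> * of_real \<tau>) * (of_real (ln (cmod a)) + \<i> * of_real \<theta>)) *
       exp (- (\<i> * of_real (\<mu> * \<tau>)) * of_real (ln t)) \<partial>lborel)"
proof -
  have "cmod (a * of_real (t powr \<mu>)) = cmod a * t powr \<mu>"
    by (simp add: norm_mult)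
  hence "ln (cmod (a * of_real (t powr \<mu>))) = ln (cmod a) + \<mu> * ln t"
    using assms by (simp add: ln_mult ln_powr)
  hence "I_fun \<Lambda> m n us ls \<theta> (a * of_real (t powr \<mu>)) = 1 / (2 * of_real pi * \<i>) *
    (\<integral>\<tau>. (I_kernel \<Lambda> m n us ls (\<i> * of_real \<tau>) *
       exp (- (\<i> * of_real \<tau>) * (of_real (ln (cmod a)) + \<i> * of_real \<theta>)) *
       exp (- (\<i> * of_real (\<mu> * \<tau>)) * of_real (ln t))) * \<i> \<partial>lborel)"
    unfolding I_fun_def mult.assoc exp_add [symmetric]
    by (intro arg_cong2[of _ _ _ _ "(*)"] refl Bochner_Integration.integral_cong arg_cong[of _ _ exp])
       (simp_all add: algebra_simps)
  thus ?thesis by simp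
qed

theorem theorem3p1:
  fixes \<alpha> \<alpha>' \<beta> \<beta>' \<gamma> \<rho> a :: complex
    and \<mu> \<theta> :: real
    and m n :: nat
    and us ls U L :: "triple list"
    and \<Lambda> :: branch
    and f :: "real \<Rightarrow> complex"
  defines "U \<equiv> [(1 - \<rho>, \<mu>, 1),
                (1 + \<alpha>' - \<beta>' - \<rho>, \<mu>, 1),
                (1 + \<alpha> + \<alpha>' + \<beta> - \<gamma> - \<rho>, \<mu>, 1)] @ us"
    and "L \<equiv> ls @ [(1 - \<beta>' - \<rho>, \<mu>, 1),
                   (1 + \<alpha> + \<alpha>' - \<gamma> - \<rho>, \<mu>, 1),
                   (1 + \<alpha>' + \<beta> - \<gamma> - \<rho>, \<mu>, 1)]"
    and "f \<equiv> (\<lambda>t. of_real t powr (\<rho> - 1) * I_fun \<Lambda> m n us ls \<theta> (a * of_real (t powr \<mu>)))"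
  assumes "a \<noteq> 0"
    and "a = rcis (cmod a) \<theta>"
    and "Re \<gamma> > 0"
    and "\<mu> > 0"
    and "Re \<rho> > Max {0, Re (\<alpha>' - \<beta>'), Re (\<alpha> + \<alpha>' + \<beta> - \<gamma>)}"
    and "log_Gamma_branch \<Lambda>"
    and "I_admissible m n us ls \<theta>"
    and "I_admissible m (n + 3) U L \<theta>"
  shows "\<forall>x>0. msm_exists \<alpha> \<alpha>' \<beta> \<beta>' \<gamma> f x \<and>
           msm_integral \<alpha> \<alpha>' \<beta> \<beta>' \<gamma> f x =
             of_real x powr (- \<alpha> - \<alpha>' + \<gamma> + \<rho> - 1) *
             I_fun \<Lambda> m (n + 3) U L \<theta> (a * of_real (x powr \<mu>))"
proof (intro allI impI)
  fix x :: real assume x: "x > 0"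
  note a = \<open>a \<noteq> 0\<close> and g = \<open>Re \<gamma> > 0\<close> and br = \<open>log_Gamma_branch \<Lambda>\<close> and adm = \<open>I_admissible m n us ls \<theta>\<close>
  have m: "m \<le> length ls" using adm by (simp add: I_admissible_def)
  have rho: "Re \<rho> > 0" "Re (\<rho> + \<beta>' - \<alpha>') > 0" "Re (\<rho> + \<gamma> - \<alpha> - \<alpha>' - \<beta>) > 0"
    using \<open>Re \<rho> > Max {0, Re (\<alpha>' - \<beta>'), Re (\<alpha> + \<alpha>' + \<beta> - \<gamma>)}\<close> by auto
  have Gamma_gamma: "Gamma \<gamma> \<noteq> 0" using g by (rule Gamma_nonzero_Re_pos)
  define M where "M = msm_integrand \<alpha> \<alpha>' \<beta> \<beta>' \<gamma>"
  define r where "r \<tau> = \<rho> - \<i> * of_real (\<mu> * \<tau>)" for \<tau>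
  define E where "E \<tau> = I_kernel \<Lambda> m n us ls (\<i> * of_real \<tau>) *
    exp (- (\<i> * of_real \<tau>) * (of_real (ln (cmod a)) + \<i> * of_real \<theta>))" for \<tau>
  define P where "P t \<tau> = exp (- (\<i> * of_real (\<mu> * \<tau>)) * of_real (ln t))" for t \<tau>
  define w where "w t = indicator {0<..<x} t *\<^sub>R M (\<lambda>t. of_real t powr (\<rho> - 1)) x t" for t
  have P_powr: "P t \<tau> = of_real t powr (- (\<i> * of_real (\<mu> * \<tau>)))" if "t > 0" for t \<tau>
    using that by (simp add: P_def powr_def Ln_of_real)
  have norm_P: "norm (P t \<tau>) = 1" for t \<tau> by (simp add: P_def)
  have E: "integrable lborel E"
    unfolding E_def [abs_def] by (rule I_fun_integrable[OF br adm])
  have w: "integrable lborel w"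
    using msm_power(1)[OF x g rho] unfolding set_integrable_def w_def [abs_def] M_def .
  have meas[measurable]: "E \<in> borel_measurable borel" "w \<in> borel_measurable borel"
    using E w by (auto dest: borel_measurable_integrable)
  have P_meas: "(\<lambda>z. P (fst z) (snd z)) \<in> borel_measurable (lborel \<Otimes>\<^sub>M lborel)"
    unfolding P_def by measurable
  \<comment> \<open>Since \<open>P t \<tau>\<close> has modulus \<open>1\<close>, \<open>G\<close> is dominated by a product of integrable functions of \<open>t\<close> and \<open>\<tau>\<close>.\<close>
  define G where "G t \<tau> = w t * (E \<tau> * P t \<tau>)" for t \<tau>
  have G: "integrable (lborel \<Otimes>\<^sub>M lborel) (\<lambda>(t, \<tau>). G t \<tau>)"
  proof (rule lborel_pair.Fubini_integrable)
    have "(\<lambda>z. w (fst z) * (E (snd z) * P (fst z) (snd z))) \<in> borel_measurable (lborel \<Otimes>\<^sub>M lborel)"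
      using P_meas by measurable
    thus "(\<lambda>(t, \<tau>). G t \<tau>) \<in> borel_measurable (lborel \<Otimes>\<^sub>M lborel)"
      by (simp add: G_def case_prod_unfold)
    have "(\<lambda>t. \<integral>\<tau>. norm (G t \<tau>) \<partial>lborel) = (\<lambda>t. norm (w t) * (\<integral>\<tau>. norm (E \<tau>) \<partial>lborel))"
      by (simp add: G_def norm_mult norm_P)
    thus "integrable lborel (\<lambda>t. \<integral>\<tau>. norm (case (t, \<tau>) of (t, \<tau>) \<Rightarrow> G t \<tau>) \<partial>lborel)"
      using w by simp
    have "integrable lborel (G t)" for t
    proof (rule Bochner_Integration.integrable_bound)
      show "integrable lborel (\<lambda>\<tau>. w t * E \<tau>)" using E by simp
      show "G t \<in> borel_measurable lborel" unfolding G_def [abs_def] P_def by measurable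
    qed (auto simp: G_def norm_mult norm_P)
    thus "AE t in lborel. integrable lborel (\<lambda>\<tau>. case (t, \<tau>) of (t, \<tau>) \<Rightarrow> G t \<tau>)" by simp
  qed
  \<comment> \<open>Integrating over \<open>\<tau>\<close> first gives the I-function under the fractional integral,\<close>
  have inner: "(\<integral>\<tau>. G t \<tau> \<partial>lborel) = 2 * of_real pi * (indicator {0<..<x} t *\<^sub>R M f x t)" for t
  proof (cases "t \<in> {0<..<x}")
    case True
    hence t: "t > 0" by simp
    have "(\<integral>\<tau>. G t \<tau> \<partial>lborel) = w t * (\<integral>\<tau>. E \<tau> * P t \<tau> \<partial>lborel)" by (simp add: G_def)
    also have "(\<integral>\<tau>. E \<tau> * P t \<tau> \<partial>lborel) = 2 * of_real pi * I_fun \<Lambda> m n us ls \<theta> (a * of_real (t powr \<mu>))"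
      unfolding I_fun_monomial[OF a t] E_def P_def by simp
    also have "w t * \<dots> = 2 * of_real pi * (indicator {0<..<x} t *\<^sub>R M f x t)"
      using True by (simp add: w_def M_def msm_integrand_def f_def)
    finally show ?thesis .
  qed (simp add: G_def w_def)
  have exists: "set_integrable lborel {0<..<x} (M f x)"
  proof -
    have "integrable lborel (\<lambda>t. \<integral>\<tau>. G t \<tau> \<partial>lborel)"
      using lborel_pair.integrable_fst[OF G] by simp
    hence "integrable lborel (\<lambda>t. 1 / (2 * of_real pi) * (2 * complex_of_real pi * (indicator {0<..<x} t *\<^sub>R M f x t)))"
      unfolding inner by (rule integrable_mult_right)
    thus ?thesis unfolding set_integrable_def by simp
  qed
  \<comment> \<open>and integrating over \<open>t\<close> first gives the fractional integral of \<open>t\<^bsup>\<rho>-\<mu>s-1\<^esup>\<close> under the contour integral.\<close>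
  have power: "(\<integral>t. G t \<tau> \<partial>lborel) =
      E \<tau> * (of_real x powr (\<gamma> + r \<tau> - \<alpha>' - 1) * (Gamma \<gamma> * msm_multiplier \<alpha> \<alpha>' \<beta> \<beta>' \<gamma> (r \<tau>)))" for \<tau>
  proof -
    have "(\<integral>t. G t \<tau> \<partial>lborel) = (\<integral>t. E \<tau> * (w t * P t \<tau>) \<partial>lborel)"
      by (simp add: G_def mult_ac)
    also have "\<dots> = E \<tau> * (\<integral>t. w t * P t \<tau> \<partial>lborel)" by simp
    also have "(\<lambda>t. w t * P t \<tau>) = (\<lambda>t. indicator {0<..<x} t *\<^sub>R M (\<lambda>t. of_real t powr (r \<tau> - 1)) x t)"
    proof
      fix t
      show "w t * P t \<tau> = indicator {0<..<x} t *\<^sub>R M (\<lambda>t. of_real t powr (r \<tau> - 1)) x t"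
      proof (cases "t \<in> {0<..<x}")
        case True
        hence "of_real t powr (\<rho> - 1) * P t \<tau> = of_real t powr (r \<tau> - 1)"
          by (simp add: P_powr r_def powr_add [symmetric] algebra_simps)
        thus ?thesis using True by (simp add: w_def M_def msm_integrand_def mult.assoc)
      qed (simp add: w_def)
    qed
    also have "(\<integral>t. indicator {0<..<x} t *\<^sub>R M (\<lambda>t. of_real t powr (r \<tau> - 1)) x t \<partial>lborel) =
        of_real x powr (\<gamma> + r \<tau> - \<alpha>' - 1) * (Gamma \<gamma> * msm_multiplier \<alpha> \<alpha>' \<beta> \<beta>' \<gamma> (r \<tau>))"
      using msm_power(2)[OF x g, of "r \<tau>" \<beta>' \<alpha>' \<alpha> \<beta>] rho
      by (simp add: set_lebesgue_integral_def M_def msm_multiplier_def r_def)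
    finally show ?thesis .
  qed
  have "(LINT t:{0<..<x}|lborel. M f x t) = 1 / (2 * of_real pi) * (\<integral>t. \<integral>\<tau>. G t \<tau> \<partial>lborel \<partial>lborel)"
    unfolding inner set_lebesgue_integral_def integral_mult_right_zero by simp
  also have "(\<integral>t. \<integral>\<tau>. G t \<tau> \<partial>lborel \<partial>lborel) = (\<integral>\<tau>. \<integral>t. G t \<tau> \<partial>lborel \<partial>lborel)"
    by (rule lborel_pair.Fubini_integral[OF G, symmetric])
  also have "\<dots> = (\<integral>\<tau>. (Gamma \<gamma> * of_real x powr (\<gamma> + \<rho> - \<alpha>' - 1)) *
      (E \<tau> * msm_multiplier \<alpha> \<alpha>' \<beta> \<beta>' \<gamma> (r \<tau>) * P x \<tau>) \<partial>lborel)"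
  proof (intro Bochner_Integration.integral_cong refl)
    fix \<tau>
    have "of_real x powr (\<gamma> + r \<tau> - \<alpha>' - 1) = of_real x powr (\<gamma> + \<rho> - \<alpha>' - 1) * P x \<tau>"
      using x by (simp add: P_powr r_def powr_add [symmetric] algebra_simps)
    thus "(\<integral>t. G t \<tau> \<partial>lborel) = (Gamma \<gamma> * of_real x powr (\<gamma> + \<rho> - \<alpha>' - 1)) *
        (E \<tau> * msm_multiplier \<alpha> \<alpha>' \<beta> \<beta>' \<gamma> (r \<tau>) * P x \<tau>)"
      unfolding power by (simp add: mult_ac)
  qed
  also have "\<dots> = Gamma \<gamma> * of_real x powr (\<gamma> + \<rho> - \<alpha>' - 1) *
      (\<integral>\<tau>. E \<tau> * msm_multiplier \<alpha> \<alpha>' \<beta> \<beta>' \<gamma> (r \<tau>) * P x \<tau> \<partial>lborel)"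
    by simp
  also have "(\<integral>\<tau>. E \<tau> * msm_multiplier \<alpha> \<alpha>' \<beta> \<beta>' \<gamma> (r \<tau>) * P x \<tau> \<partial>lborel) =
      2 * of_real pi * I_fun \<Lambda> m (n + 3) U L \<theta> (a * of_real (x powr \<mu>))"
  proof -
    have "I_kernel \<Lambda> m (n + 3) U L (\<i> * of_real \<tau>) = I_kernel \<Lambda> m n us ls (\<i> * of_real \<tau>) *
        msm_multiplier \<alpha> \<alpha>' \<beta> \<beta>' \<gamma> (r \<tau>)" for \<tau>
      unfolding U_def L_def by (subst I_kernel_extend[OF br m]) (simp_all add: r_def mult_ac)
    thus ?thesis unfolding I_fun_monomial[OF a x] E_def P_def by (simp add: mult_ac)
  qed
  finally have integral: "(LINT t:{0<..<x}|lborel. M f x t) =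
      Gamma \<gamma> * of_real x powr (\<gamma> + \<rho> - \<alpha>' - 1) * I_fun \<Lambda> m (n + 3) U L \<theta> (a * of_real (x powr \<mu>))"
    by simp
  have "msm_integral \<alpha> \<alpha>' \<beta> \<beta>' \<gamma> f x = (of_real x powr (- \<alpha>) * of_real x powr (\<gamma> + \<rho> - \<alpha>' - 1)) *
      I_fun \<Lambda> m (n + 3) U L \<theta> (a * of_real (x powr \<mu>))"
    using Gamma_gamma unfolding msm_integral_def M_def [symmetric] integral by simp
  also have "of_real x powr (- \<alpha>) * of_real x powr (\<gamma> + \<rho> - \<alpha>' - 1) = of_real x powr (- \<alpha> - \<alpha>' + \<gamma> + \<rho> - 1)"
    unfolding powr_add [symmetric] by (rule arg_cong[where f = "\<lambda>z. of_real x powr z"]) simp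
  finally show "msm_exists \<alpha> \<alpha>' \<beta> \<beta>' \<gamma> f x \<and> msm_integral \<alpha> \<alpha>' \<beta> \<beta>' \<gamma> f x =
      of_real x powr (- \<alpha> - \<alpha>' + \<gamma> + \<rho> - 1) * I_fun \<Lambda> m (n + 3) U L \<theta> (a * of_real (x powr \<mu>))"
    using exists by (simp add: msm_exists_def M_def)
qed

end
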